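(* There exist absolute constants $c,C>0$ such that for all integers $d\ge 2$ and $n\ge 1$ there is a distribution over $r\times n$ real matrices $\Pi$ with $r\le C d^2$, every matrix in whose support has at most two non-zero entries in each column, such that for every fixed $A\in\mathbb{R}^{n\times d}$, with probability at least $0.99$, simultaneously for all $x\in\mathbb{R}^d$, $$c\log d\,\|Ax\|_1\le\|\Pi Ax\|_1\le C d\log d\,\|Ax\|_1.$$ (In particular, after rescaling, this is an $\ell_1$ oblivious subspace embedding with distortion $O(d)$.)
   Context: $\|y\|_1=\sum_i|y_i|$. The distribution depends only on $n,d$, not on $A$. *)

theory Defs
  imports "HOL-Probability.Probability"
begin

text \<open>Matrices are represented as functions nat \<Rightarrow> nat \<Rightarrow> real (row index, column index);
  only the entries in the relevant index range are used.  Vectors are nat \<Rightarrow> real.\<close>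

definition mat_vec :: "nat \<Rightarrow> (nat \<Rightarrow> nat \<Rightarrow> real) \<Rightarrow> (nat \<Rightarrow> real) \<Rightarrow> nat \<Rightarrow> real" where
  "mat_vec k M x = (\<lambda>i. \<Sum>j<k. M i j * x j)"

definition l1norm :: "nat \<Rightarrow> (nat \<Rightarrow> real) \<Rightarrow> real" where
  "l1norm m y = (\<Sum>i<m. \<bar>y i\<bar>)"

definition sparse_rn_matrix :: "nat \<Rightarrow> nat \<Rightarrow> (nat \<Rightarrow> nat \<Rightarrow> real) \<Rightarrow> bool" where
  "sparse_rn_matrix r n P \<longleftrightarrow>
     (\<forall>i j. (r \<le> i \<or> n \<le> j) \<longrightarrow> P i j = 0) \<and>
     (\<forall>j<n. card {i. i < r \<and> P i j \<noteq> 0} \<le> 2)"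

end

theory Submission
  imports Defs "HOL-Real_Asymp.Real_Asymp"
begin

text \<open>Column \<open>j\<close> of the random matrix has the entry \<open>ln d\<close> in a uniformly random bucket
  \<open>h1 j\<close> and a signed dyadic entry \<open>X j\<close>, with tail probability of order \<open>1/t\<close>, in a second
  random bucket \<open>h2 j\<close>. Approximate Lewis weights \<open>w\<close> of the column space give
  \<open>\<bar>y i\<bar> \<le> 2 * w i * norm y\<close> with total weight at most \<open>2 d\<close>; truncating each \<open>X i\<close> relative to
  \<open>1 / w i\<close>, the upper bound is a first and second moment computation.

  For the lower bound put \<open>d = \<delta> ^ 32\<close>. Rows with \<open>w i < 1 / \<delta> ^ 34\<close> are light. The others are
  polynomially many in \<open>d\<close> and get new weights \<open>w'\<close>, the Lewis weights of the submatrix they form;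
  they are heavy if \<open>w' i \<ge> 1 / \<delta> ^ 5\<close> and medium otherwise. One of three cases applies to each
  vector \<open>y\<close>.
  If almost all mass is heavy, the first half of the matrix keeps it: few heavy rows collide under
  \<open>h1\<close>, and on this random set the reproducing kernel of the column space is small, so no \<open>y\<close> has
  much mass there.
  If the medium mass is substantial, then for fixed \<open>h2\<close> the expected contribution of the second half
  is of order \<open>ln d\<close>, because large entries \<open>X i\<close> are isolated in their buckets at about \<open>ln d\<close>
  dyadic scales. Symmetrization and contraction over buckets bound the deviation uniformly in \<open>y\<close> by
  the supremum of a linear process, which the kernel turns into a maximum of polynomially many
  sub-Gaussian variables.
  If the light mass is substantial, a bounded difference inequality for the bucket sums truncated
  at \<open>1 / \<delta> ^ 33\<close> has failure probability \<open>exp (- (\<delta> ^ 33))\<close>, which survives a union bound over a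
  net.
  Small \<open>d\<close> follow from large \<open>d\<close> by padding with zero columns.\<close>

section \<open>Expectations on finite weighted sets\<close>

text \<open>The powers of \<delta> constrain one another. A net of the column space has about
  \<open>exp (\<delta> ^ 32 * ln \<delta>)\<close> points, up to constants in the exponent, so the
  concentration for light rows needs the truncation level \<open>1 / \<delta> ^ 33\<close>. A
  further factor \<delta> between the light entries and this level supplies about
  \<open>log 2 \<delta>\<close> dyadic scales; hence the threshold \<open>1 / \<delta> ^ 34\<close>,
  which is \<open>1 / (d * \<delta> ^ 2)\<close>. A bucket may then hold about
  \<open>\<delta> ^ 2\<close> medium rows, so medium entries are isolated only from size
  \<open>\<delta> ^ 2\<close> on, and the scales up to \<open>\<delta> ^ 3\<close> are used. Sums of
  entries truncated there have exponential moments at rate \<delta> if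
  \<open>\<delta> ^ 5 * w' i\<close> is bounded, which fixes the heavy threshold. Pairs of
  collisions among heavy rows then cost \<open>\<delta> ^ 15\<close> against
  \<open>sqrt d = \<delta> ^ 16\<close>, so the exponent 32 suffices. The medium rows get weights of
  their own because the kernel of the submatrix bounds their process by a maximum over its rows; the
  kernel of the full matrix would give a maximum over all n rows, and n is not bounded in terms of
  d.\<close>

definition fin_prob :: "'a set \<Rightarrow> ('a \<Rightarrow> real) \<Rightarrow> bool" where
  "fin_prob S p \<longleftrightarrow> finite S \<and> (\<forall>a\<in>S. 0 \<le> p a) \<and> sum p S = 1"

text \<open>All random choices range over finite sets, so expectations are finite sums without
  measurability or integrability conditions. A measure appears only at the end, in
  \<open>finite_prob_image\<close>.\<close>

definition expect :: "'a set \<Rightarrow> ('a \<Rightarrow> real) \<Rightarrow> ('a \<Rightarrow> real) \<Rightarrow> real" where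
  "expect S p f = (\<Sum>a\<in>S. p a * f a)"

definition wprod :: "'i set \<Rightarrow> ('a \<Rightarrow> real) \<Rightarrow> ('i \<Rightarrow> 'a) \<Rightarrow> real" where
  "wprod I p f = (\<Prod>i\<in>I. p (f i))"

lemma fin_probD: "fin_prob S p \<Longrightarrow> finite S" "fin_prob S p \<Longrightarrow> a \<in> S \<Longrightarrow> 0 \<le> p a" "fin_prob S p \<Longrightarrow> sum p S = 1"
  by (auto simp: fin_prob_def)

lemma expect_cong: "(\<And>a. a \<in> S \<Longrightarrow> f a = g a) \<Longrightarrow> expect S p f = expect S p g"
  by (simp add: expect_def)

lemma expect_add: "expect S p (\<lambda>a. f a + g a) = expect S p f + expect S p g"
  by (simp add: expect_def distrib_left sum.distrib)

lemma expect_diff: "expect S p (\<lambda>a. f a - g a) = expect S p f - expect S p g"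
  by (simp add: expect_def right_diff_distrib sum_subtractf)

lemma expect_cmult: "expect S p (\<lambda>a. c * f a) = c * expect S p f"
  by (simp add: expect_def sum_distrib_left mult.left_commute)

lemma expect_multc: "expect S p (\<lambda>a. f a * c) = expect S p f * c"
  by (simp add: expect_def sum_distrib_right mult.assoc)

lemma expect_sum: "expect S p (\<lambda>a. \<Sum>b\<in>B. f a b) = (\<Sum>b\<in>B. expect S p (\<lambda>a. f a b))"
  unfolding expect_def sum_distrib_left by (rule sum.swap)

lemma expect_const: "fin_prob S p \<Longrightarrow> expect S p (\<lambda>_. c) = c"
  by (simp add: expect_def fin_prob_def flip: sum_distrib_right)

lemma expect_mono: "fin_prob S p \<Longrightarrow> (\<And>a. a \<in> S \<Longrightarrow> f a \<le> g a) \<Longrightarrow> expect S p f \<le> expect S p g"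
  unfolding expect_def by (intro sum_mono mult_left_mono) (auto simp: fin_prob_def)

lemma expect_nonneg: "fin_prob S p \<Longrightarrow> (\<And>a. a \<in> S \<Longrightarrow> 0 \<le> f a) \<Longrightarrow> 0 \<le> expect S p f"
  unfolding expect_def by (intro sum_nonneg mult_nonneg_nonneg) (auto simp: fin_prob_def)

lemma expect_le_const: "fin_prob S p \<Longrightarrow> (\<And>a. a \<in> S \<Longrightarrow> f a \<le> c) \<Longrightarrow> expect S p f \<le> c"
  using expect_mono[of S p f "\<lambda>_. c"] by (simp add: expect_const)

lemma expect_swap: "expect S p (\<lambda>a. expect T q (\<lambda>b. f a b)) = expect T q (\<lambda>b. expect S p (\<lambda>a. f a b))"
  unfolding expect_def sum_distrib_left by (subst sum.swap) (simp add: mult.left_commute)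

lemma expect_markov:
  assumes "fin_prob S p" "0 < t" "\<And>a. a \<in> S \<Longrightarrow> 0 \<le> f a" "\<And>a. a \<in> S \<Longrightarrow> P a \<Longrightarrow> t \<le> f a"
  shows "expect S p (\<lambda>a. of_bool (P a)) \<le> expect S p f / t"
proof -
  have "expect S p (\<lambda>a. of_bool (P a)) \<le> expect S p (\<lambda>a. f a / t)"
    using assms by (intro expect_mono) (auto simp: field_simps)
  also have "\<dots> = expect S p f / t"
    using expect_multc[of S p f "1/t"] by (simp add: divide_inverse)
  finally show ?thesis .
qed

lemma expect_union_bound:
  assumes "fin_prob S p" "finite B" "\<And>a. a \<in> S \<Longrightarrow> P a \<Longrightarrow> \<exists>b\<in>B. Q b a"
  shows "expect S p (\<lambda>a. of_bool (P a)) \<le> (\<Sum>b\<in>B. expect S p (\<lambda>a. of_bool (Q b a)))"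
proof -
  have "of_bool (P a) \<le> (\<Sum>b\<in>B. of_bool (Q b a) :: real)" if "a \<in> S" for a
  proof (cases "P a")
    case True
    then obtain b where b: "b \<in> B" "Q b a" using assms(3) \<open>a \<in> S\<close> by blast
    have "of_bool (Q b a) \<le> (\<Sum>b\<in>B. of_bool (Q b a) :: real)"
      using b assms(2) by (intro member_le_sum) auto
    then show ?thesis using b by simp
  qed (simp add: sum_nonneg)
  then have "expect S p (\<lambda>a. of_bool (P a)) \<le> expect S p (\<lambda>a. \<Sum>b\<in>B. of_bool (Q b a))"
    by (intro expect_mono[OF assms(1)])
  then show ?thesis by (simp add: expect_sum)
qed

lemma expect_or:
  assumes "fin_prob S p" "\<And>a. a \<in> S \<Longrightarrow> P a \<Longrightarrow> Q a \<or> R a"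
  shows "expect S p (\<lambda>a. of_bool (P a)) \<le> expect S p (\<lambda>a. of_bool (Q a)) + expect S p (\<lambda>a. of_bool (R a))"
  unfolding expect_add[symmetric] using assms by (intro expect_mono) auto

text \<open>A linear substitute for Jensen's inequality, from
  \<open>sqrt u \<le> (u / t + t) / 2\<close>. With one common \<open>t\<close> the bounds for many
  buckets can be added when only the sum of their second moments is known.\<close>

lemma expect_sqrt_le:
  assumes "fin_prob S p" "\<And>a. a \<in> S \<Longrightarrow> 0 \<le> f a" "0 < t"
  shows "expect S p (\<lambda>a. sqrt (f a)) \<le> (expect S p f / t + t) / 2"
proof -
  have "sqrt u \<le> (u / t + t) / 2" if "0 \<le> u" for u
  proof -
    have "0 \<le> (sqrt u - t)\<^sup>2" by simp
    then have "2 * t * sqrt u \<le> u + t\<^sup>2"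
      using that by (simp add: power2_diff mult_ac)
    then show ?thesis using \<open>0 < t\<close> by (simp add: field_simps power2_eq_square)
  qed
  then have "expect S p (\<lambda>a. sqrt (f a)) \<le> expect S p (\<lambda>a. (1 / (2*t)) * f a + t/2)"
    using assms by (intro expect_mono) (auto simp: field_simps)
  also have "\<dots> = (expect S p f / t + t) / 2"
    unfolding expect_add expect_cmult expect_const[OF assms(1)] using assms(3) by (simp add: field_simps)
  finally show ?thesis .
qed

section \<open>Product weights and independence of coordinates\<close>

lemma expect_Times:
  "expect (S \<times> T) (\<lambda>(a,b). p a * q b) f = expect S p (\<lambda>a. expect T q (\<lambda>b. f (a,b)))"
  unfolding expect_def sum_distrib_left
  by (simp add: sum.cartesian_product case_prod_beta mult.assoc)

lemma fin_prob_Times: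
  assumes "fin_prob S p" "fin_prob T q"
  shows "fin_prob (S \<times> T) (\<lambda>(a,b). p a * q b)"
proof -
  have "expect (S \<times> T) (\<lambda>(a,b). p a * q b) (\<lambda>_. 1) = 1"
    using assms by (simp add: expect_Times expect_const)
  then show ?thesis using assms unfolding fin_prob_def expect_def by auto
qed

lemma expect_PiE_insert:
  assumes "finite I" "i \<notin> I"
  shows "expect (PiE (insert i I) (\<lambda>_. S)) (wprod (insert i I) p) F =
         expect S p (\<lambda>a. expect (PiE I (\<lambda>_. S)) (wprod I p) (\<lambda>g. F (g(i := a))))"
proof -
  have inj: "inj_on (\<lambda>(y, g). g(i := y)) (S \<times> PiE I (\<lambda>_. S))"
    using inj_combinator[OF assms(2), of "\<lambda>_. S"] by simp
  have "wprod (insert i I) p (g(i := a)) = p a * wprod I p g" for g a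
    using assms by (auto simp: wprod_def intro!: prod.cong)
  then show ?thesis
    unfolding expect_def PiE_insert_eq
    by (subst sum.reindex[OF inj])
       (simp add: sum.cartesian_product case_prod_beta sum_distrib_left mult.assoc)
qed

lemma fin_prob_PiE:
  assumes "finite I" "fin_prob S p"
  shows "fin_prob (PiE I (\<lambda>_. S)) (wprod I p)"
proof -
  have "expect (PiE I (\<lambda>_. S)) (wprod I p) (\<lambda>_. 1) = 1"
    using assms(1)
  proof (induction I rule: finite_induct)
    case empty then show ?case by (simp add: expect_def wprod_def)
  next
    case (insert i I) then show ?case by (simp add: expect_PiE_insert expect_const[OF assms(2)])
  qed
  then show ?thesis
    using assms unfolding fin_prob_def expect_def wprod_def
    by (auto intro!: finite_PiE prod_nonneg)
qed

text \<open>Independence in the form in which it is applied: to condition on all coordinates other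
  than \<open>i\<close>, replace coordinate \<open>i\<close> by a fresh copy and average over the
  copy first.\<close>

lemma expect_resample:
  assumes "finite I" "i \<in> I" "fin_prob S p"
  shows "expect (PiE I (\<lambda>_. S)) (wprod I p) F =
         expect (PiE I (\<lambda>_. S)) (wprod I p) (\<lambda>g. expect S p (\<lambda>a. F (g(i := a))))"
proof -
  let ?J = "I - {i}"
  have I: "I = insert i ?J" using assms(2) by auto
  have f: "finite ?J" "i \<notin> ?J" using assms(1) by auto
  have "expect (PiE I (\<lambda>_. S)) (wprod I p) (\<lambda>g. expect S p (\<lambda>a. F (g(i := a)))) =
     expect (PiE (insert i ?J) (\<lambda>_. S)) (wprod (insert i ?J) p) (\<lambda>g. expect S p (\<lambda>a. F (g(i := a))))"
    using I by simp
  also have "\<dots> = expect (PiE ?J (\<lambda>_. S)) (wprod ?J p) (\<lambda>g. expect S p (\<lambda>a. F (g(i := a))))"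
    unfolding expect_PiE_insert[OF f] by (simp add: expect_const[OF assms(3)])
  also have "\<dots> = expect (PiE (insert i ?J) (\<lambda>_. S)) (wprod (insert i ?J) p) F"
    unfolding expect_PiE_insert[OF f] by (rule expect_swap)
  finally show ?thesis using I by simp
qed

lemma expect_coord:
  assumes "finite I" "i \<in> I" "fin_prob S p"
  shows "expect (PiE I (\<lambda>_. S)) (wprod I p) (\<lambda>g. f (g i)) = expect S p f"
  by (subst expect_resample[OF assms]) (simp add: expect_const fin_prob_PiE assms)

lemma expect_coord_mult:
  assumes "finite I" "i \<in> I" "fin_prob S p" "\<And>g a. G (g(i := a)) = G g"
  shows "expect (PiE I (\<lambda>_. S)) (wprod I p) (\<lambda>g. f (g i) * G g) = expect S p f * expect (PiE I (\<lambda>_. S)) (wprod I p) G"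
  by (subst expect_resample[OF assms(1-3)]) (simp add: assms(4) expect_multc expect_cmult)

lemma expect_coord_two:
  assumes "finite I" "i \<in> I" "j \<in> I" "i \<noteq> j" "fin_prob S p"
  shows "expect (PiE I (\<lambda>_. S)) (wprod I p) (\<lambda>g. f1 (g i) * f2 (g j)) = expect S p f1 * expect S p f2"
  using expect_coord_mult[OF assms(1,2,5), of "\<lambda>g. f2 (g j)" f1] expect_coord[OF assms(1,3,5), of f2] assms(4)
  by simp

lemma expect_prod:
  assumes "finite I" "J \<subseteq> I" "fin_prob S p"
  shows "expect (PiE I (\<lambda>_. S)) (wprod I p) (\<lambda>g. \<Prod>i\<in>J. f i (g i)) = (\<Prod>i\<in>J. expect S p (f i))"
  using finite_subset[OF assms(2,1)] assms(2)
proof (induction J rule: finite_induct)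
  case empty then show ?case by (simp add: expect_const fin_prob_PiE assms)
next
  case (insert j J)
  have eq: "(\<Prod>i\<in>J. f i ((g(j := a)) i)) = (\<Prod>i\<in>J. f i (g i))" for g a
    using insert by (intro prod.cong) auto
  have "expect (PiE I (\<lambda>_. S)) (wprod I p) (\<lambda>g. f j (g j) * (\<Prod>i\<in>J. f i (g i)))
     = expect S p (f j) * expect (PiE I (\<lambda>_. S)) (wprod I p) (\<lambda>g. \<Prod>i\<in>J. f i (g i))"
    using insert by (intro expect_coord_mult assms eq) auto
  then show ?case using insert by simp
qed

lemma expect_reindex:
  assumes "bij_betw \<pi> S S" "\<And>a. a \<in> S \<Longrightarrow> p (\<pi> a) = p a"
  shows "expect S p (\<lambda>a. F (\<pi> a)) = expect S p F"
proof -
  have "(\<Sum>a\<in>S. p (\<pi> a) * F (\<pi> a)) = (\<Sum>a\<in>S. p a * F a)"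
    using assms(1) by (rule sum.reindex_bij_betw)
  then show ?thesis using assms(2) by (simp add: expect_def)
qed

text \<open>Concentration for light rows treats the bucket and the entry of a row as one random
  coordinate, whereas the sketch draws them as two independent families. This identity passes
  between the two views.\<close>

lemma expect_PiE_pair:
  assumes "finite I"
  shows "expect (PiE I (\<lambda>_. S \<times> T)) (wprod I (\<lambda>(a,b). p a * q b)) (\<lambda>g. F (\<lambda>i\<in>I. fst (g i)) (\<lambda>i\<in>I. snd (g i)))
   = expect (PiE I (\<lambda>_. S)) (wprod I p) (\<lambda>f. expect (PiE I (\<lambda>_. T)) (wprod I q) (\<lambda>g. F f g))"
  using assms
proof (induction I arbitrary: F rule: finite_induct)
  case empty
  then show ?case by (simp add: expect_def wprod_def restrict_def)
next
  case (insert i I)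
  have eq: "(\<lambda>j\<in>insert i I. fst ((g(i := ab)) j)) = (\<lambda>j\<in>I. fst (g j))(i := fst ab)"
     "(\<lambda>j\<in>insert i I. snd ((g(i := ab)) j)) = (\<lambda>j\<in>I. snd (g j))(i := snd ab)" for g :: "'a \<Rightarrow> 'b \<times> 'c" and ab
    using insert by (auto simp: restrict_def fun_eq_iff)
  have "expect (PiE (insert i I) (\<lambda>_. S \<times> T)) (wprod (insert i I) (\<lambda>(a,b). p a * q b)) (\<lambda>g. F (\<lambda>i\<in>insert i I. fst (g i)) (\<lambda>i\<in>insert i I. snd (g i)))
    = expect (S \<times> T) (\<lambda>(a,b). p a * q b) (\<lambda>ab. expect (PiE I (\<lambda>_. S)) (wprod I p) (\<lambda>f. expect (PiE I (\<lambda>_. T)) (wprod I q) (\<lambda>g. F (f(i:=fst ab)) (g(i:=snd ab)))))"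
    unfolding expect_PiE_insert[OF insert(1,2)] eq
    by (intro expect_cong insert.IH[of "\<lambda>f g. F (f(i:=fst ab)) (g(i:=snd ab))" for ab])
  also have "\<dots> = expect S p (\<lambda>a. expect (PiE I (\<lambda>_. S)) (wprod I p) (\<lambda>f. expect T q (\<lambda>b. expect (PiE I (\<lambda>_. T)) (wprod I q) (\<lambda>g. F (f(i:=a)) (g(i:=b))))))"
    unfolding expect_Times fst_conv snd_conv by (intro expect_cong expect_swap)
  finally show ?case unfolding expect_PiE_insert[OF insert(1,2)] .
qed

section \<open>Approximate Lewis weights\<close>

definition wip :: "'i set \<Rightarrow> ('i \<Rightarrow> real) \<Rightarrow> ('i \<Rightarrow> real) \<Rightarrow> ('i \<Rightarrow> real) \<Rightarrow> real" where
  "wip I w f g = (\<Sum>i\<in>I. f i * g i / w i)"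

definition onb :: "nat set \<Rightarrow> (nat \<Rightarrow> real) \<Rightarrow> nat \<Rightarrow> (nat \<Rightarrow> nat \<Rightarrow> real) \<Rightarrow> (nat \<Rightarrow> nat \<Rightarrow> real) \<Rightarrow> bool" where
  "onb I w d A e \<longleftrightarrow>
     (\<forall>l<d. e l \<in> range (mat_vec d A)) \<and>
     (\<forall>l<d. \<forall>k<d. l \<noteq> k \<longrightarrow> wip I w (e l) (e k) = 0) \<and>
     (\<forall>l<d. wip I w (e l) (e l) \<in> {0, 1}) \<and>
     (\<forall>y\<in>range (mat_vec d A). \<forall>i\<in>I. y i = (\<Sum>l<d. wip I w (e l) y * e l i))"

lemma wip_commute: "wip I w f g = wip I w g f"
  by (simp add: wip_def mult.commute)

lemma wip_add: "wip I w f (\<lambda>i. g i + h i) = wip I w f g + wip I w f h"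
  by (simp add: wip_def algebra_simps add_divide_distrib sum.distrib)

lemma wip_scale: "wip I w f (\<lambda>i. c * g i) = c * wip I w f g"
  by (simp add: wip_def sum_distrib_left mult_ac)

lemma wip_minus: "wip I w f (\<lambda>i. - g i) = - wip I w f g"
  by (simp add: wip_def sum_negf)

lemma wip_sum: "wip I w f (\<lambda>i. \<Sum>l\<in>J. g l i) = (\<Sum>l\<in>J. wip I w f (g l))"
  unfolding wip_def sum_distrib_left sum_divide_distrib by (rule sum.swap)

lemma wip_cong: "(\<And>i. i \<in> I \<Longrightarrow> f i = f' i) \<Longrightarrow> (\<And>i. i \<in> I \<Longrightarrow> g i = g' i) \<Longrightarrow> wip I w f g = wip I w f' g'"
  by (simp add: wip_def)

lemma wip_self_nonneg: "(\<And>i. i \<in> I \<Longrightarrow> 0 < w i) \<Longrightarrow> 0 \<le> wip I w f f"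
  unfolding wip_def by (intro sum_nonneg) (auto simp: zero_le_mult_iff less_imp_le intro!: divide_nonneg_pos)

lemma wip_self_eq_0:
  assumes "finite I" "\<And>i. i \<in> I \<Longrightarrow> 0 < w i" "wip I w f f = 0" "i \<in> I"
  shows "f i = 0"
proof -
  have "\<forall>i\<in>I. f i * f i / w i = 0"
    using assms by (subst sum_nonneg_eq_0_iff[symmetric]) (auto simp: wip_def intro!: divide_nonneg_pos)
  then show ?thesis using assms(2,4) by fastforce
qed

lemma mat_vec_Suc: "mat_vec (Suc d) A x = (\<lambda>i. mat_vec d A x i + x d * A i d)"
  by (simp add: mat_vec_def fun_eq_iff)

lemma mat_vec_cong: "(\<And>j. j < d \<Longrightarrow> x j = x' j) \<Longrightarrow> mat_vec d A x = mat_vec d A x'"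
  by (simp add: mat_vec_def)

lemma mat_vec_add: "(\<lambda>i. mat_vec d A x i + mat_vec d A x' i) = mat_vec d A (\<lambda>j. x j + x' j)"
  by (simp add: mat_vec_def fun_eq_iff algebra_simps sum.distrib)

lemma mat_vec_scale: "(\<lambda>i. c * mat_vec d A x i) = mat_vec d A (\<lambda>j. c * x j)"
  by (simp add: mat_vec_def fun_eq_iff sum_distrib_left mult_ac)

lemma mat_vec_zero: "mat_vec d A (\<lambda>_. 0) = (\<lambda>_. 0)"
  by (simp add: mat_vec_def)

lemma range_mat_vec_add:
  "y \<in> range (mat_vec d A) \<Longrightarrow> z \<in> range (mat_vec d A) \<Longrightarrow> (\<lambda>i. y i + z i) \<in> range (mat_vec d A)"
  by (auto simp: mat_vec_add)

lemma range_mat_vec_scale: "y \<in> range (mat_vec d A) \<Longrightarrow> (\<lambda>i. c * y i) \<in> range (mat_vec d A)"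
  by (auto simp: mat_vec_scale)

lemma range_mat_vec_zero: "(\<lambda>_. 0) \<in> range (mat_vec d A)"
  using mat_vec_zero by (metis rangeI)

lemma range_mat_vec_sum:
  "finite J \<Longrightarrow> (\<And>l. l \<in> J \<Longrightarrow> y l \<in> range (mat_vec d A)) \<Longrightarrow> (\<lambda>i. \<Sum>l\<in>J. y l i) \<in> range (mat_vec d A)"
  by (induction J rule: finite_induct) (auto intro: range_mat_vec_zero range_mat_vec_add)

lemma range_mat_vec_Suc: "range (mat_vec d A) \<subseteq> range (mat_vec (Suc d) A)"
proof
  fix y assume "y \<in> range (mat_vec d A)"
  then obtain x where x: "y = mat_vec d A x" by auto
  have "mat_vec (Suc d) A (x(d := 0)) = y"
    using mat_vec_cong[of d "x(d := 0)" x A] by (simp add: mat_vec_Suc x)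
  then show "y \<in> range (mat_vec (Suc d) A)" by (metis rangeI)
qed

lemma gram_schmidt:
  assumes fin: "finite I" and w: "\<And>i. i \<in> I \<Longrightarrow> 0 < w i"
  shows "\<exists>e. onb I w d A e"
proof (induction d)
  case 0
  show ?case by (rule exI[of _ "\<lambda>_ _. 0"]) (auto simp: onb_def mat_vec_def)
next
  case (Suc d)
  then obtain e where "onb I w d A e" by blast
  then have eY: "\<And>l. l < d \<Longrightarrow> e l \<in> range (mat_vec d A)"
    and orth: "\<And>l k. l < d \<Longrightarrow> k < d \<Longrightarrow> l \<noteq> k \<Longrightarrow> wip I w (e l) (e k) = 0"
    and nrm: "\<And>l. l < d \<Longrightarrow> wip I w (e l) (e l) = 0 \<or> wip I w (e l) (e l) = 1"
    and rep: "\<And>y i. y \<in> range (mat_vec d A) \<Longrightarrow> i \<in> I \<Longrightarrow> y i = (\<Sum>l<d. wip I w (e l) y * e l i)"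
    by (auto simp: onb_def)
  define a where "a = (\<lambda>i. A i d)"
  define c where "c = (\<lambda>l. wip I w (e l) a)"
  define b where "b = (\<lambda>i. a i + (\<Sum>l<d. (- c l) * e l i))"
  define N where "N = wip I w b b"
  \<comment> \<open>A residual of norm 0 is replaced by the zero vector instead of being
    normalized.\<close>
  define s where "s = (if N = 0 then 0 else 1 / sqrt N)"
  define f where "f = (\<lambda>i. s * b i)"
  have N0: "N \<ge> 0" unfolding N_def by (rule wip_self_nonneg[OF w])
  have aY: "a \<in> range (mat_vec (Suc d) A)"
  proof -
    have "mat_vec (Suc d) A (\<lambda>j. if j = d then 1 else 0) = a"
      by (auto simp: mat_vec_def a_def fun_eq_iff)
    then show ?thesis by (metis rangeI)
  qed
  have eY': "e l \<in> range (mat_vec (Suc d) A)" if "l < d" for l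
    using eY[OF that] range_mat_vec_Suc by blast
  have bY: "b \<in> range (mat_vec (Suc d) A)"
    unfolding b_def
    by (intro range_mat_vec_add range_mat_vec_sum range_mat_vec_scale aY eY') auto
  have fY: "f \<in> range (mat_vec (Suc d) A)"
    unfolding f_def by (rule range_mat_vec_scale[OF bY])
  \<comment> \<open>A zero vector of the system has coefficient 0, so the projection formula is
    valid for it as well.\<close>
  have ceq: "c k * wip I w (e k) (e k) = c k" if "k < d" for k
    using nrm[OF that]
  proof
    assume "wip I w (e k) (e k) = 0"
    then have "e k i = 0" if "i \<in> I" for i using wip_self_eq_0[of I w "e k"] fin w that by blast
    then have "c k = 0" by (simp add: c_def wip_def)
    then show ?thesis by simp
  qed simp
  have eb: "wip I w (e k) b = 0" if "k < d" for k
  proof -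
    have "wip I w (e k) b = c k + (\<Sum>l<d. (- c l) * wip I w (e k) (e l))"
      by (simp add: b_def wip_add wip_sum wip_scale wip_minus c_def)
    also have "(\<Sum>l<d. (- c l) * wip I w (e k) (e l)) = (\<Sum>l<d. if l = k then - c k * wip I w (e k) (e k) else 0)"
      using orth that by (intro sum.cong) auto
    also have "\<dots> = - c k" using that ceq[OF that] by simp
    finally show ?thesis by simp
  qed
  have ef: "wip I w (e k) f = 0" if "k < d" for k
    using eb[OF that] by (simp add: f_def wip_scale)
  have ffN: "wip I w f f = s * s * N"
    unfolding f_def wip_scale by (subst wip_commute) (simp add: wip_scale N_def)
  have ff: "wip I w f f \<in> {0, 1}"
    unfolding ffN s_def using N0 by (auto simp: field_simps)
  have fb: "wip I w f b = s * N"
    unfolding f_def by (subst wip_commute) (simp add: wip_scale N_def)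
  have bf: "b i = s * N * f i" if "i \<in> I" for i
  proof (cases "N = 0")
    case True
    then show ?thesis using wip_self_eq_0[of I w b] fin w that by (simp add: N_def)
  next
    case False
    then have "s * N * s = 1" using N0 by (simp add: s_def field_simps)
    moreover have "s * N * (s * b i) = (s * N * s) * b i" by (simp only: mult.assoc)
    ultimately show ?thesis by (simp add: f_def)
  qed
  define e' where "e' = e(d := f)"
  have rep': "y i = (\<Sum>l<Suc d. wip I w (e' l) y * e' l i)" if y: "y \<in> range (mat_vec (Suc d) A)" and i: "i \<in> I" for y i
  proof -
    obtain x where x: "y = mat_vec (Suc d) A x" using y by auto
    define y0 where "y0 = mat_vec d A x"
    define t where "t = x d"
    have ydec: "y = (\<lambda>i. y0 i + t * a i)" by (simp add: x mat_vec_Suc y0_def t_def a_def)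
    have y0Y: "y0 \<in> range (mat_vec d A)" by (simp add: y0_def)
    have fy0: "wip I w f y0 = 0"
    proof -
      have "wip I w f y0 = wip I w f (\<lambda>i. \<Sum>l<d. wip I w (e l) y0 * e l i)"
        using rep[OF y0Y] by (intro wip_cong) auto
      also have "\<dots> = (\<Sum>l<d. wip I w (e l) y0 * wip I w f (e l))"
        by (simp add: wip_sum wip_scale)
      also have "\<dots> = 0" using ef by (intro sum.neutral) (auto simp: wip_commute)
      finally show ?thesis .
    qed
    have fa: "wip I w f a = s * N"
    proof -
      have "wip I w f b = wip I w f a + (\<Sum>l<d. (- c l) * wip I w f (e l))"
        by (simp add: b_def wip_add wip_sum wip_scale wip_minus)
      also have "(\<Sum>l<d. (- c l) * wip I w f (e l)) = 0"
        using ef by (intro sum.neutral) (auto simp: wip_commute)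
      finally show ?thesis using fb by simp
    qed
    have "(\<Sum>l<Suc d. wip I w (e' l) y * e' l i) = (\<Sum>l<d. wip I w (e l) y * e l i) + wip I w f y * f i"
      by (simp add: e'_def)
    also have "(\<Sum>l<d. wip I w (e l) y * e l i) = (\<Sum>l<d. wip I w (e l) y0 * e l i) + t * (\<Sum>l<d. c l * e l i)"
      by (simp add: ydec wip_add wip_scale c_def algebra_simps sum.distrib sum_distrib_left)
    also have "wip I w f y * f i = t * b i"
      using bf[OF i] by (simp add: ydec wip_add wip_scale fy0 fa)
    also have "(\<Sum>l<d. wip I w (e l) y0 * e l i) = y0 i" using rep[OF y0Y i] by simp
    also have "(\<Sum>l<d. c l * e l i) = a i - b i" by (simp add: b_def sum_negf)
    finally show ?thesis by (simp add: ydec algebra_simps)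
  qed
  have "onb I w (Suc d) A e'"
    unfolding onb_def
  proof (intro conjI allI impI ballI)
    fix l assume l: "l < Suc d"
    show "e' l \<in> range (mat_vec (Suc d) A)" using l eY' fY by (cases "l = d") (auto simp: e'_def)
    show "wip I w (e' l) (e' l) \<in> {0, 1}" using l nrm ff by (cases "l = d") (auto simp: e'_def)
    fix k assume k: "k < Suc d" "l \<noteq> k"
    show "wip I w (e' l) (e' k) = 0"
      using l k ef orth by (auto simp: e'_def less_Suc_eq wip_commute[of I w f])
  qed (use rep' in auto)
  then show ?case by blast
qed

text \<open>The reproducing kernel of the column space for the weighted inner product.\<close>

definition ker :: "nat \<Rightarrow> (nat \<Rightarrow> nat \<Rightarrow> real) \<Rightarrow> nat \<Rightarrow> nat \<Rightarrow> real" where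
  "ker d e i j = (\<Sum>l<d. e l i * e l j)"

lemma ker_commute: "ker d e i j = ker d e j i"
  by (simp add: ker_def mult.commute)

lemma ker_self_nonneg: "0 \<le> ker d e i i"
  by (simp add: ker_def sum_nonneg)

lemma ker_cauchy_schwarz: "(ker d e i j)\<^sup>2 \<le> ker d e i i * ker d e j j"
  using Cauchy_Schwarz_ineq_sum[of "\<lambda>l. e l i" "\<lambda>l. e l j" "{..<d}"]
  by (simp add: ker_def power2_eq_square)

lemma ker_quadratic:
  "(\<Sum>l<d. (\<Sum>i\<in>J. c i * e l i)\<^sup>2) = (\<Sum>i\<in>J. \<Sum>j\<in>J. c i * c j * ker d e i j)"
proof -
  have "(\<Sum>l<d. (\<Sum>i\<in>J. c i * e l i)\<^sup>2) = (\<Sum>l<d. \<Sum>i\<in>J. \<Sum>j\<in>J. c i * c j * (e l i * e l j))"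
    by (simp add: power2_eq_square sum_product mult_ac)
  also have "\<dots> = (\<Sum>i\<in>J. \<Sum>j\<in>J. c i * c j * ker d e i j)"
  proof -
    have "(\<Sum>l<d. \<Sum>i\<in>J. \<Sum>j\<in>J. c i * c j * (e l i * e l j)) = (\<Sum>i\<in>J. \<Sum>l<d. \<Sum>j\<in>J. c i * c j * (e l i * e l j))"
      by (rule sum.swap)
    also have "\<dots> = (\<Sum>i\<in>J. \<Sum>j\<in>J. \<Sum>l<d. c i * c j * (e l i * e l j))"
      by (intro sum.cong refl sum.swap)
    finally show ?thesis by (simp add: ker_def sum_distrib_left)
  qed
  finally show ?thesis .
qed

context
  fixes I w d A e
  assumes fin: "finite I" and w: "\<And>i. i \<in> I \<Longrightarrow> (0::real) < w i" and onb: "onb I w d A e"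
begin

lemma onb_expand: "y \<in> range (mat_vec d A) \<Longrightarrow> i \<in> I \<Longrightarrow> y i = (\<Sum>l<d. wip I w (e l) y * e l i)"
  using onb by (auto simp: onb_def)

lemma onb_norm_le: "l < d \<Longrightarrow> wip I w (e l) (e l) \<le> 1"
  using onb unfolding onb_def by fastforce

lemma onb_parseval:
  assumes "y \<in> range (mat_vec d A)"
  shows "(\<Sum>i\<in>I. (y i)\<^sup>2 / w i) = (\<Sum>l<d. (wip I w (e l) y)\<^sup>2)"
proof -
  have "(\<Sum>i\<in>I. (y i)\<^sup>2 / w i) = wip I w y y" by (simp add: wip_def power2_eq_square)
  also have "\<dots> = wip I w y (\<lambda>i. \<Sum>l<d. wip I w (e l) y * e l i)"
    using onb_expand[OF assms] by (intro wip_cong) auto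
  also have "\<dots> = (\<Sum>l<d. (wip I w (e l) y)\<^sup>2)"
    by (simp add: wip_sum wip_scale power2_eq_square wip_commute[of I w y])
  finally show ?thesis .
qed

lemma ker_range: "(\<lambda>i. ker d e i j) \<in> range (mat_vec d A)"
proof -
  have "(\<lambda>i. \<Sum>l<d. e l j * e l i) \<in> range (mat_vec d A)"
    using onb by (intro range_mat_vec_sum range_mat_vec_scale) (auto simp: onb_def)
  then show ?thesis by (simp add: ker_def mult.commute)
qed

lemma ker_reproducing:
  assumes "y \<in> range (mat_vec d A)" "i \<in> I"
  shows "y i = (\<Sum>j\<in>I. ker d e i j * y j / w j)"
proof -
  have "y i = (\<Sum>l<d. \<Sum>j\<in>I. e l j * y j / w j * e l i)"
    by (subst onb_expand[OF assms]) (simp add: wip_def sum_distrib_right)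
  also have "\<dots> = (\<Sum>j\<in>I. \<Sum>l<d. e l j * y j / w j * e l i)" by (rule sum.swap)
  also have "\<dots> = (\<Sum>j\<in>I. ker d e i j * y j / w j)"
    by (simp add: ker_def sum_distrib_left sum_divide_distrib mult_ac)
  finally show ?thesis .
qed

lemma ker_sq_sum:
  assumes "i \<in> I"
  shows "(\<Sum>j\<in>I. (ker d e i j)\<^sup>2 / w j) = ker d e i i"
proof -
  have "ker d e i i = (\<Sum>j\<in>I. ker d e i j * ker d e j i / w j)"
    by (rule ker_reproducing[OF ker_range[of i] assms])
  also have "\<dots> = (\<Sum>j\<in>I. (ker d e i j)\<^sup>2 / w j)"
    by (intro sum.cong refl) (subst (2) ker_commute, simp add: power2_eq_square)
  finally show ?thesis by simp
qed

lemma ker_trace: "(\<Sum>i\<in>I. ker d e i i / w i) \<le> real d"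
proof -
  have "(\<Sum>i\<in>I. ker d e i i / w i) = (\<Sum>l<d. wip I w (e l) (e l))"
    unfolding ker_def wip_def sum_divide_distrib by (rule sum.swap)
  also have "\<dots> \<le> (\<Sum>l<d. 1)" by (intro sum_mono onb_norm_le) auto
  finally show ?thesis by simp
qed

lemma ker_self_pos:
  assumes "i \<in> I" "y \<in> range (mat_vec d A)" "y i \<noteq> 0"
  shows "0 < ker d e i i"
proof (rule ccontr)
  assume "\<not> 0 < ker d e i i"
  then have "ker d e i i = 0" using ker_self_nonneg[of d e i] by linarith
  then have "\<forall>l<d. e l i = 0" unfolding ker_def by (subst (asm) sum_nonneg_eq_0_iff) auto
  then have "y i = 0" using onb_expand[OF assms(2,1)] by simp
  then show False using assms(3) by simp
qed

end

text \<open>Write \<open>ker d e i i\<close> as the inner product with weight \<open>v\<close> of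
  the two kernel functions at \<open>i\<close> and apply Cauchy-Schwarz. One factor is
  \<open>ker d f i i\<close>. The other is the norm of the first kernel function for the wrong
  weight; replacing \<open>v\<close> by \<open>w\<close> costs \<open>c\<close> and returns
  \<open>ker d e i i\<close>, which then cancels.\<close>

lemma ker_mono:
  assumes fin: "finite I" and w: "\<And>i. i \<in> I \<Longrightarrow> (0::real) < w i" and v: "\<And>i. i \<in> I \<Longrightarrow> (0::real) < v i"
    and e: "onb I w d A e" and f: "onb I v d A f" and wv: "\<And>i. i \<in> I \<Longrightarrow> w i \<le> c * v i" and i: "i \<in> I" and c: "0 \<le> c"
  shows "ker d e i i \<le> c * ker d f i i"
proof -
  let ?K = "ker d e" and ?L = "ker d f"
  have "?K i i = (\<Sum>j\<in>I. ?L i j * ?K j i / v j)"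
    using ker_reproducing[OF fin v f ker_range[OF fin w e] i] by simp
  then have "(?K i i)\<^sup>2 = (\<Sum>j\<in>I. (?L i j / sqrt (v j)) * (?K j i / sqrt (v j)))\<^sup>2"
    using v by (simp add: less_imp_le)
  also have "\<dots> \<le> (\<Sum>j\<in>I. (?L i j / sqrt (v j))\<^sup>2) * (\<Sum>j\<in>I. (?K j i / sqrt (v j))\<^sup>2)"
    by (rule Cauchy_Schwarz_ineq_sum)
  also have "(\<Sum>j\<in>I. (?L i j / sqrt (v j))\<^sup>2) = ?L i i"
    using v ker_sq_sum[OF fin v f i] by (simp add: power_divide less_imp_le)
  also have "(\<Sum>j\<in>I. (?K j i / sqrt (v j))\<^sup>2) \<le> (\<Sum>j\<in>I. c * ((?K i j)\<^sup>2 / w j))"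
  proof (intro sum_mono)
    fix j assume j: "j \<in> I"
    have "(?K j i)\<^sup>2 / v j \<le> c * ((?K j i)\<^sup>2 / w j)"
      using wv[OF j] w[OF j] v[OF j] mult_right_mono[OF wv[OF j], of "(?K j i)\<^sup>2"] by (simp add: field_simps)
    then show "(?K j i / sqrt (v j))\<^sup>2 \<le> c * ((?K i j)\<^sup>2 / w j)"
      using v[OF j] by (simp add: power_divide less_imp_le ker_commute[of d e j i])
  qed
  also have "\<dots> = c * ?K i i" unfolding sum_distrib_left[symmetric] by (simp only: ker_sq_sum[OF fin w e i])
  finally have *: "(?K i i)\<^sup>2 \<le> ?L i i * (c * ?K i i)"
    by (simp add: mult_left_mono ker_self_nonneg)
  show ?thesis
  proof (cases "?K i i = 0")
    case True then show ?thesis using c by (simp add: ker_self_nonneg)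
  next
    case False
    then have "0 < ?K i i" using ker_self_nonneg[of d e i] by linarith
    then show ?thesis using * by (simp add: power2_eq_square mult_ac)
  qed
qed

text \<open>The quotient \<open>ker d e i i / w i\<close> is the leverage score of row
  \<open>i\<close> after scaling the rows by \<open>1 / sqrt (w i)\<close>. For \<open>c = 1\<close>
  the condition says that it equals \<open>w i\<close>, which is the fixed point equation of the l1
  Lewis weights.\<close>

definition lewis_upto :: "nat set \<Rightarrow> nat \<Rightarrow> (nat \<Rightarrow> nat \<Rightarrow> real) \<Rightarrow> real \<Rightarrow> (nat \<Rightarrow> real) \<Rightarrow> (nat \<Rightarrow> nat \<Rightarrow> real) \<Rightarrow> bool" where
  "lewis_upto I d A c w e \<longleftrightarrow> onb I w d A e \<and>
     (\<forall>i\<in>I. 0 < w i \<and> ker d e i i \<le> c * (w i)\<^sup>2 \<and> (w i)\<^sup>2 \<le> c * ker d e i i)"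

text \<open>One step of the iteration \<open>w i \<leftarrow> sqrt (ker d e i i)\<close> halves the logarithmic distance to
  exact Lewis weights.\<close>

lemma lewis_step:
  assumes fin: "finite I" and nz: "\<And>i. i \<in> I \<Longrightarrow> \<exists>y\<in>range (mat_vec d A). y i \<noteq> 0"
    and L: "lewis_upto I d A c w e" and c: "0 \<le> c"
  shows "\<exists>v f. lewis_upto I d A (sqrt c) v f"
proof -
  define v where "v = (\<lambda>i. sqrt (ker d e i i))"
  have w: "\<And>i. i \<in> I \<Longrightarrow> 0 < w i" and e: "onb I w d A e"
    and K1: "\<And>i. i \<in> I \<Longrightarrow> ker d e i i \<le> c * (w i)\<^sup>2" and K2: "\<And>i. i \<in> I \<Longrightarrow> (w i)\<^sup>2 \<le> c * ker d e i i"
    using L by (auto simp: lewis_upto_def)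
  have v: "0 < v i" if "i \<in> I" for i
    using ker_self_pos[OF fin w e that] nz[OF that] by (auto simp: v_def)
  obtain f where f: "onb I v d A f" using gram_schmidt[of I v d A] fin v by blast
  have vsq: "(v i)\<^sup>2 = ker d e i i" for i by (simp add: v_def ker_self_nonneg)
  have wv: "w i \<le> sqrt c * v i" if "i \<in> I" for i
    using real_sqrt_le_mono[OF K2[OF that]] w[OF that] by (simp add: v_def real_sqrt_mult)
  have vw: "v i \<le> sqrt c * w i" if "i \<in> I" for i
    using real_sqrt_le_mono[OF K1[OF that]] w[OF that] by (simp add: v_def real_sqrt_mult)
  have "lewis_upto I d A (sqrt c) v f"
    unfolding lewis_upto_def vsq
    using f v ker_mono[OF fin w v e f wv] ker_mono[OF fin v w f e vw] c by auto
  then show ?thesis by blast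
qed

text \<open>By the hypothesis every diagonal entry of the kernel is positive, so constant weights
  are correct up to some finite factor \<open>c\<close>. Each step takes a square root of the
  factor, and \<open>c \<le> 2 ^ (2 ^ t)\<close> for some \<open>t\<close>. Stopping at the factor 2
  avoids any passage to a limit.\<close>

lemma approx_lewis_weights:
  assumes fin: "finite I" and nz: "\<And>i. i \<in> I \<Longrightarrow> \<exists>y\<in>range (mat_vec d A). y i \<noteq> 0"
  obtains w e where "lewis_upto I d A 2 w e"
proof -
  obtain e where e: "onb I (\<lambda>_. 1) d A e" using gram_schmidt[OF fin, of "\<lambda>_. 1"] by auto
  have pos: "0 < ker d e i i" if "i \<in> I" for i
    using ker_self_pos[OF fin _ e that] nz[OF that] by auto
  define c where "c = 1 + (\<Sum>i\<in>I. ker d e i i + 1 / ker d e i i)"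
  have "ker d e i i + 1 / ker d e i i \<le> c" if "i \<in> I" for i
  proof -
    have "ker d e i i + 1 / ker d e i i \<le> (\<Sum>i\<in>I. ker d e i i + 1 / ker d e i i)"
      using fin that pos by (intro member_le_sum[where f="\<lambda>i. ker d e i i + 1 / ker d e i i"]) (auto simp: less_imp_le)
    then show ?thesis by (simp add: c_def)
  qed
  then have "ker d e i i \<le> c \<and> 1 / ker d e i i \<le> c" if "i \<in> I" for i
    using that pos[OF that] by (smt (verit) divide_pos_pos)
  then have base: "lewis_upto I d A c (\<lambda>_. 1) e"
    using e pos by (auto simp: lewis_upto_def field_simps)
  have c1: "1 \<le> c"
    unfolding c_def using pos by (auto intro!: sum_nonneg add_nonneg_nonneg simp: less_imp_le)
  have "1 \<le> b \<Longrightarrow> b \<le> 2 ^ (2 ^ t) \<Longrightarrow> lewis_upto I d A b w e \<Longrightarrow> \<exists>v f. lewis_upto I d A 2 v f" for t b w e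
  proof (induction t arbitrary: b w e)
    case 0
    have "lewis_upto I d A 2 w e"
      unfolding lewis_upto_def
    proof (intro conjI ballI)
      fix i assume i: "i \<in> I"
      have L: "0 < w i" "ker d e i i \<le> b * (w i)\<^sup>2" "(w i)\<^sup>2 \<le> b * ker d e i i"
        using 0(3) i by (auto simp: lewis_upto_def)
      have "b \<le> 2" using 0(2) by simp
      then have "b * (w i)\<^sup>2 \<le> 2 * (w i)\<^sup>2" "b * ker d e i i \<le> 2 * ker d e i i"
        by (auto intro!: mult_right_mono simp: ker_self_nonneg)
      then show "0 < w i" "ker d e i i \<le> 2 * (w i)\<^sup>2" "(w i)\<^sup>2 \<le> 2 * ker d e i i" using L by linarith+
    qed (use 0(3) in \<open>auto simp: lewis_upto_def\<close>)
    then show ?case by blast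
  next
    case (Suc t)
    obtain v f where "lewis_upto I d A (sqrt b) v f"
      using lewis_step[OF fin nz Suc.prems(3)] Suc.prems(1) by auto
    moreover have "sqrt b \<le> 2 ^ (2 ^ t)"
      using Suc.prems(2) real_sqrt_le_mono[OF Suc.prems(2)] by (simp add: power_mult power_mult_distrib mult.commute[of 2])
    moreover have "1 \<le> sqrt b" using Suc.prems(1) by simp
    ultimately show ?case using Suc.IH by blast
  qed
  moreover obtain t where "c \<le> 2 ^ (2 ^ t)"
  proof -
    obtain k where "c < 2 ^ k" using real_arch_pow[of 2 c] by auto
    also have "(2::real) ^ k \<le> 2 ^ (2 ^ k)" by (intro power_increasing) (auto simp: less_imp_le)
    finally show ?thesis using that[of k] by linarith
  qed
  ultimately show ?thesis using base c1 that by blast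
qed

section \<open>Estimates from approximate Lewis weights\<close>

context
  fixes I w d A e
  assumes fin: "finite I" and L: "lewis_upto I d A 2 w e"
begin

lemma lewis_pos: "i \<in> I \<Longrightarrow> 0 < w i"
  and lewis_onb: "onb I w d A e"
  and lewis_ker_le: "i \<in> I \<Longrightarrow> ker d e i i \<le> 2 * (w i)\<^sup>2"
  and lewis_sq_le: "i \<in> I \<Longrightarrow> (w i)\<^sup>2 \<le> 2 * ker d e i i"
  using L by (auto simp: lewis_upto_def)

lemma lewis_sum: "(\<Sum>i\<in>I. w i) \<le> 2 * real d"
proof -
  have "(\<Sum>i\<in>I. w i) \<le> (\<Sum>i\<in>I. 2 * (ker d e i i / w i))"
    using lewis_sq_le lewis_pos by (intro sum_mono) (simp add: field_simps power2_eq_square)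
  also have "\<dots> \<le> 2 * real d"
    unfolding sum_distrib_left[symmetric] using ker_trace[OF fin lewis_pos lewis_onb] by simp
  finally show ?thesis .
qed

lemma lewis_card_ge:
  assumes "0 < t" "J \<subseteq> I" "\<And>i. i \<in> J \<Longrightarrow> t \<le> w i"
  shows "real (card J) \<le> 2 * real d / t"
proof -
  have "t * real (card J) = (\<Sum>i\<in>J. t)" by simp
  also have "\<dots> \<le> (\<Sum>i\<in>J. w i)" using assms by (intro sum_mono) auto
  also have "\<dots> \<le> (\<Sum>i\<in>I. w i)" using assms fin lewis_pos by (intro sum_mono2) (auto simp: less_imp_le)
  finally show ?thesis using lewis_sum assms(1) by (simp add: field_simps)
qed

lemma lewis_ker_abs_le:
  assumes "i \<in> I" "j \<in> I"
  shows "\<bar>ker d e i j\<bar> \<le> 2 * w i * w j"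
proof -
  have "(ker d e i j)\<^sup>2 \<le> (2 * (w i)\<^sup>2) * (2 * (w j)\<^sup>2)"
    using ker_cauchy_schwarz[of d e i j] mult_mono[OF lewis_ker_le[OF assms(1)] lewis_ker_le[OF assms(2)]]
    by (simp add: ker_self_nonneg)
  also have "\<dots> = (2 * w i * w j)\<^sup>2" by (simp add: power2_eq_square)
  finally show ?thesis
    using lewis_pos[OF assms(1)] lewis_pos[OF assms(2)] by (subst (asm) power2_le_iff_abs_le) auto
qed

text \<open>The summand \<open>j = i\<close> of \<open>ker_sq_sum\<close> alone gives
  \<open>ker d e i i \<le> w i\<close>: a leverage score is at most 1. Combine this with the Lewis
  condition.\<close>

lemma lewis_le_2: "i \<in> I \<Longrightarrow> w i \<le> 2"
proof -
  assume i: "i \<in> I"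
  have "(ker d e i i)\<^sup>2 / w i \<le> (\<Sum>j\<in>I. (ker d e i j)\<^sup>2 / w j)"
    using lewis_pos by (intro member_le_sum[OF i _ fin, where f="\<lambda>j. (ker d e i j)\<^sup>2 / w j"]) (auto simp: less_imp_le)
  also have "\<dots> = ker d e i i" using ker_sq_sum[OF fin lewis_pos lewis_onb i] .
  finally have "(ker d e i i)\<^sup>2 \<le> ker d e i i * w i" using lewis_pos[OF i] by (simp add: field_simps)
  moreover have "0 < ker d e i i" using lewis_sq_le[OF i] lewis_pos[OF i]
    by (smt (verit) zero_less_power)
  ultimately have "ker d e i i \<le> w i" by (simp add: power2_eq_square)
  then have "(w i)\<^sup>2 \<le> 2 * w i" using lewis_sq_le[OF i] by linarith
  then show ?thesis using lewis_pos[OF i] by (simp add: power2_eq_square)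
qed

text \<open>A Hilbert-Schmidt bound. The weights in \<open>ker_sq_sum\<close> and in the trace are
  at most 2, and dropping them costs a factor 2 each time. It controls the kernel off the diagonal
  when heavy rows collide.\<close>

lemma lewis_ker_sq_sum_le: "J \<subseteq> I \<Longrightarrow> (\<Sum>i\<in>J. \<Sum>j\<in>J. (ker d e i j)\<^sup>2) \<le> 4 * real d"
proof -
  assume J: "J \<subseteq> I"
  have "(\<Sum>i\<in>J. \<Sum>j\<in>J. (ker d e i j)\<^sup>2) \<le> (\<Sum>i\<in>J. 2 * ker d e i i)"
  proof (intro sum_mono)
    fix i assume i: "i \<in> J"
    have "(\<Sum>j\<in>J. (ker d e i j)\<^sup>2) \<le> (\<Sum>j\<in>J. 2 * ((ker d e i j)\<^sup>2 / w j))"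
    proof (intro sum_mono)
      fix j assume "j \<in> J"
      then have "0 < w j" "w j \<le> 2" using J lewis_pos lewis_le_2 by auto
      then show "(ker d e i j)\<^sup>2 \<le> 2 * ((ker d e i j)\<^sup>2 / w j)"
        by (simp add: field_simps mult_right_mono)
    qed
    also have "\<dots> \<le> (\<Sum>j\<in>I. 2 * ((ker d e i j)\<^sup>2 / w j))"
      using J fin lewis_pos by (intro sum_mono2) (auto simp: less_imp_le)
    also have "\<dots> = 2 * ker d e i i"
      unfolding sum_distrib_left[symmetric] using ker_sq_sum[OF fin lewis_pos lewis_onb] i J by auto
    finally show "(\<Sum>j\<in>J. (ker d e i j)\<^sup>2) \<le> 2 * ker d e i i" .
  qed
  also have "\<dots> \<le> (\<Sum>i\<in>I. 2 * ker d e i i)"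
    using J fin by (intro sum_mono2) (auto simp: ker_self_nonneg)
  also have "\<dots> \<le> (\<Sum>i\<in>I. 4 * (ker d e i i / w i))"
  proof (intro sum_mono)
    fix i assume "i \<in> I"
    then have "0 < w i" "w i \<le> 2" using lewis_pos lewis_le_2 by auto
    then show "2 * ker d e i i \<le> 4 * (ker d e i i / w i)"
      by (simp add: field_simps mult_right_mono ker_self_nonneg)
  qed
  also have "\<dots> \<le> 4 * real d"
    unfolding sum_distrib_left[symmetric] using ker_trace[OF fin lewis_pos lewis_onb] by simp
  finally show ?thesis .
qed

text \<open>In the reproducing formula the bound \<open>2 * w i * w j\<close> for the kernel cancels
  the denominator \<open>w j\<close>, so that the plain l1 norm remains.\<close>

lemma lewis_coord_le:
  assumes "y \<in> range (mat_vec d A)" "i \<in> I"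
  shows "\<bar>y i\<bar> \<le> 2 * w i * (\<Sum>j\<in>I. \<bar>y j\<bar>)"
proof -
  have "\<bar>y i\<bar> \<le> (\<Sum>j\<in>I. \<bar>ker d e i j * y j / w j\<bar>)"
    by (subst ker_reproducing[OF fin lewis_pos lewis_onb assms]) (simp, rule sum_abs)
  also have "\<dots> \<le> (\<Sum>j\<in>I. 2 * w i * \<bar>y j\<bar>)"
  proof (intro sum_mono)
    fix j assume j: "j \<in> I"
    have "\<bar>ker d e i j\<bar> * \<bar>y j\<bar> \<le> 2 * w i * w j * \<bar>y j\<bar>"
      using lewis_ker_abs_le[OF assms(2) j] by (intro mult_right_mono) auto
    then show "\<bar>ker d e i j * y j / w j\<bar> \<le> 2 * w i * \<bar>y j\<bar>"
      using lewis_pos[OF j] by (simp add: abs_mult field_simps)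
  qed
  finally show ?thesis by (simp add: sum_distrib_left)
qed

lemma lewis_coeff_sq_le:
  assumes "y \<in> range (mat_vec d A)"
  shows "(\<Sum>l<d. (wip I w (e l) y)\<^sup>2) \<le> 2 * (\<Sum>j\<in>I. \<bar>y j\<bar>)\<^sup>2"
proof -
  have "(\<Sum>l<d. (wip I w (e l) y)\<^sup>2) = (\<Sum>i\<in>I. (y i)\<^sup>2 / w i)"
    using onb_parseval[OF fin lewis_pos lewis_onb assms] by simp
  also have "\<dots> \<le> (\<Sum>i\<in>I. 2 * (\<Sum>j\<in>I. \<bar>y j\<bar>) * \<bar>y i\<bar>)"
  proof (intro sum_mono)
    fix i assume i: "i \<in> I"
    have "\<bar>y i\<bar> * \<bar>y i\<bar> \<le> 2 * w i * (\<Sum>j\<in>I. \<bar>y j\<bar>) * \<bar>y i\<bar>"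
      by (intro mult_right_mono lewis_coord_le assms i) auto
    then show "(y i)\<^sup>2 / w i \<le> 2 * (\<Sum>j\<in>I. \<bar>y j\<bar>) * \<bar>y i\<bar>"
      using lewis_pos[OF i] by (simp add: field_simps power2_eq_square)
  qed
  also have "\<dots> = 2 * (\<Sum>j\<in>I. \<bar>y j\<bar>)\<^sup>2"
    by (simp add: power2_eq_square flip: sum_distrib_left)
  finally show ?thesis .
qed

lemma lewis_basis_l1_le: "l < d \<Longrightarrow> (\<Sum>i\<in>I. \<bar>e l i\<bar>) \<le> 2 * real d"
proof -
  assume l: "l < d"
  have "(\<Sum>i\<in>I. \<bar>e l i\<bar>) \<le> (\<Sum>i\<in>I. (w i + e l i * e l i / w i) / 2)"
  proof (intro sum_mono)
    fix i assume i: "i \<in> I"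
    have "0 \<le> (w i - \<bar>e l i\<bar>)\<^sup>2" by simp
    then have "2 * w i * \<bar>e l i\<bar> \<le> (w i)\<^sup>2 + (e l i)\<^sup>2" by (simp add: power2_diff)
    then show "\<bar>e l i\<bar> \<le> (w i + e l i * e l i / w i) / 2"
      using lewis_pos[OF i] by (simp add: field_simps power2_eq_square)
  qed
  also have "\<dots> = ((\<Sum>i\<in>I. w i) + wip I w (e l) (e l)) / 2"
    by (simp add: wip_def sum.distrib flip: sum_divide_distrib)
  also have "\<dots> \<le> (2 * real d + 1) / 2"
    using lewis_sum onb_norm_le[OF fin lewis_pos lewis_onb l] by simp
  also have "\<dots> \<le> 2 * real d" using l by (simp add: field_simps)
  finally show ?thesis .
qed

text \<open>Expanding \<open>y\<close> in the orthonormal system separates it from the coefficients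
  \<open>c\<close>. A random linear functional is thereby bounded on the whole l1 ball at once by a
  single random variable, whose second moment can be computed.\<close>

lemma lewis_linear_le:
  assumes "y \<in> range (mat_vec d A)" "J \<subseteq> I"
  shows "\<bar>\<Sum>i\<in>J. c i * y i\<bar> \<le> sqrt 2 * (\<Sum>j\<in>I. \<bar>y j\<bar>) * sqrt (\<Sum>l<d. (\<Sum>i\<in>J. c i * e l i)\<^sup>2)"
proof -
  have "(\<Sum>i\<in>J. c i * y i) = (\<Sum>i\<in>J. \<Sum>l<d. c i * (wip I w (e l) y * e l i))"
    using assms onb_expand[OF fin lewis_pos lewis_onb assms(1)]
    by (intro sum.cong refl) (auto simp: sum_distrib_left)
  also have "\<dots> = (\<Sum>l<d. wip I w (e l) y * (\<Sum>i\<in>J. c i * e l i))"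
    by (subst sum.swap) (simp add: sum_distrib_left mult_ac)
  finally have eq: "(\<Sum>i\<in>J. c i * y i) = (\<Sum>l<d. wip I w (e l) y * (\<Sum>i\<in>J. c i * e l i))" .
  have "(\<Sum>i\<in>J. c i * y i)\<^sup>2 \<le> (\<Sum>l<d. (wip I w (e l) y)\<^sup>2) * (\<Sum>l<d. (\<Sum>i\<in>J. c i * e l i)\<^sup>2)"
    unfolding eq by (rule Cauchy_Schwarz_ineq_sum)
  also have "\<dots> \<le> (2 * (\<Sum>j\<in>I. \<bar>y j\<bar>)\<^sup>2) * (\<Sum>l<d. (\<Sum>i\<in>J. c i * e l i)\<^sup>2)"
    by (intro mult_right_mono lewis_coeff_sq_le assms sum_nonneg) auto
  finally have "sqrt ((\<Sum>i\<in>J. c i * y i)\<^sup>2) \<le> sqrt ((2 * (\<Sum>j\<in>I. \<bar>y j\<bar>)\<^sup>2) * (\<Sum>l<d. (\<Sum>i\<in>J. c i * e l i)\<^sup>2))"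
    by (rule real_sqrt_le_mono)
  then show ?thesis
    by (simp add: real_sqrt_mult sum_nonneg)
qed

end

section \<open>A dyadic heavy-tailed distribution\<close>

definition dyadic :: "nat \<Rightarrow> real set" where
  "dyadic Q = {0} \<union> ((\<lambda>k. 2 ^ k) ` {..Q} \<union> (\<lambda>k. - (2 ^ k)) ` {..Q})"

text \<open>The mass at \<open>0\<close> leaves a bucket that contains a few heavy rows free of them with
  probability close to one.\<close>

definition dyadic_wt :: "nat \<Rightarrow> real \<Rightarrow> real" where
  "dyadic_wt Q x = (if x = 0 then 1 - (1 - 1 / 2 ^ Suc Q) / 32 else 1 / (128 * \<bar>x\<bar>))"

lemma expect_dyadic:
  "expect (dyadic Q) (dyadic_wt Q) f = (1 - (1 - 1 / 2 ^ Suc Q) / 32) * f 0 + (\<Sum>k\<le>Q. (f (2 ^ k) + f (- (2 ^ k))) / (128 * 2 ^ k))"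
proof -
  let ?A = "(\<lambda>k. 2 ^ k :: real) ` {..Q}" and ?B = "(\<lambda>k. - (2 ^ k) :: real) ` {..Q}"
  have pos: "0 < x" if "x \<in> ?A" for x using that by auto
  have neg: "x < 0" if "x \<in> ?B" for x using that by auto
  have disj: "{0} \<inter> (?A \<union> ?B) = {}" "?A \<inter> ?B = {}" using pos neg by (fastforce, fastforce)
  have "expect (dyadic Q) (dyadic_wt Q) f = dyadic_wt Q 0 * f 0 + ((\<Sum>x\<in>?A. dyadic_wt Q x * f x) + (\<Sum>x\<in>?B. dyadic_wt Q x * f x))"
    unfolding expect_def dyadic_def
    by (subst sum.union_disjoint[OF _ _ disj(1)], simp, simp, subst sum.union_disjoint[OF _ _ disj(2)]) auto
  also have "(\<Sum>x\<in>?A. dyadic_wt Q x * f x) = (\<Sum>k\<le>Q. f (2 ^ k) / (128 * 2 ^ k))"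
    by (subst sum.reindex) (auto simp: inj_on_def dyadic_wt_def)
  also have "(\<Sum>x\<in>?B. dyadic_wt Q x * f x) = (\<Sum>k\<le>Q. f (- (2 ^ k)) / (128 * 2 ^ k))"
    by (subst sum.reindex) (auto simp: inj_on_def dyadic_wt_def)
  finally have "expect (dyadic Q) (dyadic_wt Q) f = dyadic_wt Q 0 * f 0 + ((\<Sum>k\<le>Q. f (2 ^ k) / (128 * 2 ^ k)) + (\<Sum>k\<le>Q. f (- (2 ^ k)) / (128 * 2 ^ k)))" .
  moreover have "dyadic_wt Q 0 = 1 - (1 - 1 / 2 ^ Suc Q) / 32" by (simp add: dyadic_wt_def)
  ultimately show ?thesis by (simp add: sum.distrib add_divide_distrib)
qed

lemma sum_inverse_pow2: "(\<Sum>k\<le>Q. 1 / 2 ^ k) = (2 - 1 / 2 ^ Q :: real)"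
  by (induction Q) (auto simp: field_simps)

lemma px_zero_pos: "0 < 1 - (1 - 1 / 2 ^ Suc Q) / (32::real)"
proof -
  have "0 < 1 / (2::real) ^ Suc Q" by simp
  then have "(1 - 1 / 2 ^ Suc Q) / (32::real) < 1 / 32" by (intro divide_strict_right_mono) linarith+
  then show ?thesis by linarith
qed

lemma fin_prob_dyadic: "fin_prob (dyadic Q) (dyadic_wt Q)"
proof -
  have "expect (dyadic Q) (dyadic_wt Q) (\<lambda>_. 1) = 1 - (1 - 1 / 2 ^ Suc Q) / 32 + (\<Sum>k\<le>Q. 1 / 2 ^ k) / 64"
    unfolding expect_dyadic by (simp add: sum_divide_distrib mult.commute)
  also have "\<dots> = 1" by (simp add: sum_inverse_pow2 field_simps)
  finally have "sum (dyadic_wt Q) (dyadic Q) = 1" by (simp add: expect_def)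
  then show ?thesis using px_zero_pos[of Q] by (auto simp: fin_prob_def dyadic_def dyadic_wt_def)
qed

lemma expect_dyadic_uminus: "expect (dyadic Q) (dyadic_wt Q) (\<lambda>x. f (- x)) = expect (dyadic Q) (dyadic_wt Q) f"
  by (simp add: expect_dyadic add.commute)

lemma expect_dyadic_even:
  assumes "\<And>x. f (- x) = f x"
  shows "expect (dyadic Q) (dyadic_wt Q) f = (1 - (1 - 1 / 2 ^ Suc Q) / 32) * f 0 + (\<Sum>k\<le>Q. f (2 ^ k) / 2 ^ k) / 64"
  unfolding expect_dyadic by (simp add: assms sum_divide_distrib mult.commute)

lemma expect_dyadic_odd:
  assumes "\<And>x. f (- x) = - f x"
  shows "expect (dyadic Q) (dyadic_wt Q) f = 0"
proof -
  have "f 0 = 0" using assms[of 0] by simp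
  then show ?thesis by (simp add: expect_dyadic assms)
qed

lemma dyadic_tail:
  assumes "0 < t"
  shows "expect (dyadic Q) (dyadic_wt Q) (\<lambda>x. of_bool (t \<le> \<bar>x\<bar>)) \<le> 1 / (32 * t)"
proof -
  \<comment> \<open>The tail of the geometric series is kept in the bound to make the induction
    close. The case \<open>2 ^ Q < t\<close> is carried along because the first summand to be
    counted starts from the value 0.\<close>
  have "(t \<le> 2 ^ Q \<longrightarrow> (\<Sum>k\<le>Q. of_bool (t \<le> 2 ^ k) / 2 ^ k) \<le> 2 / t - 1 / 2 ^ Q) \<and>
        (2 ^ Q < t \<longrightarrow> (\<Sum>k\<le>Q. of_bool (t \<le> 2 ^ k) / (2::real) ^ k) = 0)"
  proof (induction Q)
    case 0
    show ?case using assms by (auto simp: field_simps)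
  next
    case (Suc Q)
    show ?case
    proof (intro conjI impI)
      assume t: "t \<le> 2 ^ Suc Q"
      show "(\<Sum>k\<le>Suc Q. of_bool (t \<le> 2 ^ k) / 2 ^ k) \<le> 2 / t - 1 / 2 ^ Suc Q"
      proof (cases "t \<le> 2 ^ Q")
        case True
        have "(1::real) / 2 ^ Q = 1 / 2 ^ Suc Q + 1 / 2 ^ Suc Q" by (simp add: field_simps)
        then show ?thesis using Suc t True by simp
      next
        case False
        have "2 / 2 ^ Suc Q \<le> 2 / t" using t assms by (intro divide_left_mono) auto
        then show ?thesis using Suc t False by simp
      qed
    next
      assume t: "2 ^ Suc Q < t"
      moreover have "(2::real) ^ Q \<le> 2 ^ Suc Q" by simp
      ultimately have "2 ^ Q < t" by linarith
      then show "(\<Sum>k\<le>Suc Q. of_bool (t \<le> 2 ^ k) / (2::real) ^ k) = 0" using Suc t by simp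
    qed
  qed
  moreover have "(0::real) < 1 / 2 ^ Q" "0 < 2 / t" using assms by auto
  ultimately have "(\<Sum>k\<le>Q. of_bool (t \<le> 2 ^ k) / 2 ^ k) \<le> 2 / t"
    by linarith
  then show ?thesis using assms by (subst expect_dyadic_even) (auto simp: field_simps)
qed

lemma dyadic_nonzero:
  assumes "0 \<le> t"
  shows "expect (dyadic Q) (dyadic_wt Q) (\<lambda>x. of_bool (t < \<bar>x\<bar>)) \<le> 1 / 32"
proof -
  have "(\<Sum>k\<le>Q. of_bool (t < 2 ^ k) / 2 ^ k) \<le> (\<Sum>k\<le>Q. 1 / 2 ^ k :: real)"
    by (intro sum_mono) auto
  also have "\<dots> \<le> 2" by (simp add: sum_inverse_pow2)
  finally show ?thesis using assms by (subst expect_dyadic_even) auto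
qed

lemma dyadic_truncated_square:
  assumes "0 \<le> T"
  shows "expect (dyadic Q) (dyadic_wt Q) (\<lambda>x. x\<^sup>2 * of_bool (\<bar>x\<bar> \<le> T)) \<le> T / 32"
proof -
  \<comment> \<open>The second bound is there for the induction: if the new summand counts, the old
    ones add up to at most \<open>2 ^ Suc Q\<close>, which equals the new one.\<close>
  have "(\<Sum>k\<le>Q. 2 ^ k * of_bool (2 ^ k \<le> T)) \<le> 2 * T \<and> (\<Sum>k\<le>Q. (2::real) ^ k * of_bool (2 ^ k \<le> T)) \<le> 2 ^ Suc Q"
  proof (induction Q)
    case 0
    show ?case using assms by (simp add: of_bool_def)
  next
    case (Suc Q)
    show ?case
    proof (cases "(2::real) ^ Suc Q \<le> T")
      case True
      then show ?thesis using Suc by simp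
    next
      case False
      have "(0::real) \<le> 2 ^ Suc Q" by simp
      then show ?thesis using Suc False by simp
    qed
  qed
  then show ?thesis using assms by (subst expect_dyadic_even) (auto simp: power2_eq_square)
qed

text \<open>Every dyadic scale contributes the same amount 1/64. This is the origin of the logarithm
  in both the upper and the lower bound.\<close>

lemma dyadic_truncated_abs:
  "expect (dyadic Q) (dyadic_wt Q) (\<lambda>x. \<bar>x\<bar> * of_bool (a \<le> \<bar>x\<bar> \<and> \<bar>x\<bar> \<le> b)) = real (card {k. k \<le> Q \<and> a \<le> 2 ^ k \<and> 2 ^ k \<le> b}) / 64"
proof -
  have "{..Q} \<inter> {k. a \<le> 2 ^ k \<and> 2 ^ k \<le> b} = {k. k \<le> Q \<and> a \<le> 2 ^ k \<and> 2 ^ k \<le> b}" by auto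
  then show ?thesis by (subst expect_dyadic_even) (auto simp: of_bool_def sum.If_cases)
qed

lemma dyadic_truncated_abs_upper:
  assumes "0 < a" "a \<le> b"
  shows "expect (dyadic Q) (dyadic_wt Q) (\<lambda>x. \<bar>x\<bar> * of_bool (a \<le> \<bar>x\<bar> \<and> \<bar>x\<bar> \<le> b)) \<le> (log 2 (b / a) + 1) / 64"
proof -
  let ?S = "{k. k \<le> Q \<and> a \<le> 2 ^ k \<and> 2 ^ k \<le> b}"
  have "real (card ?S) \<le> log 2 (b / a) + 1"
  proof (cases "?S = {}")
    case True
    have "0 \<le> log 2 (b / a)" using assms by (simp add: zero_le_log_cancel_iff)
    then show ?thesis unfolding True by simp
  next
    case False
    have fin: "finite ?S" by auto
    define m M where "m = Min ?S" and "M = Max ?S"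
    have m: "m \<in> ?S" "\<And>k. k \<in> ?S \<Longrightarrow> m \<le> k" and M: "M \<in> ?S" "\<And>k. k \<in> ?S \<Longrightarrow> k \<le> M"
      using Min_in[OF fin False] Max_in[OF fin False] fin by (auto simp: m_def M_def)
    have mM: "m \<le> M" using m M by blast
    have "card ?S \<le> card {m..M}" using m M by (intro card_mono) auto
    then have "real (card ?S) \<le> real (M - m) + 1" using mM by simp
    moreover have "2 ^ (M - m) \<le> b / a"
    proof -
      have "(2::real) ^ (M - m) * 2 ^ m = 2 ^ M" using mM by (simp flip: power_add)
      then have "2 ^ (M - m) * a \<le> b" using m(1) M(1) mult_left_mono[of a "2 ^ m" "2 ^ (M - m)"] by auto
      then show ?thesis using assms by (simp add: field_simps)
    qed
    then have "real (M - m) \<le> log 2 (b / a)" using assms by (simp add: le_log_iff powr_realpow)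
    ultimately show ?thesis by linarith
  qed
  then show ?thesis unfolding dyadic_truncated_abs by simp
qed

lemma dyadic_truncated_abs_lower:
  assumes "1 \<le> a" "a \<le> b" "b \<le> 2 ^ Q"
  shows "(log 2 (b / a) - 1) / 64 \<le> expect (dyadic Q) (dyadic_wt Q) (\<lambda>x. \<bar>x\<bar> * of_bool (a \<le> \<bar>x\<bar> \<and> \<bar>x\<bar> \<le> b))"
proof -
  let ?S = "{k. k \<le> Q \<and> a \<le> 2 ^ k \<and> 2 ^ k \<le> b}"
  define m M where "m = nat \<lceil>log 2 a\<rceil>" and "M = nat \<lfloor>log 2 b\<rfloor>"
  have la: "0 \<le> log 2 a" and lb: "0 \<le> log 2 b" using assms by (auto simp: zero_le_log_cancel_iff)
  have "real m = of_int \<lceil>log 2 a\<rceil>" using la by (simp add: m_def)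
  then have m: "log 2 a \<le> real m" "real m \<le> log 2 a + 1" by linarith+
  have "real M = of_int \<lfloor>log 2 b\<rfloor>" using lb by (simp add: M_def)
  then have M: "real M \<le> log 2 b" "log 2 b - 1 \<le> real M" by linarith+
  have "{m..M} \<subseteq> ?S"
  proof safe
    fix k assume k: "k \<in> {m..M}"
    have "log 2 a \<le> real k" using m(1) k by auto
    then show "a \<le> 2 ^ k" using assms by (simp add: log_le_iff powr_realpow)
    have "real k \<le> log 2 b" using M(1) k by auto
    then show b: "2 ^ k \<le> b" using assms by (simp add: le_log_iff powr_realpow)
    then have "(2::real) ^ k \<le> 2 ^ Q" using assms by linarith
    then show "k \<le> Q" by simp
  qed
  then have "card {m..M} \<le> card ?S" by (intro card_mono) auto
  then have "real M + 1 - real m \<le> real (card ?S)" by (simp add: of_nat_diff)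
  moreover have "log 2 (b / a) = log 2 b - log 2 a" using assms by (simp add: log_divide)
  ultimately show ?thesis unfolding dyadic_truncated_abs using m M by simp
qed

text \<open>Split at \<open>\<theta> / a\<close>: the truncated second moment and the tail each give
  \<open>a * \<theta> / 32\<close>. The result is linear in \<open>a\<close>, so that summation over
  the rows leads back to an l1 norm.\<close>

lemma dyadic_min_square:
  assumes "0 \<le> a" "0 < \<theta>"
  shows "expect (dyadic Q) (dyadic_wt Q) (\<lambda>x. (min (\<bar>x\<bar> * a) \<theta>)\<^sup>2) \<le> a * \<theta> / 16"
proof (cases "a = 0")
  case True
  then show ?thesis using assms by (simp add: expect_def)
next
  case False
  then have a: "0 < a" using assms by simp
  have "(min (\<bar>x\<bar> * a) \<theta>)\<^sup>2 \<le> a\<^sup>2 * (x\<^sup>2 * of_bool (\<bar>x\<bar> \<le> \<theta> / a)) + \<theta>\<^sup>2 * of_bool (\<theta> / a \<le> \<bar>x\<bar>)" for x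
  proof (cases "\<bar>x\<bar> \<le> \<theta> / a")
    case True
    then have "min (\<bar>x\<bar> * a) \<theta> = \<bar>x\<bar> * a" using a by (simp add: field_simps)
    then show ?thesis using True by (simp add: power_mult_distrib)
  next
    case False
    then have "min (\<bar>x\<bar> * a) \<theta> = \<theta>" using a by (simp add: field_simps)
    then show ?thesis using False by simp
  qed
  then have "expect (dyadic Q) (dyadic_wt Q) (\<lambda>x. (min (\<bar>x\<bar> * a) \<theta>)\<^sup>2) \<le>
     expect (dyadic Q) (dyadic_wt Q) (\<lambda>x. a\<^sup>2 * (x\<^sup>2 * of_bool (\<bar>x\<bar> \<le> \<theta> / a)) + \<theta>\<^sup>2 * of_bool (\<theta> / a \<le> \<bar>x\<bar>))"
    by (intro expect_mono fin_prob_dyadic)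
  also have "\<dots> = a\<^sup>2 * expect (dyadic Q) (dyadic_wt Q) (\<lambda>x. x\<^sup>2 * of_bool (\<bar>x\<bar> \<le> \<theta> / a)) + \<theta>\<^sup>2 * expect (dyadic Q) (dyadic_wt Q) (\<lambda>x. of_bool (\<theta> / a \<le> \<bar>x\<bar>))"
    by (simp add: expect_add expect_cmult)
  also have "\<dots> \<le> a\<^sup>2 * (\<theta> / a / 32) + \<theta>\<^sup>2 * (1 / (32 * (\<theta> / a)))"
    using a assms by (intro add_mono mult_left_mono dyadic_truncated_square dyadic_tail) auto
  also have "\<dots> = a * \<theta> / 16" using a assms by (simp add: field_simps power2_eq_square)
  finally show ?thesis .
qed

lemma dyadic_uminus: "x \<in> dyadic Q \<Longrightarrow> - x \<in> dyadic Q"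
  by (auto simp: dyadic_def)

section \<open>The upper bound\<close>

abbreviation rowspace :: "nat set \<Rightarrow> nat \<Rightarrow> (nat \<Rightarrow> real) set" where
  "rowspace N Q \<equiv> PiE N (\<lambda>_. dyadic Q)"

abbreviation expectX :: "nat set \<Rightarrow> nat \<Rightarrow> ((nat \<Rightarrow> real) \<Rightarrow> real) \<Rightarrow> real" where
  "expectX N Q \<equiv> expect (rowspace N Q) (wprod N (dyadic_wt Q))"

lemma fin_prob_X: "finite N \<Longrightarrow> fin_prob (rowspace N Q) (wprod N (dyadic_wt Q))"
  by (intro fin_prob_PiE fin_prob_dyadic)

lemma second_moment:
  assumes N: "finite N" "J \<subseteq> N" and odd: "\<And>i x. i \<in> J \<Longrightarrow> f i (- x) = - f i x"
  shows "expectX N Q (\<lambda>X. (\<Sum>i\<in>J. f i (X i) * c i)\<^sup>2) = (\<Sum>i\<in>J. expect (dyadic Q) (dyadic_wt Q) (\<lambda>x. (f i x)\<^sup>2) * (c i)\<^sup>2)"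
proof -
  have cross: "expectX N Q (\<lambda>X. f i (X i) * f j (X j)) = (if i = j then expect (dyadic Q) (dyadic_wt Q) (\<lambda>x. (f i x)\<^sup>2) else 0)"
    if "i \<in> J" "j \<in> J" for i j
  proof (cases "i = j")
    case True
    then show ?thesis using expect_coord[of N i "dyadic Q" "dyadic_wt Q" "\<lambda>x. (f i x)\<^sup>2"] N that fin_prob_dyadic
      by (auto simp: power2_eq_square)
  next
    case False
    have "expectX N Q (\<lambda>X. f i (X i) * f j (X j)) = expect (dyadic Q) (dyadic_wt Q) (f i) * expect (dyadic Q) (dyadic_wt Q) (f j)"
      using that N False by (intro expect_coord_two fin_prob_dyadic) auto
    then show ?thesis using False expect_dyadic_odd[of "f i" Q] odd[OF that(1)] by simp
  qed
  have "(\<Sum>i\<in>J. f i (X i) * c i)\<^sup>2 = (\<Sum>i\<in>J. \<Sum>j\<in>J. (f i (X i) * f j (X j)) * (c i * c j))" for X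
    by (simp add: power2_eq_square sum_product mult_ac)
  then have "expectX N Q (\<lambda>X. (\<Sum>i\<in>J. f i (X i) * c i)\<^sup>2) = (\<Sum>i\<in>J. \<Sum>j\<in>J. expectX N Q (\<lambda>X. f i (X i) * f j (X j)) * (c i * c j))"
    by (simp only: expect_sum expect_multc)
  also have "\<dots> = (\<Sum>i\<in>J. \<Sum>j\<in>J. if i = j then expect (dyadic Q) (dyadic_wt Q) (\<lambda>x. (f i x)\<^sup>2) * (c i * c i) else 0)"
    by (intro sum.cong refl) (auto simp: cross)
  also have "\<dots> = (\<Sum>i\<in>J. expect (dyadic Q) (dyadic_wt Q) (\<lambda>x. (f i x)\<^sup>2) * (c i)\<^sup>2)"
    using finite_subset[OF N(2,1)] by (simp add: power2_eq_square)
  finally show ?thesis .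
qed

text \<open>Independence and oddness remove the products of different rows, so only the diagonal of
  the kernel is left. It supplies the second moment for \<open>lewis_linear_le\<close>.\<close>

lemma second_moment_ker:
  assumes N: "finite N" "J \<subseteq> N" and odd: "\<And>i x. i \<in> J \<Longrightarrow> f i (- x) = - f i x"
  shows "expectX N Q (\<lambda>X. \<Sum>l<d. (\<Sum>i\<in>J. f i (X i) * e l i)\<^sup>2) = (\<Sum>i\<in>J. expect (dyadic Q) (dyadic_wt Q) (\<lambda>x. (f i x)\<^sup>2) * ker d e i i)"
proof -
  have "expectX N Q (\<lambda>X. \<Sum>l<d. (\<Sum>i\<in>J. f i (X i) * e l i)\<^sup>2) = (\<Sum>l<d. \<Sum>i\<in>J. expect (dyadic Q) (dyadic_wt Q) (\<lambda>x. (f i x)\<^sup>2) * (e l i)\<^sup>2)"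
    by (simp only: expect_sum second_moment[of N J f, OF assms])
  also have "\<dots> = (\<Sum>i\<in>J. \<Sum>l<d. expect (dyadic Q) (dyadic_wt Q) (\<lambda>x. (f i x)\<^sup>2) * (e l i)\<^sup>2)" by (rule sum.swap)
  finally show ?thesis by (simp add: ker_def power2_eq_square sum_distrib_left)
qed

lemma trunc_second_moment:
  assumes "0 \<le> \<beta>"
  shows "expect (dyadic Q) (dyadic_wt Q) (\<lambda>x. (x * of_bool (\<bar>x\<bar> \<le> \<beta>))\<^sup>2) \<le> \<beta> / 32"
proof -
  have eq: "(x * of_bool (\<bar>x\<bar> \<le> \<beta>))\<^sup>2 = x\<^sup>2 * of_bool (\<bar>x\<bar> \<le> \<beta>)" for x by (auto simp: of_bool_def)
  show ?thesis unfolding eq by (rule dyadic_truncated_square[OF assms])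
qed

lemma sum_buckets:
  assumes "finite I" "\<And>i. i \<in> I \<Longrightarrow> h i < (r::nat)"
  shows "(\<Sum>b<r. \<Sum>i | i \<in> I \<and> h i = b. f i) = sum f I"
  using assms by (intro sum.group) auto

text \<open>Entries above \<open>hi i\<close> are excluded by a union bound. Entries between
  \<open>lo i\<close> and \<open>hi i\<close> are estimated row by row with
  \<open>lewis_coord_le\<close>, without cancellation: about \<open>log 2 (d ^ 2)\<close> scales,
  each costing a multiple of \<open>w i\<close>. Entries below \<open>lo i\<close> would cost too
  many scales in this way; there the cancellation inside each bucket is used through second
  moments.\<close>

lemma upper_event:
  fixes C0 :: real
  assumes N: "finite N" "I \<subseteq> N" and L: "lewis_upto I d A 2 w e" and d: "1 \<le> d"
    and r: "real r \<le> C0 * real d ^ 2" and C0: "1 \<le> C0" and h: "\<And>i. i \<in> I \<Longrightarrow> h i < r"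
  shows "expectX N Q (\<lambda>X. of_bool (\<exists>y\<in>range (mat_vec d A).
      (63 * (log 2 (1000 * real d ^ 2) + 1) + 1500 * C0) * real d * (\<Sum>i\<in>I. \<bar>y i\<bar>) < (\<Sum>b<r. \<bar>\<Sum>i | i \<in> I \<and> h i = b. X i * y i\<bar>))) \<le> 3/1000"
proof -
  have fin: "finite I" using N finite_subset by blast
  have w: "0 < w i" if "i \<in> I" for i using lewis_pos[OF fin L that] .
  note FX = fin_prob_X[OF N(1), of Q]
  have d0: "0 < real d" using d by simp
  define lo hi where "lo = (\<lambda>i. 1 / (real d * w i))" and "hi = (\<lambda>i. 1000 * real d / w i)"
  have lohi: "0 < lo i" "lo i \<le> hi i" if "i \<in> I" for i
  proof -
    show "0 < lo i" using w[OF that] d0 by (simp add: lo_def)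
    have "1 / real d \<le> 1" "1 \<le> 1000 * real d" using d by (simp_all add: field_simps)
    then have "1 / real d \<le> 1000 * real d" by linarith
    then have "1 / real d / w i \<le> 1000 * real d / w i" by (intro divide_right_mono less_imp_le[OF w[OF that]])
    then show "lo i \<le> hi i" by (simp add: lo_def hi_def)
  qed
  define P0 where "P0 = (\<lambda>X::nat\<Rightarrow>real. \<exists>i\<in>I. hi i \<le> \<bar>X i\<bar>)"
  define f1 where "f1 = (\<lambda>i x. \<bar>x\<bar> * of_bool (lo i \<le> \<bar>x\<bar> \<and> \<bar>x\<bar> \<le> hi i))"
  define F1 where "F1 = (\<lambda>X::nat\<Rightarrow>real. \<Sum>i\<in>I. f1 i (X i) * (2 * w i))"
  define fs where "fs = (\<lambda>i x. x * of_bool (\<bar>x\<bar> \<le> lo i) :: real)"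
  define G where "G = (\<lambda>b X. \<Sum>l<d. (\<Sum>i | i \<in> I \<and> h i = b. fs i (X i) * e l i)\<^sup>2)"
  define F2 where "F2 = (\<lambda>X. \<Sum>b<r. sqrt (G b X))"
  define lg where "lg = log 2 (1000 * real d ^ 2) + 1"
  have lg: "1 \<le> lg"
  proof -
    have "1 \<le> real d ^ 2" using d by (simp add: one_le_power)
    then have "1 \<le> 1000 * real d ^ 2" by linarith
    then have "0 \<le> log 2 (1000 * real d ^ 2)" using d0 by (subst zero_le_log_cancel_iff) auto
    then show ?thesis by (simp add: lg_def)
  qed
  have p0: "expectX N Q (\<lambda>X. of_bool (P0 X)) \<le> 1/1000"
  proof -
    have "expectX N Q (\<lambda>X. of_bool (P0 X)) \<le> (\<Sum>i\<in>I. expectX N Q (\<lambda>X. of_bool (hi i \<le> \<bar>X i\<bar>)))"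
      by (rule expect_union_bound[OF FX fin]) (simp add: P0_def)
    also have "\<dots> \<le> (\<Sum>i\<in>I. w i / (32 * (1000 * real d)))"
    proof (intro sum_mono)
      fix i assume i: "i \<in> I"
      have "expectX N Q (\<lambda>X. of_bool (hi i \<le> \<bar>X i\<bar>)) = expect (dyadic Q) (dyadic_wt Q) (\<lambda>x. of_bool (hi i \<le> \<bar>x\<bar>))"
        using i N by (intro expect_coord[where f="\<lambda>x. of_bool (hi i \<le> \<bar>x\<bar>)"] fin_prob_dyadic) auto
      also have "\<dots> \<le> 1 / (32 * hi i)" using lohi[OF i] by (intro dyadic_tail) auto
      finally show "expectX N Q (\<lambda>X. of_bool (hi i \<le> \<bar>X i\<bar>)) \<le> w i / (32 * (1000 * real d))"
        using w[OF i] by (simp add: hi_def)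
    qed
    also have "\<dots> = (\<Sum>i\<in>I. w i) / (32 * (1000 * real d))" by (simp add: sum_divide_distrib)
    also have "\<dots> \<le> (2 * real d) / (32 * (1000 * real d))"
      by (intro divide_right_mono lewis_sum[OF fin L]) auto
    also have "\<dots> \<le> 1/1000" using d0 by simp
    finally show ?thesis .
  qed
  have p1: "expectX N Q (\<lambda>X. of_bool (1000 * (real d * lg / 16) \<le> F1 X)) \<le> 1/1000"
  proof -
    have "expectX N Q F1 = (\<Sum>i\<in>I. expectX N Q (\<lambda>X. f1 i (X i)) * (2 * w i))"
      unfolding F1_def expect_sum expect_multc ..
    also have "\<dots> \<le> (\<Sum>i\<in>I. lg / 64 * (2 * w i))"
    proof (intro sum_mono mult_right_mono)
      fix i assume i: "i \<in> I"
      have "expectX N Q (\<lambda>X. f1 i (X i)) = expect (dyadic Q) (dyadic_wt Q) (f1 i)" using i N by (intro expect_coord fin_prob_dyadic) auto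
      also have "\<dots> \<le> (log 2 (hi i / lo i) + 1) / 64"
        unfolding f1_def by (rule dyadic_truncated_abs_upper[OF lohi[OF i]])
      also have "hi i / lo i = 1000 * real d ^ 2" using w[OF i] d0 by (simp add: hi_def lo_def power2_eq_square field_simps)
      finally show "expectX N Q (\<lambda>X. f1 i (X i)) \<le> lg / 64" by (simp add: lg_def)
    qed (use w in \<open>auto simp: less_imp_le\<close>)
    also have "\<dots> = lg / 32 * (\<Sum>i\<in>I. w i)" by (simp add: sum_distrib_left mult_ac)
    also have "\<dots> \<le> lg / 32 * (2 * real d)" using lg by (intro mult_left_mono lewis_sum[OF fin L]) auto
    finally have E: "expectX N Q F1 \<le> real d * lg / 16" by (simp add: mult_ac)
    have pos: "0 < 1000 * (real d * lg / 16)" using lg d0 by simp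
    have "expectX N Q (\<lambda>X. of_bool (1000 * (real d * lg / 16) \<le> F1 X)) \<le> expectX N Q F1 / (1000 * (real d * lg / 16))"
      using w by (intro expect_markov[OF FX pos]) (auto simp: F1_def f1_def less_imp_le intro!: sum_nonneg)
    also have "\<dots> \<le> (real d * lg / 16) / (1000 * (real d * lg / 16))" using E pos by (intro divide_right_mono) auto
    also have "\<dots> \<le> 1/1000" using lg d0 by simp
    finally show ?thesis .
  qed
  have p2: "expectX N Q (\<lambda>X. of_bool (1000 * (C0 * real d) \<le> F2 X)) \<le> 1/1000"
  proof -
    have Gb: "expectX N Q (G b) = (\<Sum>i | i \<in> I \<and> h i = b. expect (dyadic Q) (dyadic_wt Q) (\<lambda>x. (fs i x)\<^sup>2) * ker d e i i)" for b
      unfolding G_def using N by (intro second_moment_ker) (auto simp: fs_def)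
    have "(\<Sum>b<r. expectX N Q (G b)) = (\<Sum>i\<in>I. expect (dyadic Q) (dyadic_wt Q) (\<lambda>x. (fs i x)\<^sup>2) * ker d e i i)"
      unfolding Gb by (rule sum_buckets[OF fin h])
    also have "\<dots> \<le> (\<Sum>i\<in>I. (lo i / 32) * (2 * (w i)\<^sup>2))"
      using lohi lewis_ker_le[OF fin L] unfolding fs_def
      by (intro sum_mono mult_mono trunc_second_moment) (auto simp: less_imp_le ker_self_nonneg)
    also have "\<dots> = (\<Sum>i\<in>I. w i) / (16 * real d)"
      using w d0 unfolding sum_divide_distrib by (intro sum.cong refl) (auto simp: lo_def power2_eq_square field_simps)
    also have "\<dots> \<le> (2 * real d) / (16 * real d)" by (intro divide_right_mono lewis_sum[OF fin L]) auto
    also have "\<dots> = 1/8" using d0 by simp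
    finally have EG: "(\<Sum>b<r. expectX N Q (G b)) \<le> 1/8" .
    \<comment> \<open>The parameter \<open>t = 1 / d\<close> balances the total variance 1/8,
      multiplied by \<open>d\<close>, against \<open>r / d\<close> from the number of buckets. This
      is where \<open>r\<close> of order \<open>d ^ 2\<close> is compatible with a bound of order
      \<open>d\<close>.\<close>
    have "expectX N Q F2 = (\<Sum>b<r. expectX N Q (\<lambda>X. sqrt (G b X)))" unfolding F2_def expect_sum ..
    also have "\<dots> \<le> (\<Sum>b<r. (expectX N Q (G b) / (1 / real d) + 1 / real d) / 2)"
      using d0 by (intro sum_mono expect_sqrt_le[OF FX]) (auto simp: G_def intro!: sum_nonneg)
    also have "\<dots> = real d / 2 * (\<Sum>b<r. expectX N Q (G b)) + real r / (2 * real d)"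
      by (simp add: sum.distrib add_divide_distrib sum_distrib_left mult_ac sum_divide_distrib flip: sum_distrib_right)
    also have "\<dots> \<le> real d / 2 * (1/8) + C0 * real d ^ 2 / (2 * real d)"
      using EG r d0 by (intro add_mono mult_left_mono divide_right_mono) auto
    also have "\<dots> = real d / 16 + C0 * real d / 2" using d0 by (simp add: power2_eq_square)
    also have "\<dots> \<le> C0 * real d" using C0 d0 mult_right_mono[of 1 C0 "real d"] by (simp add: field_simps)
    finally have E: "expectX N Q F2 \<le> C0 * real d" .
    have pos: "0 < 1000 * (C0 * real d)" using C0 d0 by simp
    have "expectX N Q (\<lambda>X. of_bool (1000 * (C0 * real d) \<le> F2 X)) \<le> expectX N Q F2 / (1000 * (C0 * real d))"
      by (intro expect_markov[OF FX pos]) (auto simp: F2_def G_def intro!: sum_nonneg)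
    also have "\<dots> \<le> (C0 * real d) / (1000 * (C0 * real d))" using E pos by (intro divide_right_mono) auto
    also have "\<dots> \<le> 1/1000" using C0 d0 by simp
    finally show ?thesis .
  qed
  have main: "(\<Sum>b<r. \<bar>\<Sum>i | i \<in> I \<and> h i = b. X i * y i\<bar>) \<le> (63 * lg + 1500 * C0) * real d * (\<Sum>i\<in>I. \<bar>y i\<bar>)"
    if y: "y \<in> range (mat_vec d A)" and X: "\<not> P0 X" "\<not> 1000 * (real d * lg / 16) \<le> F1 X" "\<not> 1000 * (C0 * real d) \<le> F2 X" for y X
  proof -
    define s where "s = (\<Sum>i\<in>I. \<bar>y i\<bar>)"
    have s0: "0 \<le> s" by (simp add: s_def sum_nonneg)
    have split: "\<bar>X i * y i - fs i (X i) * y i\<bar> \<le> f1 i (X i) * (2 * w i) * s" if i: "i \<in> I" for i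
    proof (cases "\<bar>X i\<bar> \<le> lo i")
      case True
      then show ?thesis using s0 w[OF i] by (simp add: fs_def f1_def)
    next
      case False
      then have "f1 i (X i) = \<bar>X i\<bar>" using X(1) i by (force simp: f1_def P0_def)
      moreover have "\<bar>X i\<bar> * \<bar>y i\<bar> \<le> \<bar>X i\<bar> * (2 * w i * s)"
        unfolding s_def by (intro mult_left_mono lewis_coord_le[OF fin L y i]) auto
      ultimately show ?thesis using False by (simp add: fs_def abs_mult mult_ac)
    qed
    have "\<bar>\<Sum>i | i \<in> I \<and> h i = b. X i * y i\<bar> \<le> (\<Sum>i | i \<in> I \<and> h i = b. f1 i (X i) * (2 * w i) * s) + sqrt 2 * s * sqrt (G b X)" for b
    proof -
      have "\<bar>\<Sum>i | i \<in> I \<and> h i = b. X i * y i\<bar> \<le> \<bar>\<Sum>i | i \<in> I \<and> h i = b. X i * y i - fs i (X i) * y i\<bar> + \<bar>\<Sum>i | i \<in> I \<and> h i = b. fs i (X i) * y i\<bar>"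
        unfolding sum_subtractf by linarith
      also have "\<bar>\<Sum>i | i \<in> I \<and> h i = b. fs i (X i) * y i\<bar> \<le> sqrt 2 * s * sqrt (G b X)"
        unfolding G_def s_def by (rule lewis_linear_le[OF fin L y]) auto
      also have "\<bar>\<Sum>i | i \<in> I \<and> h i = b. X i * y i - fs i (X i) * y i\<bar> \<le> (\<Sum>i | i \<in> I \<and> h i = b. f1 i (X i) * (2 * w i) * s)"
        using split by (intro order_trans[OF sum_abs] sum_mono) auto
      finally show ?thesis by linarith
    qed
    then have "(\<Sum>b<r. \<bar>\<Sum>i | i \<in> I \<and> h i = b. X i * y i\<bar>) \<le>
        (\<Sum>b<r. (\<Sum>i | i \<in> I \<and> h i = b. f1 i (X i) * (2 * w i) * s) + sqrt 2 * s * sqrt (G b X))"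
      by (intro sum_mono) auto
    also have "\<dots> = F1 X * s + sqrt 2 * s * F2 X"
      by (simp add: sum.distrib sum_buckets[OF fin h] F1_def F2_def sum_distrib_left sum_distrib_right)
    also have "\<dots> \<le> 1000 * (real d * lg / 16) * s + 1.5 * s * (1000 * (C0 * real d))"
    proof (intro add_mono mult_mono)
      show "sqrt 2 \<le> 1.5" by (intro real_le_lsqrt) (auto simp: power2_eq_square)
      show "0 \<le> F2 X" unfolding F2_def G_def by (intro sum_nonneg) (auto intro!: sum_nonneg)
    qed (use X s0 lg d0 in auto)
    also have "\<dots> \<le> (63 * lg + 1500 * C0) * real d * s"
    proof -
      have "1000 / 16 * (real d * lg * s) \<le> 63 * (real d * lg * s)"
        using s0 lg by (intro mult_right_mono) auto
      then show ?thesis by (simp add: algebra_simps)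
    qed
    finally show ?thesis by (simp add: s_def)
  qed
  have "expectX N Q (\<lambda>X. of_bool (\<exists>y\<in>range (mat_vec d A).
      (63 * lg + 1500 * C0) * real d * (\<Sum>i\<in>I. \<bar>y i\<bar>) < (\<Sum>b<r. \<bar>\<Sum>i | i \<in> I \<and> h i = b. X i * y i\<bar>)))
    \<le> expectX N Q (\<lambda>X. of_bool (P0 X)) + expectX N Q (\<lambda>X. of_bool (1000 * (real d * lg / 16) \<le> F1 X \<or> 1000 * (C0 * real d) \<le> F2 X))"
    using main by (intro expect_or[OF FX]) (meson linorder_not_le)
  also have "\<dots> \<le> expectX N Q (\<lambda>X. of_bool (P0 X)) + (expectX N Q (\<lambda>X. of_bool (1000 * (real d * lg / 16) \<le> F1 X)) + expectX N Q (\<lambda>X. of_bool (1000 * (C0 * real d) \<le> F2 X)))"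
    by (intro add_left_mono expect_or[OF FX]) auto
  finally show ?thesis using p0 p1 p2 unfolding lg_def by linarith
qed

section \<open>Symmetrization and contraction\<close>

abbreviation signs :: "nat set \<Rightarrow> (nat \<Rightarrow> real) set" where
  "signs B \<equiv> PiE B (\<lambda>_. {-1, 1})"

abbreviation expectS :: "nat set \<Rightarrow> ((nat \<Rightarrow> real) \<Rightarrow> real) \<Rightarrow> real" where
  "expectS B \<equiv> expect (signs B) (wprod B (\<lambda>_. 1/2))"

lemma expect_sign: "expect {-1, 1} (\<lambda>_. 1/2) f = (f (-1) + f (1::real)) / 2"
  by (simp add: expect_def)

lemma fin_prob_sign: "fin_prob {-1, 1::real} (\<lambda>_. 1/2)"
  by (simp add: fin_prob_def)

lemma fin_prob_signs: "finite B \<Longrightarrow> fin_prob (signs B) (wprod B (\<lambda>_. 1/2))"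
  by (intro fin_prob_PiE fin_prob_sign)

lemma Max_image_le: "finite T \<Longrightarrow> T \<noteq> {} \<Longrightarrow> (\<And>t. t \<in> T \<Longrightarrow> f t \<le> c) \<Longrightarrow> Max (f ` T) \<le> (c::real)"
  by (subst Max_le_iff) auto

lemma Max_image_ge: "finite T \<Longrightarrow> t \<in> T \<Longrightarrow> f t \<le> (Max (f ` T) :: real)"
  by (intro Max_ge) auto

text \<open>Let \<open>s\<close> and \<open>t\<close> be maximizers of the two maxima on the left.
  The change of \<phi> between them is at most \<open>\<bar>g t - g s\<bar>\<close>; according to
  the sign of \<open>g t - g s\<close>, insert \<open>s\<close> and \<open>t\<close> on the right in
  this order or exchanged.\<close>

lemma contraction_step:
  fixes f g :: "'t \<Rightarrow> real" and \<phi> :: "real \<Rightarrow> real"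
  assumes T: "finite T" "T \<noteq> {}" and lip: "\<And>u v. \<bar>\<phi> u - \<phi> v\<bar> \<le> \<bar>u - v\<bar>"
  shows "Max ((\<lambda>t. f t - \<phi> (g t)) ` T) + Max ((\<lambda>t. f t + \<phi> (g t)) ` T)
       \<le> Max ((\<lambda>t. f t - g t) ` T) + Max ((\<lambda>t. f t + g t) ` T)"
proof -
  have "Max ((\<lambda>t. f t - \<phi> (g t)) ` T) \<in> (\<lambda>t. f t - \<phi> (g t)) ` T" using T by (intro Max_in) auto
  then obtain s where s: "s \<in> T" "Max ((\<lambda>t. f t - \<phi> (g t)) ` T) = f s - \<phi> (g s)" by auto
  have "Max ((\<lambda>t. f t + \<phi> (g t)) ` T) \<in> (\<lambda>t. f t + \<phi> (g t)) ` T" using T by (intro Max_in) auto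
  then obtain t where t: "t \<in> T" "Max ((\<lambda>t. f t + \<phi> (g t)) ` T) = f t + \<phi> (g t)" by auto
  have m: "f s - g s \<le> Max ((\<lambda>t. f t - g t) ` T)" "f t - g t \<le> Max ((\<lambda>t. f t - g t) ` T)"
     "f s + g s \<le> Max ((\<lambda>t. f t + g t) ` T)" "f t + g t \<le> Max ((\<lambda>t. f t + g t) ` T)"
    using Max_image_ge[OF T(1) s(1), of "\<lambda>t. f t - g t"] Max_image_ge[OF T(1) t(1), of "\<lambda>t. f t - g t"]
      Max_image_ge[OF T(1) s(1), of "\<lambda>t. f t + g t"] Max_image_ge[OF T(1) t(1), of "\<lambda>t. f t + g t"] by auto
  show ?thesis unfolding s(2) t(2) using m lip[of "g t" "g s"] by linarith
qed

text \<open>The signs are treated one at a time with all others fixed. The function \<open>f\<close>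
  is arbitrary because in the induction it absorbs the coordinate that has already been replaced by
  its linear version.\<close>

lemma ledoux_talagrand_contraction:
  fixes f :: "'t \<Rightarrow> real" and \<phi> :: "nat \<Rightarrow> real \<Rightarrow> real"
  assumes T: "finite T" "T \<noteq> {}" and B: "finite B" and lip: "\<And>b u v. b \<in> B \<Longrightarrow> \<bar>\<phi> b u - \<phi> b v\<bar> \<le> \<bar>u - v\<bar>"
  shows "expectS B (\<lambda>\<epsilon>. Max ((\<lambda>t. f t + (\<Sum>b\<in>B. \<epsilon> b * \<phi> b (a b t))) ` T)) \<le> expectS B (\<lambda>\<epsilon>. Max ((\<lambda>t. f t + (\<Sum>b\<in>B. \<epsilon> b * a b t)) ` T))"
  using B lip
proof (induction B arbitrary: f rule: finite_induct)
  case empty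
  then show ?case by simp
next
  case (insert b B)
  have upd: "(\<Sum>c\<in>insert b B. (\<epsilon>(b := u)) c * F c) = u * F b + (\<Sum>c\<in>B. \<epsilon> c * F c)" for u :: real and F :: "nat \<Rightarrow> real" and \<epsilon>
  proof -
    have "(\<Sum>c\<in>B. (\<epsilon>(b := u)) c * F c) = (\<Sum>c\<in>B. \<epsilon> c * F c)"
      using insert(2) by (intro sum.cong) auto
    then show ?thesis using insert(1,2) by simp
  qed
  let ?M = "\<lambda>\<epsilon> u. Max ((\<lambda>t. f t + (u * \<phi> b (a b t) + (\<Sum>c\<in>B. \<epsilon> c * \<phi> c (a c t)))) ` T)"
  let ?L = "\<lambda>\<epsilon> u. Max ((\<lambda>t. f t + (u * a b t + (\<Sum>c\<in>B. \<epsilon> c * \<phi> c (a c t)))) ` T)"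
  let ?N = "\<lambda>\<epsilon> u. Max ((\<lambda>t. f t + (u * a b t + (\<Sum>c\<in>B. \<epsilon> c * a c t))) ` T)"
  have step: "?M \<epsilon> (-1) + ?M \<epsilon> 1 \<le> ?L \<epsilon> (-1) + ?L \<epsilon> 1" for \<epsilon>
    using contraction_step[OF T insert.prems[of b], of "\<lambda>t. f t + (\<Sum>c\<in>B. \<epsilon> c * \<phi> c (a c t))" "a b"]
    by (simp add: algebra_simps)
  have IH: "expectS B (\<lambda>\<epsilon>. ?L \<epsilon> u) \<le> expectS B (\<lambda>\<epsilon>. ?N \<epsilon> u)" for u
    using insert.IH[of "\<lambda>t. f t + u * a b t"] insert.prems by (simp add: add.assoc)
  have "expectS (insert b B) (\<lambda>\<epsilon>. Max ((\<lambda>t. f t + (\<Sum>b\<in>insert b B. \<epsilon> b * \<phi> b (a b t))) ` T)) = (expectS B (\<lambda>\<epsilon>. ?M \<epsilon> (-1)) + expectS B (\<lambda>\<epsilon>. ?M \<epsilon> 1)) / 2"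
    unfolding expect_PiE_insert[OF insert(1,2)] expect_sign upd ..
  also have "\<dots> \<le> (expectS B (\<lambda>\<epsilon>. ?L \<epsilon> (-1)) + expectS B (\<lambda>\<epsilon>. ?L \<epsilon> 1)) / 2"
    unfolding expect_add[symmetric] by (intro divide_right_mono expect_mono fin_prob_signs insert(1) step) auto
  also have "\<dots> \<le> (expectS B (\<lambda>\<epsilon>. ?N \<epsilon> (-1)) + expectS B (\<lambda>\<epsilon>. ?N \<epsilon> 1)) / 2"
    by (intro divide_right_mono add_mono IH) auto
  also have "\<dots> = expectS (insert b B) (\<lambda>\<epsilon>. Max ((\<lambda>t. f t + (\<Sum>b\<in>insert b B. \<epsilon> b * a b t)) ` T))"
    unfolding expect_PiE_insert[OF insert(1,2)] expect_sign upd ..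
  finally show ?case .
qed

lemma expect_swap_coords:
  fixes p :: "'a \<Rightarrow> real" and D :: "nat set" and G :: "(nat \<Rightarrow> 'a) \<Rightarrow> (nat \<Rightarrow> 'a) \<Rightarrow> real"
  assumes N: "finite N"
  defines "mix \<equiv> (\<lambda>X X' i. if i \<in> D then X' i else X i)"
  shows "expect (PiE N (\<lambda>_. S)) (wprod N p) (\<lambda>X. expect (PiE N (\<lambda>_. S)) (wprod N p) (\<lambda>X'. G X X')) =
         expect (PiE N (\<lambda>_. S)) (wprod N p) (\<lambda>X. expect (PiE N (\<lambda>_. S)) (wprod N p) (\<lambda>X'. G (mix X X') (mix X' X)))"
proof -
  let ?S = "PiE N (\<lambda>_. S)" and ?p = "wprod N p"
  define \<pi> where "\<pi> = (\<lambda>(X, X'). (mix X X', mix X' X))"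
  have inv: "\<pi> (\<pi> a) = a" for a by (cases a) (auto simp: \<pi>_def mix_def fun_eq_iff)
  have cl: "\<pi> a \<in> ?S \<times> ?S" if "a \<in> ?S \<times> ?S" for a
    using that by (auto simp: \<pi>_def mix_def PiE_iff extensional_def)
  have bij: "bij_betw \<pi> (?S \<times> ?S) (?S \<times> ?S)"
  proof (rule bij_betw_byWitness[where f'=\<pi>])
    show "\<forall>a\<in>?S \<times> ?S. \<pi> (\<pi> a) = a" "\<forall>a\<in>?S \<times> ?S. \<pi> (\<pi> a) = a" by (simp_all add: inv)
    show "\<pi> ` (?S \<times> ?S) \<subseteq> ?S \<times> ?S" "\<pi> ` (?S \<times> ?S) \<subseteq> ?S \<times> ?S"
      by (rule image_subsetI, rule cl, assumption)+
  qed
  have wt: "(\<lambda>(a,b). ?p a * ?p b) (\<pi> c) = (\<lambda>(a,b). ?p a * ?p b) c" for c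
  proof -
    obtain X X' where c: "c = (X, X')" by (cases c)
    have "?p (mix X X') * ?p (mix X' X) = (\<Prod>i\<in>N. p (X i) * p (X' i))"
      unfolding wprod_def prod.distrib[symmetric] by (intro prod.cong) (auto simp: mix_def)
    then show ?thesis by (simp add: c \<pi>_def wprod_def prod.distrib)
  qed
  have "expect (?S \<times> ?S) (\<lambda>(a,b). ?p a * ?p b) (\<lambda>c. (\<lambda>(X,X'). G X X') (\<pi> c)) = expect (?S \<times> ?S) (\<lambda>(a,b). ?p a * ?p b) (\<lambda>(X,X'). G X X')"
    by (rule expect_reindex) (rule bij, rule wt)
  then show ?thesis by (simp add: expect_Times \<pi>_def)
qed

lemma expect_flip_signs:
  assumes N: "finite N" and eps: "\<And>i. i \<in> N \<Longrightarrow> \<epsilon> i = 1 \<or> \<epsilon> i = (-1::real)"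
  shows "expectX N Q (\<lambda>X. F (\<lambda>i. if i \<in> N then \<epsilon> i * X i else X i)) = expectX N Q F"
proof (rule expect_reindex)
  let ?\<pi> = "\<lambda>X i. if i \<in> N then \<epsilon> i * X i else X i"
  have e2: "\<epsilon> i * (\<epsilon> i * u) = u" if "i \<in> N" for i u using eps[OF that] by auto
  show "bij_betw ?\<pi> (rowspace N Q) (rowspace N Q)"
  proof (rule bij_betw_byWitness[where f'="?\<pi>"])
    show "?\<pi> ` rowspace N Q \<subseteq> rowspace N Q"
      using eps dyadic_uminus by (fastforce simp: PiE_iff extensional_def)
    then show "?\<pi> ` rowspace N Q \<subseteq> rowspace N Q" .
  qed (auto simp: e2 fun_eq_iff)
  show "wprod N (dyadic_wt Q) (?\<pi> X) = wprod N (dyadic_wt Q) X" for X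
    unfolding wprod_def using eps by (intro prod.cong refl) (fastforce simp: dyadic_wt_def)
qed

text \<open>The signs belong to buckets and not to rows. By \<open>loc\<close> a bucket term depends
  on the rows of its own bucket only, so exchanging \<open>X\<close> and its independent copy on all
  rows of the buckets with sign -1 negates exactly the differences of these buckets. Splitting each
  difference into its two terms gives the factor 2.\<close>

lemma symmetrization:
  fixes \<Psi> :: "nat \<Rightarrow> (nat \<Rightarrow> real) \<Rightarrow> 't \<Rightarrow> real"
  assumes N: "finite N" and B: "finite B" and T: "finite T" "T \<noteq> {}"
    and loc: "\<And>b X X' t. b \<in> B \<Longrightarrow> (\<And>i. i \<in> N \<Longrightarrow> h i = b \<Longrightarrow> X i = X' i) \<Longrightarrow> \<Psi> b X t = \<Psi> b X' t"
  shows "expectX N Q (\<lambda>X. Max ((\<lambda>t. \<Sum>b\<in>B. expectX N Q (\<lambda>X'. \<Psi> b X' t) - \<Psi> b X t) ` T))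
       \<le> 2 * expectX N Q (\<lambda>X. expectS B (\<lambda>\<epsilon>. Max ((\<lambda>t. \<Sum>b\<in>B. \<epsilon> b * \<Psi> b X t) ` T)))"
proof -
  note FX = fin_prob_X[OF N, of Q]
  define M where "M = (\<lambda>\<epsilon> X X'. Max ((\<lambda>t. \<Sum>b\<in>B. \<epsilon> b * (\<Psi> b X' t - \<Psi> b X t)) ` T))"
  define V where "V = (\<lambda>\<epsilon>. expectX N Q (\<lambda>X. Max ((\<lambda>t. \<Sum>b\<in>B. \<epsilon> b * \<Psi> b X t) ` T)))"
  let ?E = "expectX N Q (\<lambda>X. expectX N Q (\<lambda>X'. M (\<lambda>_. 1) X X'))"
  have first: "expectX N Q (\<lambda>X. Max ((\<lambda>t. \<Sum>b\<in>B. expectX N Q (\<lambda>X'. \<Psi> b X' t) - \<Psi> b X t) ` T)) \<le> ?E"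
  proof (intro expect_mono[OF FX] Max_image_le T)
    fix X t assume t: "t \<in> T"
    have "(\<Sum>b\<in>B. expectX N Q (\<lambda>X'. \<Psi> b X' t) - \<Psi> b X t) = expectX N Q (\<lambda>X'. \<Sum>b\<in>B. 1 * (\<Psi> b X' t - \<Psi> b X t))"
      by (simp add: expect_sum expect_diff expect_const[OF FX])
    also have "\<dots> \<le> expectX N Q (\<lambda>X'. M (\<lambda>_. 1) X X')"
      unfolding M_def by (intro expect_mono[OF FX] Max_image_ge[OF T(1) t])
    finally show "(\<Sum>b\<in>B. expectX N Q (\<lambda>X'. \<Psi> b X' t) - \<Psi> b X t) \<le> expectX N Q (\<lambda>X'. M (\<lambda>_. 1) X X')" .
  qed
  have signed: "?E \<le> V \<epsilon> + V (\<lambda>b. - \<epsilon> b)" if eps: "\<epsilon> \<in> signs B" for \<epsilon>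
  proof -
    let ?D = "{i. h i \<in> B \<and> \<epsilon> (h i) = -1}"
    let ?mix = "\<lambda>X X' i. if i \<in> ?D then X' i else X i"
    have mixM: "M (\<lambda>_. 1) (?mix X X') (?mix X' X) = M \<epsilon> X X'" for X X'
    proof -
      have "1 * (\<Psi> b (?mix X' X) t - \<Psi> b (?mix X X') t) = \<epsilon> b * (\<Psi> b X' t - \<Psi> b X t)" if b: "b \<in> B" for b t
      proof (cases "\<epsilon> b = -1")
        case True
        have "\<Psi> b (?mix X' X) t = \<Psi> b X t" "\<Psi> b (?mix X X') t = \<Psi> b X' t"
          using True b by (auto intro!: loc)
        then show ?thesis using True by simp
      next
        case False
        then have "\<epsilon> b = 1" using eps b by (auto simp: PiE_iff)
        moreover have "\<Psi> b (?mix X' X) t = \<Psi> b X' t" "\<Psi> b (?mix X X') t = \<Psi> b X t"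
          using False b by (auto intro!: loc)
        ultimately show ?thesis by simp
      qed
      then show ?thesis unfolding M_def by (intro arg_cong[where f=Max] image_cong sum.cong refl)
    qed
    have "?E = expectX N Q (\<lambda>X. expectX N Q (\<lambda>X'. M (\<lambda>_. 1) (?mix X X') (?mix X' X)))"
      by (rule expect_swap_coords[OF N])
    also have "\<dots> = expectX N Q (\<lambda>X. expectX N Q (\<lambda>X'. M \<epsilon> X X'))" unfolding mixM ..
    also have "\<dots> \<le> expectX N Q (\<lambda>X. expectX N Q (\<lambda>X'. Max ((\<lambda>t. \<Sum>b\<in>B. \<epsilon> b * \<Psi> b X' t) ` T) + Max ((\<lambda>t. \<Sum>b\<in>B. (- \<epsilon> b) * \<Psi> b X t) ` T)))"
    proof (intro expect_mono[OF FX])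
      fix X X'
      show "M \<epsilon> X X' \<le> Max ((\<lambda>t. \<Sum>b\<in>B. \<epsilon> b * \<Psi> b X' t) ` T) + Max ((\<lambda>t. \<Sum>b\<in>B. (- \<epsilon> b) * \<Psi> b X t) ` T)"
        unfolding M_def
      proof (intro Max_image_le T)
        fix t assume t: "t \<in> T"
        show "(\<Sum>b\<in>B. \<epsilon> b * (\<Psi> b X' t - \<Psi> b X t)) \<le> Max ((\<lambda>t. \<Sum>b\<in>B. \<epsilon> b * \<Psi> b X' t) ` T) + Max ((\<lambda>t. \<Sum>b\<in>B. (- \<epsilon> b) * \<Psi> b X t) ` T)"
          using Max_image_ge[OF T(1) t, of "\<lambda>t. \<Sum>b\<in>B. \<epsilon> b * \<Psi> b X' t"]
            Max_image_ge[OF T(1) t, of "\<lambda>t. \<Sum>b\<in>B. (- \<epsilon> b) * \<Psi> b X t"]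
          by (simp add: right_diff_distrib sum_subtractf sum_negf)
      qed
    qed
    also have "\<dots> = V \<epsilon> + V (\<lambda>b. - \<epsilon> b)"
      unfolding expect_add expect_const[OF FX] V_def by simp
    finally show ?thesis .
  qed
  have flip: "expectS B (\<lambda>\<epsilon>. V (\<lambda>b. - \<epsilon> b)) = expectS B V"
  proof -
    \<comment> \<open>The negation is confined to \<open>B\<close> because members of
      \<open>signs B\<close> must remain \<open>undefined\<close> elsewhere.\<close>
    let ?\<pi> = "\<lambda>\<epsilon> b. if b \<in> B then - \<epsilon> b else \<epsilon> b :: real"
    have "expectS B (\<lambda>\<epsilon>. V (?\<pi> \<epsilon>)) = expectS B V"
    proof (rule expect_reindex)
      show "bij_betw ?\<pi> (signs B) (signs B)"
        by (rule bij_betw_byWitness[where f'="?\<pi>"]) (auto simp: PiE_iff extensional_def fun_eq_iff)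
    qed (simp add: wprod_def)
    moreover have "V (?\<pi> \<epsilon>) = V (\<lambda>b. - \<epsilon> b)" for \<epsilon>
      unfolding V_def by (intro expect_cong arg_cong[where f=Max] image_cong sum.cong refl) auto
    ultimately show ?thesis by simp
  qed
  have "?E = expectS B (\<lambda>_. ?E)" by (simp add: expect_const[OF fin_prob_signs[OF B]])
  also have "\<dots> \<le> expectS B (\<lambda>\<epsilon>. V \<epsilon> + V (\<lambda>b. - \<epsilon> b))"
    by (intro expect_mono[OF fin_prob_signs[OF B]] signed)
  also have "\<dots> = 2 * expectS B V" by (simp add: expect_add flip)
  also have "expectS B V = expectX N Q (\<lambda>X. expectS B (\<lambda>\<epsilon>. Max ((\<lambda>t. \<Sum>b\<in>B. \<epsilon> b * \<Psi> b X t) ` T)))"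
    unfolding V_def by (rule expect_swap)
  finally show ?thesis using first by linarith
qed

text \<open>After symmetrization \<open>X\<close> is fixed and only the signs vary; then
  \<open>nk b X\<close> is a constant 0 or 1 and the map from \<open>u\<close> to
  \<open>nk b X * \<bar>u\<bar>\<close> is 1-Lipschitz, so contraction removes both the indicator
  and the absolute value. Since \<open>f\<close> is odd and the entries are symmetric, the signs of
  the buckets are absorbed into \<open>X\<close>. What remains is a linear process without buckets,
  dominated by \<open>W\<close>.\<close>

lemma uniform_deviation:
  fixes Y :: "(nat \<Rightarrow> real) set" and B :: "nat set"
  assumes N: "finite N" and B: "finite B" and J: "J \<subseteq> N" and h: "\<And>i. i \<in> N \<Longrightarrow> h i \<in> B"
    and odd: "\<And>i x. f i (- x) = - f i x"
    and nk: "\<And>b X. nk b X = 0 \<or> nk b X = (1::real)"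
    and loc: "\<And>b X X'. b \<in> B \<Longrightarrow> (\<And>i. i \<in> N \<Longrightarrow> h i = b \<Longrightarrow> X i = X' i) \<Longrightarrow> nk b X = nk b X'"
    and Y0: "(\<lambda>_. 0) \<in> Y"
    and W: "\<And>y X. y \<in> Y \<Longrightarrow> X \<in> rowspace N Q \<Longrightarrow> (\<Sum>i\<in>J. f i (X i) * y i) \<le> W X"
    and D: "expectX N Q W \<le> D" and s: "0 < s"
  defines "\<Psi> \<equiv> (\<lambda>b X y. nk b X * \<bar>\<Sum>i | i \<in> J \<and> h i = b. f i (X i) * y i\<bar>)"
  shows "expectX N Q (\<lambda>X. of_bool (\<exists>y\<in>Y. s \<le> (\<Sum>b\<in>B. expectX N Q (\<lambda>X'. \<Psi> b X' y) - \<Psi> b X y))) \<le> 2 * D / s"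
proof -
  note FX = fin_prob_X[OF N, of Q]
  have finJ: "finite J" using N J finite_subset by blast
  define dev where "dev = (\<lambda>X y. \<Sum>b\<in>B. expectX N Q (\<lambda>X'. \<Psi> b X' y) - \<Psi> b X y)"
  \<comment> \<open>The supremum only ranges over finitely many \<open>y\<close>: one bad choice for each bad \<open>X\<close>.\<close>
  define ch where "ch = (\<lambda>X. SOME y. y \<in> Y \<and> s \<le> dev X y)"
  have ch: "ch X \<in> Y \<and> s \<le> dev X (ch X)" if "\<exists>y\<in>Y. s \<le> dev X y" for X
  proof -
    have "\<exists>y. y \<in> Y \<and> s \<le> dev X y" using that by blast
    then show ?thesis unfolding ch_def by (rule someI_ex)
  qed
  define T where "T = insert (\<lambda>_. 0) (ch ` {X \<in> rowspace N Q. \<exists>y\<in>Y. s \<le> dev X y})"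
  have T: "finite T" "T \<noteq> {}" using fin_probD(1)[OF FX] by (auto simp: T_def)
  have TY: "T \<subseteq> Y" using ch Y0 by (auto simp: T_def)
  have dev0: "dev X (\<lambda>_. 0) = 0" for X by (simp add: dev_def \<Psi>_def expect_const[OF FX])
  define Z where "Z = (\<lambda>X b y. \<Sum>i | i \<in> J \<and> h i = b. f i (X i) * y i)"
  have "expectX N Q (\<lambda>X. of_bool (\<exists>y\<in>Y. s \<le> dev X y)) \<le> expectX N Q (\<lambda>X. Max (dev X ` T)) / s"
  proof (rule expect_markov[OF FX s])
    fix X assume X: "X \<in> rowspace N Q"
    show "0 \<le> Max (dev X ` T)"
      using Max_image_ge[OF T(1), of "\<lambda>_. 0" "dev X"] dev0 by (auto simp: T_def)
    assume b: "\<exists>y\<in>Y. s \<le> dev X y"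
    then have "ch X \<in> T" using X by (auto simp: T_def)
    then show "s \<le> Max (dev X ` T)"
      using ch[OF b] Max_image_ge[OF T(1), of "ch X" "dev X"] by linarith
  qed
  also have "expectX N Q (\<lambda>X. Max (dev X ` T)) \<le> 2 * expectX N Q (\<lambda>X. expectS B (\<lambda>\<epsilon>. Max ((\<lambda>y. \<Sum>b\<in>B. \<epsilon> b * \<Psi> b X y) ` T)))"
    unfolding dev_def
  proof (rule symmetrization[OF N B T, where h=h])
    fix b :: nat and X X' :: "nat \<Rightarrow> real" and y :: "nat \<Rightarrow> real" assume b: "b \<in> B" and eq: "\<And>i. i \<in> N \<Longrightarrow> h i = b \<Longrightarrow> X i = X' i"
    have "(\<Sum>i | i \<in> J \<and> h i = b. f i (X i) * y i) = (\<Sum>i | i \<in> J \<and> h i = b. f i (X' i) * y i)"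
      using eq J by (intro sum.cong) auto
    then show "\<Psi> b X y = \<Psi> b X' y" using loc[OF b eq] by (simp add: \<Psi>_def)
  qed
  also have "expectX N Q (\<lambda>X. expectS B (\<lambda>\<epsilon>. Max ((\<lambda>y. \<Sum>b\<in>B. \<epsilon> b * \<Psi> b X y) ` T)))
     \<le> expectX N Q (\<lambda>X. expectS B (\<lambda>\<epsilon>. Max ((\<lambda>y. \<Sum>b\<in>B. \<epsilon> b * Z X b y) ` T)))"
  proof (intro expect_mono[OF FX])
    fix X
    have "expectS B (\<lambda>\<epsilon>. Max ((\<lambda>y. 0 + (\<Sum>b\<in>B. \<epsilon> b * (\<lambda>u. nk b X * \<bar>u\<bar>) (Z X b y))) ` T))
       \<le> expectS B (\<lambda>\<epsilon>. Max ((\<lambda>y. 0 + (\<Sum>b\<in>B. \<epsilon> b * Z X b y)) ` T))"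
    proof (rule ledoux_talagrand_contraction[OF T B, where \<phi>="\<lambda>b u. nk b X * \<bar>u\<bar>"])
      fix b u v
      show "\<bar>nk b X * \<bar>u\<bar> - nk b X * \<bar>v\<bar>\<bar> \<le> \<bar>u - v\<bar>" using nk[of b X] by auto
    qed
    then show "expectS B (\<lambda>\<epsilon>. Max ((\<lambda>y. \<Sum>b\<in>B. \<epsilon> b * \<Psi> b X y) ` T)) \<le> expectS B (\<lambda>\<epsilon>. Max ((\<lambda>y. \<Sum>b\<in>B. \<epsilon> b * Z X b y) ` T))"
      by (simp add: \<Psi>_def Z_def)
  qed
  also have "\<dots> = expectS B (\<lambda>\<epsilon>. expectX N Q (\<lambda>X. Max ((\<lambda>y. \<Sum>b\<in>B. \<epsilon> b * Z X b y) ` T)))" by (rule expect_swap)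
  also have "\<dots> \<le> expectS B (\<lambda>\<epsilon>. D)"
  proof (intro expect_mono[OF fin_prob_signs[OF B]])
    fix \<epsilon> assume eps: "\<epsilon> \<in> signs B"
    let ?\<pi> = "\<lambda>X i. if i \<in> N then \<epsilon> (h i) * X i else X i"
    have e: "\<epsilon> (h i) = 1 \<or> \<epsilon> (h i) = -1" if "i \<in> N" for i using eps h[OF that] by (auto simp: PiE_iff)
    have lin: "(\<Sum>b\<in>B. \<epsilon> b * Z X b y) = (\<Sum>i\<in>J. f i (?\<pi> X i) * y i)" for X y
    proof -
      have "(\<Sum>b\<in>B. \<epsilon> b * Z X b y) = (\<Sum>b\<in>B. \<Sum>i | i \<in> J \<and> h i = b. f i (?\<pi> X i) * y i)"
        unfolding Z_def sum_distrib_left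
      proof (intro sum.cong refl)
        fix b i assume "b \<in> B" "i \<in> {i \<in> J. h i = b}"
        then have i: "i \<in> N" "h i = b" using J by auto
        then show "\<epsilon> b * (f i (X i) * y i) = f i (?\<pi> X i) * y i" using e[OF i(1)] odd[of i "X i"] by auto
      qed
      also have "\<dots> = (\<Sum>i\<in>J. f i (?\<pi> X i) * y i)"
        using h J by (intro sum.group finJ B) auto
      finally show ?thesis .
    qed
    have "expectX N Q (\<lambda>X. Max ((\<lambda>y. \<Sum>b\<in>B. \<epsilon> b * Z X b y) ` T)) = expectX N Q (\<lambda>X. Max ((\<lambda>y. \<Sum>i\<in>J. f i (X i) * y i) ` T))"
      unfolding lin by (rule expect_flip_signs[OF N e, where F="\<lambda>X. Max ((\<lambda>y. \<Sum>i\<in>J. f i (X i) * y i) ` T)"])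
    also have "\<dots> \<le> expectX N Q W"
      using TY W by (intro expect_mono[OF FX] Max_image_le T) auto
    finally show "expectX N Q (\<lambda>X. Max ((\<lambda>y. \<Sum>b\<in>B. \<epsilon> b * Z X b y) ` T)) \<le> D" using D by linarith
  qed
  also have "\<dots> = D" by (simp add: expect_const[OF fin_prob_signs[OF B]])
  finally show ?thesis using s unfolding dev_def by (simp add: divide_right_mono)
qed

section \<open>Rows of medium weight\<close>

lemma exp_le_quadratic:
  fixes u :: real
  assumes "\<bar>u\<bar> \<le> 1"
  shows "exp u \<le> 1 + u + u\<^sup>2"
proof (cases "0 \<le> u")
  case True
  then show ?thesis using assms exp_bound[of u] by simp
next
  case False
  define v where "v = - u"
  have v: "0 < v" "v \<le> 1" using False assms by (auto simp: v_def)
  have "1 + v \<le> exp v" by simp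
  then have "exp u \<le> 1 / (1 + v)" using v by (simp add: v_def exp_minus field_simps)
  also have "\<dots> \<le> 1 - v + v\<^sup>2"
  proof -
    have "1 \<le> 1 + v ^ 3" using v by simp
    also have "\<dots> = (1 - v + v\<^sup>2) * (1 + v)" by (simp add: power2_eq_square power3_eq_cube algebra_simps)
    finally show ?thesis using v by (simp add: field_simps)
  qed
  finally show ?thesis by (simp add: v_def)
qed

text \<open>The smallness condition keeps each exponent in the range of
  \<open>exp_le_quadratic\<close>. The linear term has mean 0 by symmetry, and the truncated second
  moment is at most \<open>t / 32\<close>.\<close>

lemma subgaussian_linear:
  assumes N: "finite N" "J \<subseteq> N" and t: "0 \<le> t" and small: "\<And>i. i \<in> J \<Longrightarrow> \<bar>\<mu> * a i\<bar> * t \<le> 1"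
  shows "expectX N Q (\<lambda>X. exp (\<mu> * (\<Sum>i\<in>J. X i * of_bool (\<bar>X i\<bar> \<le> t) * a i))) \<le> exp (\<mu>\<^sup>2 * t / 32 * (\<Sum>i\<in>J. (a i)\<^sup>2))"
proof -
  have fJ: "finite J" using N finite_subset by blast
  let ?f = "\<lambda>x::real. x * of_bool (\<bar>x\<bar> \<le> t)"
  have "expectX N Q (\<lambda>X. exp (\<mu> * (\<Sum>i\<in>J. ?f (X i) * a i))) = expectX N Q (\<lambda>X. \<Prod>i\<in>J. exp (\<mu> * a i * ?f (X i)))"
    using fJ by (simp add: sum_distrib_left exp_sum[symmetric] mult_ac)
  also have "\<dots> = (\<Prod>i\<in>J. expect (dyadic Q) (dyadic_wt Q) (\<lambda>x. exp (\<mu> * a i * ?f x)))"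
    by (rule expect_prod[OF N fin_prob_dyadic, where f="\<lambda>i x. exp (\<mu> * a i * ?f x)"])
  also have "\<dots> \<le> (\<Prod>i\<in>J. exp ((\<mu> * a i)\<^sup>2 * (t / 32)))"
  proof (intro prod_mono conjI)
    fix i assume i: "i \<in> J"
    show "0 \<le> expect (dyadic Q) (dyadic_wt Q) (\<lambda>x. exp (\<mu> * a i * ?f x))" by (intro expect_nonneg fin_prob_dyadic) auto
    have bd: "\<bar>\<mu> * a i * ?f x\<bar> \<le> 1" for x
    proof -
      have "\<bar>?f x\<bar> \<le> t" using t by auto
      then have "\<bar>\<mu> * a i\<bar> * \<bar>?f x\<bar> \<le> \<bar>\<mu> * a i\<bar> * t" by (intro mult_left_mono) auto
      then show ?thesis using small[OF i] by (simp only: abs_mult)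
    qed
    have "expect (dyadic Q) (dyadic_wt Q) (\<lambda>x. exp (\<mu> * a i * ?f x)) \<le> expect (dyadic Q) (dyadic_wt Q) (\<lambda>x. 1 + \<mu> * a i * ?f x + (\<mu> * a i * ?f x)\<^sup>2)"
      by (intro expect_mono fin_prob_dyadic exp_le_quadratic bd)
    also have "\<dots> = 1 + \<mu> * a i * expect (dyadic Q) (dyadic_wt Q) ?f + (\<mu> * a i)\<^sup>2 * expect (dyadic Q) (dyadic_wt Q) (\<lambda>x. (?f x)\<^sup>2)"
      by (simp add: expect_add expect_cmult expect_const[OF fin_prob_dyadic] power_mult_distrib)
    also have "\<dots> \<le> 1 + (\<mu> * a i)\<^sup>2 * (t / 32)"
      using mult_left_mono[OF trunc_second_moment[OF t, of Q], of "(\<mu> * a i)\<^sup>2"] expect_dyadic_odd[of ?f Q] by simp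
    also have "\<dots> \<le> exp ((\<mu> * a i)\<^sup>2 * (t / 32))" by (rule exp_ge_add_one_self)
    finally show "expect (dyadic Q) (dyadic_wt Q) (\<lambda>x. exp (\<mu> * a i * ?f x)) \<le> exp ((\<mu> * a i)\<^sup>2 * (t / 32))" .
  qed
  also have "\<dots> = exp (\<mu>\<^sup>2 * t / 32 * (\<Sum>i\<in>J. (a i)\<^sup>2))"
    using fJ by (simp add: exp_sum[symmetric] sum_distrib_left power_mult_distrib mult_ac)
  finally show ?thesis .
qed

text \<open>Pair \<open>x\<close> with \<open>- x\<close>: the two absolute values add up to at
  least \<open>2 * \<bar>x * c\<bar>\<close>. Hence the remainder \<rho> of a bucket cannot cancel
  the mean contribution of one row.\<close>

lemma expect_symmetric_abs:
  assumes f: "\<And>x. 0 \<le> f x" "\<And>x. f (- x) = f x"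
  shows "\<bar>c\<bar> * expect (dyadic Q) (dyadic_wt Q) (\<lambda>x. \<bar>x\<bar> * f x) \<le> expect (dyadic Q) (dyadic_wt Q) (\<lambda>x. f x * \<bar>x * c + \<rho>\<bar>)"
proof -
  let ?E = "expect (dyadic Q) (dyadic_wt Q)"
  have "2 * (\<bar>c\<bar> * ?E (\<lambda>x. \<bar>x\<bar> * f x)) = ?E (\<lambda>x. 2 * (\<bar>c\<bar> * (\<bar>x\<bar> * f x)))" by (simp add: expect_cmult)
  also have "\<dots> \<le> ?E (\<lambda>x. f x * \<bar>x * c + \<rho>\<bar> + f (- x) * \<bar>- x * c + \<rho>\<bar>)"
  proof (intro expect_mono fin_prob_dyadic)
    fix x
    have "2 * (\<bar>x\<bar> * \<bar>c\<bar>) \<le> \<bar>x * c + \<rho>\<bar> + \<bar>- x * c + \<rho>\<bar>" by (simp add: abs_mult[symmetric])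
    then have "f x * (2 * (\<bar>x\<bar> * \<bar>c\<bar>)) \<le> f x * (\<bar>x * c + \<rho>\<bar> + \<bar>- x * c + \<rho>\<bar>)" by (intro mult_left_mono f)
    then show "2 * (\<bar>c\<bar> * (\<bar>x\<bar> * f x)) \<le> f x * \<bar>x * c + \<rho>\<bar> + f (- x) * \<bar>- x * c + \<rho>\<bar>"
      by (simp add: f(2) algebra_simps)
  qed
  also have "\<dots> = 2 * ?E (\<lambda>x. f x * \<bar>x * c + \<rho>\<bar>)"
    unfolding expect_add by (simp only: expect_dyadic_uminus[where f="\<lambda>x. f x * \<bar>x * c + \<rho>\<bar>"])
  finally show ?thesis by simp
qed

text \<open>For each row of \<open>S\<close> consider the event that its entry lies between
  \<open>T1\<close> and its level, that no other row of \<open>S\<close> reaches \<open>T1\<close>,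
  and that no other entry in the bucket exceeds its level. These events are disjoint. By
  \<open>un\<close> the conditions on the other rows hold with probability at least 1/2, and given
  them the row contributes at least its l1 share, by symmetry of its entry.\<close>

lemma mean_bucket:
  assumes N: "finite N" "R \<subseteq> N" and S: "S \<subseteq> R" and T1: "1 \<le> T1"
    and \<beta>: "\<And>i. i \<in> S \<Longrightarrow> T1 \<le> \<beta> i \<and> \<beta> i \<le> 2 ^ Q"
    and un: "(\<Sum>i\<in>R. expect (dyadic Q) (dyadic_wt Q) (\<lambda>x. of_bool (\<beta> i < \<bar>x\<bar>))) + (\<Sum>i\<in>S. expect (dyadic Q) (dyadic_wt Q) (\<lambda>x. of_bool (T1 \<le> \<bar>x\<bar>))) \<le> 1/2"
    and g: "\<And>i. i \<in> S \<Longrightarrow> g \<le> log 2 (\<beta> i / T1) - 1" and g0: "0 \<le> g"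
  shows "g / 128 * (\<Sum>i\<in>S. \<bar>y i\<bar>) \<le> expectX N Q (\<lambda>X. of_bool (\<forall>i\<in>R. \<bar>X i\<bar> \<le> \<beta> i) * \<bar>\<Sum>i\<in>R. X i * of_bool (\<bar>X i\<bar> \<le> \<beta> i) * y i\<bar>)"
proof -
  note FX = fin_prob_X[OF N(1), of Q]
  have fR: "finite R" using N finite_subset by blast
  have fS: "finite S" using S fR finite_subset by blast
  let ?z = "\<lambda>i x. x * of_bool (\<bar>x\<bar> \<le> \<beta> i) :: real"
  define Z where "Z = (\<lambda>X. \<bar>\<Sum>i\<in>R. ?z i (X i) * y i\<bar>)"
  \<comment> \<open>It imposes no condition on \<open>X i\<close>, so that coordinate
    \<open>i\<close> can be resampled independently of it.\<close>
  define Oth where "Oth = (\<lambda>i X. (\<forall>j\<in>R-{i}. \<bar>X j\<bar> \<le> \<beta> j) \<and> (\<forall>j\<in>S-{i}. \<bar>X j\<bar> < T1))"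
  define a where "a = (\<lambda>i x. of_bool (T1 \<le> \<bar>x\<bar> \<and> \<bar>x\<bar> \<le> \<beta> i) :: real)"
  have Z0: "0 \<le> Z X" for X by (simp add: Z_def)
  have pair_wt: "(\<Sum>i\<in>S. of_bool (Oth i X) * (a i (X i) * Z X)) \<le> of_bool (\<forall>i\<in>R. \<bar>X i\<bar> \<le> \<beta> i) * Z X" for X
  proof (cases "\<exists>i\<in>S. Oth i X \<and> T1 \<le> \<bar>X i\<bar> \<and> \<bar>X i\<bar> \<le> \<beta> i")
    case True
    then obtain i where i: "i \<in> S" "Oth i X" "T1 \<le> \<bar>X i\<bar>" "\<bar>X i\<bar> \<le> \<beta> i" by auto
    have nk: "\<forall>j\<in>R. \<bar>X j\<bar> \<le> \<beta> j"
    proof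
      fix j assume "j \<in> R"
      then show "\<bar>X j\<bar> \<le> \<beta> j" using i(2,4) unfolding Oth_def by (cases "j = i") auto
    qed
    have "(\<Sum>j\<in>S. of_bool (Oth j X) * (a j (X j) * Z X)) = (\<Sum>j\<in>S. if j = i then of_bool (Oth j X) * (a j (X j) * Z X) else 0)"
    proof (intro sum.cong refl)
      fix j assume "j \<in> S"
      then have "j \<noteq> i \<Longrightarrow> \<bar>X j\<bar> < T1" using i(2) by (auto simp: Oth_def)
      then show "of_bool (Oth j X) * (a j (X j) * Z X) = (if j = i then of_bool (Oth j X) * (a j (X j) * Z X) else 0)"
        by (auto simp: a_def)
    qed
    also have "\<dots> = Z X" using i fS by (simp add: a_def)
    finally show ?thesis using nk by simp
  next
    case False
    then have "(\<Sum>i\<in>S. of_bool (Oth i X) * (a i (X i) * Z X)) = 0"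
      by (intro sum.neutral) (auto simp: a_def)
    then show ?thesis using Z0 by simp
  qed
  have low: "\<bar>y i\<bar> * (g / 64) * (1/2) \<le> expectX N Q (\<lambda>X. of_bool (Oth i X) * (a i (X i) * Z X))" if i: "i \<in> S" for i
  proof -
    have iR: "i \<in> R" and iN: "i \<in> N" using i S N by auto
    have b1: "1 \<le> \<beta> i" using \<beta>[OF i] T1 by linarith
    have upd: "Oth i (X(i := x)) = Oth i X" for X x by (auto simp: Oth_def)
    have inner: "\<bar>y i\<bar> * (g / 64) \<le> expect (dyadic Q) (dyadic_wt Q) (\<lambda>x. a i x * Z (X(i := x)))" for X
    proof -
      define \<rho> where "\<rho> = (\<Sum>j\<in>R-{i}. ?z j (X j) * y j)"
      have Zu: "a i x * Z (X(i := x)) = a i x * \<bar>x * y i + \<rho>\<bar>" for x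
      proof -
        have "(\<Sum>j\<in>R. ?z j ((X(i := x)) j) * y j) = ?z i x * y i + \<rho>"
          unfolding \<rho>_def by (subst sum.remove[OF fR iR]) (auto intro!: sum.cong)
        then show ?thesis by (auto simp: Z_def a_def)
      qed
      have "g / 64 \<le> (log 2 (\<beta> i / T1) - 1) / 64" using g[OF i] by simp
      also have "\<dots> \<le> expect (dyadic Q) (dyadic_wt Q) (\<lambda>x. \<bar>x\<bar> * a i x)"
        unfolding a_def using \<beta>[OF i] T1 by (intro dyadic_truncated_abs_lower) auto
      finally have "\<bar>y i\<bar> * (g / 64) \<le> \<bar>y i\<bar> * expect (dyadic Q) (dyadic_wt Q) (\<lambda>x. \<bar>x\<bar> * a i x)" by (intro mult_left_mono) auto
      also have "\<dots> \<le> expect (dyadic Q) (dyadic_wt Q) (\<lambda>x. a i x * \<bar>x * y i + \<rho>\<bar>)"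
        by (intro expect_symmetric_abs) (auto simp: a_def)
      finally show ?thesis unfolding Zu .
    qed
    have "1 - 1/2 \<le> expectX N Q (\<lambda>X. of_bool (Oth i X))"
    proof -
      have "expectX N Q (\<lambda>X. 1 - of_bool (Oth i X)) \<le> expectX N Q (\<lambda>X. (\<Sum>j\<in>R. of_bool (\<beta> j < \<bar>X j\<bar>)) + (\<Sum>j\<in>S. of_bool (T1 \<le> \<bar>X j\<bar>)))"
      proof (intro expect_mono[OF FX])
        fix X
        show "1 - of_bool (Oth i X) \<le> (\<Sum>j\<in>R. of_bool (\<beta> j < \<bar>X j\<bar>)) + (\<Sum>j\<in>S. of_bool (T1 \<le> \<bar>X j\<bar>) :: real)"
        proof (cases "Oth i X")
          case True then show ?thesis by (simp add: sum_nonneg)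
        next
          case False
          then consider j where "j \<in> R" "\<beta> j < \<bar>X j\<bar>" | j where "j \<in> S" "T1 \<le> \<bar>X j\<bar>"
            by (force simp: Oth_def not_le not_less)
          then show ?thesis
          proof cases
            case 1
            have "of_bool (\<beta> j < \<bar>X j\<bar>) \<le> (\<Sum>j\<in>R. of_bool (\<beta> j < \<bar>X j\<bar>) :: real)"
              using 1 fR by (intro member_le_sum) auto
            moreover have "0 \<le> (\<Sum>j\<in>S. of_bool (T1 \<le> \<bar>X j\<bar>) :: real)" by (simp add: sum_nonneg)
            ultimately show ?thesis using 1 False by simp
          next
            case 2
            have "of_bool (T1 \<le> \<bar>X j\<bar>) \<le> (\<Sum>j\<in>S. of_bool (T1 \<le> \<bar>X j\<bar>) :: real)"
              using 2 fS by (intro member_le_sum) auto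
            moreover have "0 \<le> (\<Sum>j\<in>R. of_bool (\<beta> j < \<bar>X j\<bar>) :: real)" by (simp add: sum_nonneg)
            ultimately show ?thesis using 2 False by simp
          qed
        qed
      qed
      also have "\<dots> = (\<Sum>j\<in>R. expectX N Q (\<lambda>X. of_bool (\<beta> j < \<bar>X j\<bar>))) + (\<Sum>j\<in>S. expectX N Q (\<lambda>X. of_bool (T1 \<le> \<bar>X j\<bar>)))"
        by (simp add: expect_add expect_sum)
      also have "(\<Sum>j\<in>R. expectX N Q (\<lambda>X. of_bool (\<beta> j < \<bar>X j\<bar>))) = (\<Sum>j\<in>R. expect (dyadic Q) (dyadic_wt Q) (\<lambda>x. of_bool (\<beta> j < \<bar>x\<bar>)))"
        using N by (intro sum.cong refl expect_coord[where f="\<lambda>x. of_bool (c < \<bar>x\<bar>)" for c] fin_prob_dyadic) auto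
      also have "(\<Sum>j\<in>S. expectX N Q (\<lambda>X. of_bool (T1 \<le> \<bar>X j\<bar>))) = (\<Sum>j\<in>S. expect (dyadic Q) (dyadic_wt Q) (\<lambda>x. of_bool (T1 \<le> \<bar>x\<bar>)))"
        using N S by (intro sum.cong refl expect_coord[where f="\<lambda>x. of_bool (c \<le> \<bar>x\<bar>)" for c] fin_prob_dyadic) auto
      finally show ?thesis using un by (simp add: expect_diff expect_const[OF FX])
    qed
    then have "\<bar>y i\<bar> * (g / 64) * (1/2) \<le> \<bar>y i\<bar> * (g / 64) * expectX N Q (\<lambda>X. of_bool (Oth i X))"
      using g0 by (intro mult_left_mono) auto
    also have "\<dots> = expectX N Q (\<lambda>X. of_bool (Oth i X) * (\<bar>y i\<bar> * (g / 64)))"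
      by (rule trans[OF mult.commute expect_multc[symmetric]])
    also have "\<dots> \<le> expectX N Q (\<lambda>X. of_bool (Oth i X) * expect (dyadic Q) (dyadic_wt Q) (\<lambda>x. a i x * Z (X(i := x))))"
      by (intro expect_mono[OF FX] mult_left_mono inner) auto
    also have "\<dots> = expectX N Q (\<lambda>X. of_bool (Oth i X) * (a i (X i) * Z X))"
      by (subst expect_resample[OF N(1) iN fin_prob_dyadic, where F="\<lambda>X. of_bool (Oth i X) * (a i (X i) * Z X)"])
         (simp add: upd expect_cmult)
    finally show ?thesis .
  qed
  have "g / 128 * (\<Sum>i\<in>S. \<bar>y i\<bar>) = (\<Sum>i\<in>S. \<bar>y i\<bar> * (g / 64) * (1/2))"
    by (simp add: sum_distrib_left mult_ac)
  also have "\<dots> \<le> expectX N Q (\<lambda>X. \<Sum>i\<in>S. of_bool (Oth i X) * (a i (X i) * Z X))"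
    unfolding expect_sum by (intro sum_mono low)
  also have "\<dots> \<le> expectX N Q (\<lambda>X. of_bool (\<forall>i\<in>R. \<bar>X i\<bar> \<le> \<beta> i) * Z X)"
    by (intro expect_mono[OF FX] pair_wt)
  finally show ?thesis unfolding Z_def .
qed

text \<open>The randomness is in \<open>X\<close> alone, for bucket functions with bounded loads
  \<open>l1\<close> and \<open>l2\<close>. The mean is at least \<open>g * \<kappa> / 128\<close>,
  and it suffices to exclude a downward deviation by half of it. In the dominating variable of
  \<open>uniform_deviation\<close>, light rows enter through their second moment in the kernel of
  \<open>I\<close>, medium rows through the kernel of \<open>M\<close>, and heavy rows vanish
  because their level is 0.\<close>

lemma medium_event:
  fixes \<delta> \<kappa> :: real and h :: "nat \<Rightarrow> nat"
  assumes N: "finite N" "I \<subseteq> N" and L: "lewis_upto I d A 2 w e"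
    and M: "M = {i \<in> I. 1 / \<delta> ^ 34 \<le> w i}" and L': "lewis_upto M d A 2 w' e'"
    and d: "real d = \<delta> ^ 32" and \<delta>: "2 < \<delta>" and big: "ln (4 * \<delta> ^ 66 + 1) + 3 \<le> \<delta>"
    and Q: "\<delta> ^ 3 \<le> 2 ^ Q" and h: "\<And>i. i \<in> N \<Longrightarrow> h i < r"
    and l1: "\<And>b. b < r \<Longrightarrow> (\<Sum>i | i \<in> I \<and> h i = b. min (w i) (1 / \<delta> ^ 34)) \<le> 1 / (8 * real d)"
    and l2: "\<And>b. b < r \<Longrightarrow> (\<Sum>i | i \<in> M \<and> h i = b. min (w' i) (1 / \<delta> ^ 5)) \<le> 7 * (1 / \<delta> ^ 5)"
    and \<kappa>: "0 < \<kappa>"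
  shows "expectX N Q (\<lambda>X. of_bool (\<exists>y\<in>range (mat_vec d A). (\<Sum>i\<in>I. \<bar>y i\<bar>) \<le> 1 \<and>
       \<kappa> \<le> (\<Sum>i | i \<in> M \<and> w' i < 1 / \<delta> ^ 5. \<bar>y i\<bar>) \<and>
       (\<Sum>b<r. \<bar>\<Sum>i | i \<in> I \<and> h i = b. X i * y i\<bar>) \<le> (log 2 \<delta> - 1) * \<kappa> / 256)) \<le> 1024 / ((log 2 \<delta> - 1) * \<kappa>)"
proof -
  note FX = fin_prob_X[OF N(1), of Q]
  have fin: "finite I" using N finite_subset by blast
  have MI: "M \<subseteq> I" by (auto simp: M)
  have finM: "finite M" using fin MI finite_subset by blast
  have w: "0 < w i" if "i \<in> I" for i using lewis_pos[OF fin L that] .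
  have w': "0 < w' i" if "i \<in> M" for i using lewis_pos[OF finM L' that] .
  define \<theta> \<eta> where "\<theta> = 1 / \<delta> ^ 34" and "\<eta> = 1 / \<delta> ^ 5"
  have \<theta>0: "0 < \<theta>" and \<eta>0: "0 < \<eta>" and \<delta>0: "0 < \<delta>" using \<delta> by (auto simp: \<theta>_def \<eta>_def)
  have d0: "0 < real d" using d \<delta>0 by simp
  have d\<theta>: "1 / (real d * \<theta>) = \<delta> ^ 2"
  proof -
    have "\<delta> ^ 34 / \<delta> ^ 32 = \<delta> ^ (34 - 32)" using \<delta>0 by (intro power_diff[symmetric]) auto
    then show ?thesis by (simp add: d \<theta>_def)
  qed
  have \<eta>5: "\<delta> ^ 2 * \<delta> ^ 3 * \<eta> = 1"
  proof -
    have "\<delta> ^ 5 = \<delta> ^ 2 * \<delta> ^ 3" by (simp flip: power_add)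
    then show ?thesis using \<delta>0 by (simp add: \<eta>_def)
  qed
  define g where "g = log 2 \<delta> - 1"
  have g0: "0 < g" using \<delta> by (simp add: g_def less_log_iff)
  define S where "S = {i \<in> M. w' i < \<eta>}"
  have SM: "S \<subseteq> M" by (auto simp: S_def)
  have finS: "finite S" using SM finM finite_subset by blast
  \<comment> \<open>Entries above the level \<open>\<beta>\<close> disqualify their bucket; at level \<open>0\<close>, every active heavy row does.\<close>
  define \<beta> where "\<beta> = (\<lambda>i. if i \<in> M then if w' i < \<eta> then \<delta> ^ 3 else 0 else if i \<in> I then 1 / (real d * w i) else 0)"
  have \<beta>0: "0 \<le> \<beta> i" for i using w[of i] \<delta>0 by (auto simp: \<beta>_def less_imp_le)
  have \<beta>S: "\<beta> i = \<delta> ^ 3" if "i \<in> S" for i using that by (auto simp: \<beta>_def S_def)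
  have \<beta>H: "\<beta> i = 0" if "i \<in> M - S" for i using that by (auto simp: \<beta>_def S_def)
  have \<beta>L: "\<beta> i = 1 / (real d * w i)" if "i \<in> I - M" for i using that by (auto simp: \<beta>_def)
  define f where "f = (\<lambda>i x. x * of_bool (\<bar>x\<bar> \<le> \<beta> i) :: real)"
  define nk where "nk = (\<lambda>b X. of_bool (\<forall>i\<in>{i \<in> I. h i = b}. \<bar>X i\<bar> \<le> \<beta> i) :: real)"
  define \<Psi> where "\<Psi> = (\<lambda>b X y. nk b X * \<bar>\<Sum>i | i \<in> I \<and> h i = b. f i (X i) * y i\<bar>)"
  have \<Psi>le: "\<Psi> b X y \<le> \<bar>\<Sum>i | i \<in> I \<and> h i = b. X i * y i\<bar>" for b X y
  proof (cases "nk b X = 0")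
    case False
    then have "(\<Sum>i | i \<in> I \<and> h i = b. f i (X i) * y i) = (\<Sum>i | i \<in> I \<and> h i = b. X i * y i)"
      by (intro sum.cong refl) (auto simp: nk_def f_def)
    then show ?thesis by (simp add: \<Psi>_def nk_def)
  qed (simp add: \<Psi>_def)
  have mean: "g / 128 * (\<Sum>i | i \<in> S \<and> h i = b. \<bar>y i\<bar>) \<le> expectX N Q (\<lambda>X. \<Psi> b X y)" if b: "b < r" for b y
  proof -
    let ?R = "{i \<in> I. h i = b}" and ?S = "{i \<in> S. h i = b}"
    let ?E = "expect (dyadic Q) (dyadic_wt Q)"
    have finR: "finite ?R" using fin by auto
    define m where "m = (\<lambda>i. min (w i) \<theta>)"
    have m0: "0 \<le> m i" if "i \<in> I" for i using w[OF that] \<theta>0 by (simp add: m_def less_imp_le)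
    have mM: "m i = \<theta>" if "i \<in> M" for i using that by (auto simp: m_def M \<theta>_def)
    have mL: "m i = w i" if "i \<in> I" "i \<notin> M" for i using that by (auto simp: m_def M \<theta>_def)
    have l1': "(\<Sum>i\<in>?R. m i) \<le> 1 / (8 * real d)" using l1[OF b] by (simp add: m_def \<theta>_def)
    \<comment> \<open>Each row is charged to one of the two loads: a heavy row to \<open>l2\<close>,
      where it counts as one unit \<eta>, and a light or medium row to \<open>l1\<close>, where a
      medium row counts as one unit \<theta>.\<close>
    have u: "?E (\<lambda>x. of_bool (\<beta> i < \<bar>x\<bar>)) \<le> (if i \<in> M then min (w' i) \<eta> else 0) / (32 * \<eta>) + m i * (1 / (32 * \<delta> ^ 3 * \<theta>) + real d / 32)"
      if i: "i \<in> ?R" for i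
    proof -
      consider "i \<in> S" | "i \<in> M - S" | "i \<in> I - M" using i by blast
      then show ?thesis
      proof cases
        case 1
        have "?E (\<lambda>x. of_bool (\<beta> i < \<bar>x\<bar>)) \<le> ?E (\<lambda>x. of_bool (\<delta> ^ 3 \<le> \<bar>x\<bar>))"
          using \<beta>S[OF 1] by (intro expect_mono fin_prob_dyadic) auto
        also have "\<dots> \<le> 1 / (32 * \<delta> ^ 3)" using \<delta>0 by (intro dyadic_tail) auto
        also have "\<dots> = m i * (1 / (32 * \<delta> ^ 3 * \<theta>))" using mM 1 SM \<theta>0 by auto
        also have "\<dots> \<le> m i * (1 / (32 * \<delta> ^ 3 * \<theta>) + real d / 32)"
          using m0 i by (intro mult_left_mono) auto
        finally show ?thesis using w'[of i] \<eta>0 1 SM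
          by (smt (verit, ccfv_threshold) divide_nonneg_pos min_def subsetD)
      next
        case 2
        have "?E (\<lambda>x. of_bool (\<beta> i < \<bar>x\<bar>)) \<le> 1 / 32" using \<beta>0 by (intro dyadic_nonzero) auto
        also have "\<dots> = min (w' i) \<eta> / (32 * \<eta>)" using 2 \<eta>0 by (auto simp: S_def min_def)
        finally have a: "?E (\<lambda>x. of_bool (\<beta> i < \<bar>x\<bar>)) \<le> min (w' i) \<eta> / (32 * \<eta>)" .
        have "0 \<le> m i * (1 / (32 * \<delta> ^ 3 * \<theta>) + real d / 32)"
          using m0 i \<delta>0 \<theta>0 by (intro mult_nonneg_nonneg add_nonneg_nonneg) auto
        then show ?thesis using a 2 by simp
      next
        case 3
        then have wi: "0 < w i" using w by auto
        have pos: "0 < 1 / (real d * w i)" using wi d0 by simp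
        have "?E (\<lambda>x. of_bool (\<beta> i < \<bar>x\<bar>)) \<le> ?E (\<lambda>x. of_bool (1 / (real d * w i) \<le> \<bar>x\<bar>))"
          using \<beta>L[OF 3] by (intro expect_mono fin_prob_dyadic) auto
        also have "\<dots> \<le> 1 / (32 * (1 / (real d * w i)))" by (rule dyadic_tail[OF pos])
        also have "\<dots> = m i * (real d / 32)" using mL 3 by auto
        also have "\<dots> \<le> m i * (1 / (32 * \<delta> ^ 3 * \<theta>) + real d / 32)"
          using m0 i \<delta>0 \<theta>0 by (intro mult_left_mono) auto
        finally show ?thesis using 3 by simp
      qed
    qed
    have v: "?E (\<lambda>x. of_bool (\<delta> ^ 2 \<le> \<bar>x\<bar>)) \<le> m i * (1 / (32 * \<delta> ^ 2 * \<theta>))" if i: "i \<in> ?S" for i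
    proof -
      have "?E (\<lambda>x. of_bool (\<delta> ^ 2 \<le> \<bar>x\<bar>)) \<le> 1 / (32 * \<delta> ^ 2)" using \<delta>0 by (intro dyadic_tail) auto
      also have "\<dots> = m i * (1 / (32 * \<delta> ^ 2 * \<theta>))" using mM i SM \<theta>0 by auto
      finally show ?thesis .
    qed
    \<comment> \<open>The heavy rows amount to at most 7 units of probability 1/32 each. The load
      \<open>l1\<close> makes each of the three remaining terms at most 1/256.\<close>
    have un: "(\<Sum>i\<in>?R. ?E (\<lambda>x. of_bool (\<beta> i < \<bar>x\<bar>))) + (\<Sum>i\<in>?S. ?E (\<lambda>x. of_bool (\<delta> ^ 2 \<le> \<bar>x\<bar>))) \<le> 1/2"
    proof -
      have "(\<Sum>i\<in>?R. ?E (\<lambda>x. of_bool (\<beta> i < \<bar>x\<bar>))) \<le> (\<Sum>i\<in>?R. (if i \<in> M then min (w' i) \<eta> else 0) / (32 * \<eta>) + m i * (1 / (32 * \<delta> ^ 3 * \<theta>) + real d / 32))"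
        by (intro sum_mono u)
      also have "\<dots> = (\<Sum>i\<in>?R. if i \<in> M then min (w' i) \<eta> else 0) / (32 * \<eta>) + (\<Sum>i\<in>?R. m i) * (1 / (32 * \<delta> ^ 3 * \<theta>) + real d / 32)"
        by (simp only: sum.distrib sum_divide_distrib sum_distrib_right)
      also have "(\<Sum>i\<in>?R. if i \<in> M then min (w' i) \<eta> else 0) = (\<Sum>i | i \<in> M \<and> h i = b. min (w' i) \<eta>)"
        using MI by (subst sum.inter_filter[OF finR, symmetric]) (auto intro!: sum.cong)
      also have "(\<Sum>i | i \<in> M \<and> h i = b. min (w' i) \<eta>) / (32 * \<eta>) \<le> 7 * \<eta> / (32 * \<eta>)"
        using l2[OF b] \<eta>0 by (intro divide_right_mono) (auto simp: \<eta>_def)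
      finally have a: "(\<Sum>i\<in>?R. ?E (\<lambda>x. of_bool (\<beta> i < \<bar>x\<bar>))) \<le> 7/32 + (\<Sum>i\<in>?R. m i) * (1 / (32 * \<delta> ^ 3 * \<theta>) + real d / 32)"
        using \<eta>0 by simp
      have "(\<Sum>i\<in>?S. ?E (\<lambda>x. of_bool (\<delta> ^ 2 \<le> \<bar>x\<bar>))) \<le> (\<Sum>i\<in>?S. m i * (1 / (32 * \<delta> ^ 2 * \<theta>)))"
        by (intro sum_mono v)
      also have "\<dots> = (\<Sum>i\<in>?S. m i) * (1 / (32 * \<delta> ^ 2 * \<theta>))" by (simp only: sum_distrib_right)
      also have "\<dots> \<le> (\<Sum>i\<in>?R. m i) * (1 / (32 * \<delta> ^ 2 * \<theta>))"
        using SM MI m0 \<delta>0 \<theta>0 finR by (intro mult_right_mono sum_mono2) auto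
      finally have b: "(\<Sum>i\<in>?S. ?E (\<lambda>x. of_bool (\<delta> ^ 2 \<le> \<bar>x\<bar>))) \<le> (\<Sum>i\<in>?R. m i) * (1 / (32 * \<delta> ^ 2 * \<theta>))" .
      have "(\<Sum>i\<in>?R. m i) * (1 / (32 * \<delta> ^ 3 * \<theta>) + real d / 32 + 1 / (32 * \<delta> ^ 2 * \<theta>)) \<le> 1 / (8 * real d) * (1 / (32 * \<delta> ^ 3 * \<theta>) + real d / 32 + 1 / (32 * \<delta> ^ 2 * \<theta>))"
        using l1' \<delta>0 \<theta>0 by (intro mult_right_mono add_nonneg_nonneg) auto
      also have "\<dots> = 1 / (256 * \<delta>) + 1/256 + 1/256"
      proof -
        have "1 / (8 * real d) * (1 / (32 * \<delta> ^ 3 * \<theta>)) = 1 / (real d * \<theta>) / (256 * \<delta> ^ 3)" by simp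
        also have "\<dots> = 1 / (256 * \<delta>)" unfolding d\<theta> using \<delta>0 by (simp add: power2_eq_square power3_eq_cube)
        finally have 1: "1 / (8 * real d) * (1 / (32 * \<delta> ^ 3 * \<theta>)) = 1 / (256 * \<delta>)" .
        have "1 / (8 * real d) * (1 / (32 * \<delta> ^ 2 * \<theta>)) = 1 / (real d * \<theta>) / (256 * \<delta> ^ 2)" by simp
        also have "\<dots> = 1 / 256" unfolding d\<theta> using \<delta>0 by simp
        finally have 2: "1 / (8 * real d) * (1 / (32 * \<delta> ^ 2 * \<theta>)) = 1 / 256" .
        have 3: "1 / (8 * real d) * (real d / 32) = 1 / 256" using d0 by simp
        show ?thesis unfolding distrib_left 1 2 3 ..
      qed
      also have "\<dots> \<le> 3/256" using \<delta> by (simp add: field_simps)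
      finally show ?thesis using a b by (simp add: algebra_simps)
    qed
    have "g / 128 * (\<Sum>i\<in>?S. \<bar>y i\<bar>) \<le> expectX N Q (\<lambda>X. of_bool (\<forall>i\<in>?R. \<bar>X i\<bar> \<le> \<beta> i) * \<bar>\<Sum>i\<in>?R. X i * of_bool (\<bar>X i\<bar> \<le> \<beta> i) * y i\<bar>)"
    proof (rule mean_bucket[OF N(1) _ _ _ _ un])
      show "?R \<subseteq> N" "?S \<subseteq> ?R" using N SM MI by auto
      show "1 \<le> \<delta> ^ 2" using \<delta> by (intro one_le_power) auto
      show "0 \<le> g" using g0 by simp
      fix i assume "i \<in> ?S"
      then have bi: "\<beta> i = \<delta> ^ 3" using \<beta>S by auto
      have "\<delta> ^ 2 \<le> \<delta> ^ 3" using \<delta> by (intro power_increasing) auto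
      then show "\<delta> ^ 2 \<le> \<beta> i \<and> \<beta> i \<le> 2 ^ Q" using bi Q by simp
      have "\<beta> i / \<delta> ^ 2 = \<delta>" using \<delta>0 bi by (simp add: power2_eq_square power3_eq_cube)
      then show "g \<le> log 2 (\<beta> i / \<delta> ^ 2) - 1" by (simp add: g_def)
    qed
    then show ?thesis by (simp add: \<Psi>_def nk_def f_def)
  qed
  define Y where "Y = {y \<in> range (mat_vec d A). (\<Sum>i\<in>I. \<bar>y i\<bar>) \<le> 1}"
  define G where "G = (\<lambda>X. \<Sum>l<d. (\<Sum>i\<in>I - M. f i (X i) * e l i)\<^sup>2)"
  define \<Lambda> where "\<Lambda> = ln (2 * real (card M) + 1)"
  define v where "v = (\<lambda>j X. \<Sum>i\<in>S. X i * of_bool (\<bar>X i\<bar> \<le> \<delta> ^ 3) * (ker d e' i j / w' j))"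
  \<comment> \<open>A soft maximum of the values \<open>\<bar>v j X\<bar>\<close>: apply
    \<open>1 + u \<le> exp u\<close> with
    \<open>u = \<delta> * \<bar>v j X\<bar> - \<Lambda>\<close> and replace the exponential by the
    sum over all \<open>j\<close> and both signs. The choice of \<Lambda> bounds the mean of the
    exponential part by 3.\<close>
  define W2 where "W2 = (\<lambda>X. (\<Lambda> + exp (- \<Lambda>) * (\<Sum>j\<in>M. exp (\<delta> * v j X) + exp ((- \<delta>) * v j X))) / \<delta>)"
  have \<Lambda>0: "0 \<le> \<Lambda>" by (simp add: \<Lambda>_def)
  have W20: "0 \<le> W2 X" for X unfolding W2_def using \<Lambda>0 \<delta>0 by (auto intro!: divide_nonneg_nonneg add_nonneg_nonneg mult_nonneg_nonneg sum_nonneg)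
  have vW: "\<bar>v j X\<bar> \<le> W2 X" if j: "j \<in> M" for j X
  proof -
    have "exp (\<delta> * \<bar>v j X\<bar>) \<le> exp (\<delta> * v j X) + exp ((- \<delta>) * v j X)"
      by (cases "0 \<le> v j X") auto
    also have "\<dots> \<le> (\<Sum>j\<in>M. exp (\<delta> * v j X) + exp ((- \<delta>) * v j X))"
      using finM j by (intro member_le_sum[where f="\<lambda>j. exp (\<delta> * v j X) + exp ((- \<delta>) * v j X)"]) (auto intro: add_nonneg_nonneg)
    finally have "exp (- \<Lambda>) * exp (\<delta> * \<bar>v j X\<bar>) \<le> exp (- \<Lambda>) * (\<Sum>j\<in>M. exp (\<delta> * v j X) + exp ((- \<delta>) * v j X))"
      by (intro mult_left_mono) auto
    moreover have "exp (- \<Lambda>) * exp (\<delta> * \<bar>v j X\<bar>) = exp (\<delta> * \<bar>v j X\<bar> - \<Lambda>)" by (simp add: exp_diff exp_minus field_simps)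
    moreover have "1 + (\<delta> * \<bar>v j X\<bar> - \<Lambda>) \<le> exp (\<delta> * \<bar>v j X\<bar> - \<Lambda>)" by (rule exp_ge_add_one_self)
    ultimately have "\<delta> * \<bar>v j X\<bar> \<le> \<Lambda> + exp (- \<Lambda>) * (\<Sum>j\<in>M. exp (\<delta> * v j X) + exp ((- \<delta>) * v j X))" by linarith
    then show ?thesis using \<delta>0 by (simp add: W2_def field_simps)
  qed
  have W: "(\<Sum>i\<in>I. f i (X i) * y i) \<le> sqrt 2 * sqrt (G X) + W2 X" if y: "y \<in> Y" for y X
  proof -
    have yr: "y \<in> range (mat_vec d A)" and y1: "(\<Sum>i\<in>I. \<bar>y i\<bar>) \<le> 1" using y by (auto simp: Y_def)
    have yM: "(\<Sum>i\<in>M. \<bar>y i\<bar>) \<le> 1" using sum_mono2[OF fin MI, of "\<lambda>i. \<bar>y i\<bar>"] y1 by simp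
    have "(\<Sum>i\<in>I. f i (X i) * y i) = (\<Sum>i\<in>I - M. f i (X i) * y i) + ((\<Sum>i\<in>M - S. f i (X i) * y i) + (\<Sum>i\<in>S. f i (X i) * y i))"
      using sum.subset_diff[OF MI fin, of "\<lambda>i. f i (X i) * y i"] sum.subset_diff[OF SM finM, of "\<lambda>i. f i (X i) * y i"] by simp
    also have "(\<Sum>i\<in>M - S. f i (X i) * y i) = 0" using \<beta>H by (intro sum.neutral) (auto simp: f_def)
    \<comment> \<open>The reproducing formula moves the randomness into \<open>v j\<close>, which
      does not depend on \<open>y\<close>. As the masses \<open>\<bar>y j\<bar>\<close> on
      \<open>M\<close> sum to at most 1, only the maximum over \<open>j\<close> matters.\<close>
    also have "(\<Sum>i\<in>S. f i (X i) * y i) = (\<Sum>j\<in>M. y j * v j X)"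
    proof -
      have "(\<Sum>i\<in>S. f i (X i) * y i) = (\<Sum>i\<in>S. \<Sum>j\<in>M. X i * of_bool (\<bar>X i\<bar> \<le> \<delta> ^ 3) * (ker d e' i j * y j / w' j))"
        using \<beta>S SM ker_reproducing[OF finM w' lewis_onb[OF finM L'] yr]
        by (intro sum.cong refl) (auto simp: f_def sum_distrib_left)
      also have "\<dots> = (\<Sum>j\<in>M. \<Sum>i\<in>S. X i * of_bool (\<bar>X i\<bar> \<le> \<delta> ^ 3) * (ker d e' i j * y j / w' j))"
        by (rule sum.swap)
      also have "\<dots> = (\<Sum>j\<in>M. y j * v j X)" by (simp add: v_def sum_distrib_left mult_ac)
      finally show ?thesis .
    qed
    also have "(\<Sum>j\<in>M. y j * v j X) \<le> (\<Sum>j\<in>M. \<bar>y j\<bar> * W2 X)"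
    proof (intro sum_mono)
      fix j assume j: "j \<in> M"
      have "y j * v j X \<le> \<bar>y j\<bar> * \<bar>v j X\<bar>" by (simp flip: abs_mult)
      also have "\<dots> \<le> \<bar>y j\<bar> * W2 X" by (intro mult_left_mono vW j) auto
      finally show "y j * v j X \<le> \<bar>y j\<bar> * W2 X" .
    qed
    also have "\<dots> \<le> 1 * W2 X" using yM W20 unfolding sum_distrib_right[symmetric] by (intro mult_right_mono)
    also have "(\<Sum>i\<in>I - M. f i (X i) * y i) \<le> sqrt 2 * (\<Sum>i\<in>I. \<bar>y i\<bar>) * sqrt (G X)"
      unfolding G_def using lewis_linear_le[OF fin L yr, of "I - M" "\<lambda>i. f i (X i)"] by auto
    also have "\<dots> \<le> sqrt 2 * 1 * sqrt (G X)"
      using y1 by (intro mult_right_mono mult_left_mono) (auto simp: G_def intro!: sum_nonneg)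
    finally show ?thesis by simp
  qed
  have EG: "expectX N Q G \<le> 1/8"
  proof -
    have "expectX N Q G = (\<Sum>i\<in>I - M. expect (dyadic Q) (dyadic_wt Q) (\<lambda>x. (f i x)\<^sup>2) * ker d e i i)"
      unfolding G_def using N by (intro second_moment_ker) (auto simp: f_def)
    also have "\<dots> \<le> (\<Sum>i\<in>I - M. (\<beta> i / 32) * (2 * (w i)\<^sup>2))"
      using \<beta>0 lewis_ker_le[OF fin L] unfolding f_def
      by (intro sum_mono mult_mono trunc_second_moment) (auto simp: ker_self_nonneg)
    also have "\<dots> = (\<Sum>i\<in>I - M. w i) / (16 * real d)"
      using w d0 unfolding sum_divide_distrib by (intro sum.cong refl) (auto simp: \<beta>L power2_eq_square field_simps)
    also have "\<dots> \<le> (\<Sum>i\<in>I. w i) / (16 * real d)"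
      using w fin by (intro divide_right_mono sum_mono2) (auto simp: less_imp_le)
    also have "\<dots> \<le> (2 * real d) / (16 * real d)" by (intro divide_right_mono lewis_sum[OF fin L]) auto
    also have "\<dots> = 1/8" using d0 by simp
    finally show ?thesis .
  qed
  have EW2: "expectX N Q W2 \<le> 1"
  proof -
    have mgf: "expectX N Q (\<lambda>X. exp (\<mu> * v j X)) \<le> 3" if j: "j \<in> M" and \<mu>: "\<bar>\<mu>\<bar> = \<delta>" for j \<mu>
    proof -
      have a: "\<bar>ker d e' i j / w' j\<bar> \<le> 2 * w' i" if "i \<in> M" for i
        using lewis_ker_abs_le[OF finM L' that j] w'[OF j] by (simp add: field_simps)
      have "expectX N Q (\<lambda>X. exp (\<mu> * v j X)) \<le> exp (\<mu>\<^sup>2 * \<delta> ^ 3 / 32 * (\<Sum>i\<in>S. (ker d e' i j / w' j)\<^sup>2))"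
        unfolding v_def
      proof (rule subgaussian_linear)
        show "finite N" "S \<subseteq> N" "0 \<le> \<delta> ^ 3" using N MI SM \<delta>0 by auto
        fix i assume i: "i \<in> S"
        have "\<bar>\<mu> * (ker d e' i j / w' j)\<bar> * \<delta> ^ 3 = \<delta> * \<bar>ker d e' i j / w' j\<bar> * \<delta> ^ 3" by (simp only: abs_mult \<mu>)
        also have "\<dots> \<le> \<delta> * (2 * \<eta>) * \<delta> ^ 3"
        proof -
          have "\<bar>ker d e' i j / w' j\<bar> \<le> 2 * \<eta>" using a[of i] i by (auto simp: S_def)
          then show ?thesis using \<delta>0 by (intro mult_right_mono mult_left_mono) auto
        qed
        also have "\<dots> = 2 / \<delta>" using \<eta>5 \<delta>0 by (simp add: power2_eq_square field_simps)
        also have "\<dots> \<le> 1" using \<delta> by simp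
        finally show "\<bar>\<mu> * (ker d e' i j / w' j)\<bar> * \<delta> ^ 3 \<le> 1" .
      qed
      also have "\<dots> \<le> exp 1"
      proof (subst exp_le_cancel_iff)
        \<comment> \<open>Extract one factor \<open>w' i \<le> \<eta>\<close>; the rest is
          \<open>ker_sq_sum\<close> and gives at most \<open>2 * \<eta>\<close>. This is where rows
          with \<open>w' i\<close> above \<eta> would be harmful.\<close>
        have "(\<Sum>i\<in>S. (ker d e' i j / w' j)\<^sup>2) \<le> (\<Sum>i\<in>S. \<eta> / (w' j)\<^sup>2 * ((ker d e' j i)\<^sup>2 / w' i))"
        proof (intro sum_mono)
          fix i assume i: "i \<in> S"
          then have wi: "0 < w' i" "w' i \<le> \<eta>" using w' by (auto simp: S_def)
          have "(ker d e' i j / w' j)\<^sup>2 = (ker d e' j i)\<^sup>2 / (w' j)\<^sup>2" by (simp add: power_divide ker_commute[of d e' i j])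
          also have "\<dots> = w' i / (w' j)\<^sup>2 * ((ker d e' j i)\<^sup>2 / w' i)" using wi by simp
          also have "\<dots> \<le> \<eta> / (w' j)\<^sup>2 * ((ker d e' j i)\<^sup>2 / w' i)"
            using wi by (intro mult_right_mono divide_right_mono) auto
          finally show "(ker d e' i j / w' j)\<^sup>2 \<le> \<eta> / (w' j)\<^sup>2 * ((ker d e' j i)\<^sup>2 / w' i)" .
        qed
        also have "\<dots> = \<eta> / (w' j)\<^sup>2 * (\<Sum>i\<in>S. (ker d e' j i)\<^sup>2 / w' i)" by (simp add: sum_distrib_left)
        also have "\<dots> \<le> \<eta> / (w' j)\<^sup>2 * (\<Sum>i\<in>M. (ker d e' j i)\<^sup>2 / w' i)"
          using \<eta>0 w' SM finM by (intro mult_left_mono sum_mono2) (auto simp: less_imp_le)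
        also have "(\<Sum>i\<in>M. (ker d e' j i)\<^sup>2 / w' i) = ker d e' j j"
          by (rule ker_sq_sum[OF finM w' lewis_onb[OF finM L'] j])
        also have "\<eta> / (w' j)\<^sup>2 * ker d e' j j \<le> \<eta> / (w' j)\<^sup>2 * (2 * (w' j)\<^sup>2)"
          using \<eta>0 by (intro mult_left_mono lewis_ker_le[OF finM L' j]) auto
        also have "\<dots> = 2 * \<eta>" using w'[OF j] by simp
        finally have "\<mu>\<^sup>2 * \<delta> ^ 3 / 32 * (\<Sum>i\<in>S. (ker d e' i j / w' j)\<^sup>2) \<le> \<mu>\<^sup>2 * \<delta> ^ 3 / 32 * (2 * \<eta>)"
          using \<delta>0 by (intro mult_left_mono) auto
        also have "\<mu>\<^sup>2 * \<delta> ^ 3 / 32 * (2 * \<eta>) = \<delta>\<^sup>2 * \<delta> ^ 3 * \<eta> / 16"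
        proof -
          have "\<mu>\<^sup>2 = \<delta>\<^sup>2" using \<mu> by (metis power2_abs)
          then show ?thesis by simp
        qed
        also have "\<dots> = 1/16" unfolding \<eta>5 ..
        finally show "\<mu>\<^sup>2 * \<delta> ^ 3 / 32 * (\<Sum>i\<in>S. (ker d e' i j / w' j)\<^sup>2) \<le> 1" by linarith
      qed
      also have "exp 1 \<le> (3::real)" by (rule exp_le)
      finally show ?thesis .
    qed
    have m1: "expectX N Q (\<lambda>X. exp (\<delta> * v j X)) \<le> 3" and m2: "expectX N Q (\<lambda>X. exp ((- \<delta>) * v j X)) \<le> 3" if "j \<in> M" for j
      using mgf[OF that, of \<delta>] mgf[OF that, of "- \<delta>"] \<delta>0 by simp_all
    have "expectX N Q W2 = (\<Lambda> + exp (- \<Lambda>) * (\<Sum>j\<in>M. expectX N Q (\<lambda>X. exp (\<delta> * v j X)) + expectX N Q (\<lambda>X. exp ((- \<delta>) * v j X)))) / \<delta>"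
    proof -
      have "expectX N Q W2 = expectX N Q (\<lambda>X. (1 / \<delta>) * (\<Lambda> + exp (- \<Lambda>) * (\<Sum>j\<in>M. exp (\<delta> * v j X) + exp ((- \<delta>) * v j X))))"
        by (simp add: W2_def)
      then show ?thesis unfolding expect_cmult expect_add expect_sum expect_const[OF FX] by simp
    qed
    also have "\<dots> \<le> (\<Lambda> + exp (- \<Lambda>) * (\<Sum>j\<in>M. 3 + 3)) / \<delta>"
      using \<delta>0 by (intro divide_right_mono add_left_mono mult_left_mono sum_mono add_mono m1 m2) auto
    also have "\<dots> = (\<Lambda> + 3 * (2 * real (card M) / (2 * real (card M) + 1))) / \<delta>"
      by (simp add: \<Lambda>_def exp_minus field_simps)
    also have "\<dots> \<le> (\<Lambda> + 3 * 1) / \<delta>" using \<delta>0 by (intro divide_right_mono add_left_mono mult_left_mono) auto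
    also have "\<dots> \<le> 1"
    proof -
      have "real (card M) \<le> 2 * real d / \<theta>"
        using \<theta>0 by (intro lewis_card_ge[OF fin L]) (auto simp: M \<theta>_def)
      also have "\<dots> = 2 * \<delta> ^ 66" using \<delta>0 by (simp add: d \<theta>_def flip: power_add)
      finally have "\<Lambda> \<le> ln (4 * \<delta> ^ 66 + 1)" unfolding \<Lambda>_def by (intro ln_mono) auto
      then show ?thesis using big \<delta>0 by simp
    qed
    finally show ?thesis .
  qed
  have EW: "expectX N Q (\<lambda>X. sqrt 2 * sqrt (G X) + W2 X) \<le> 2"
  proof -
    have "expectX N Q (\<lambda>X. sqrt (G X)) \<le> (expectX N Q G / 1 + 1) / 2"
      by (intro expect_sqrt_le[OF FX]) (auto simp: G_def intro!: sum_nonneg)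
    also have "\<dots> \<le> 9/16" using EG by simp
    finally have "sqrt 2 * expectX N Q (\<lambda>X. sqrt (G X)) \<le> 1.5 * (9/16)"
    proof (intro mult_mono)
      show "sqrt 2 \<le> 1.5" by (intro real_le_lsqrt) (auto simp: power2_eq_square)
    qed (auto intro!: expect_nonneg[OF FX] sum_nonneg simp: G_def)
    then show ?thesis using EW2 by (simp add: expect_add expect_cmult)
  qed
  have s0: "0 < g * \<kappa> / 256" using g0 \<kappa> by simp
  have dev: "expectX N Q (\<lambda>X. of_bool (\<exists>y\<in>Y. g * \<kappa> / 256 \<le> (\<Sum>b<r. expectX N Q (\<lambda>X'. \<Psi> b X' y) - \<Psi> b X y))) \<le> 2 * 2 / (g * \<kappa> / 256)"
    unfolding \<Psi>_def
  proof (rule uniform_deviation[where f=f and nk=nk and h=h and Y=Y and W="\<lambda>X. sqrt 2 * sqrt (G X) + W2 X", OF N(1) finite_lessThan N(2) _ _ _ _ _ _ EW s0])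
    show "h i \<in> {..<r}" if "i \<in> N" for i using h[OF that] by simp
    show "f i (- x) = - f i x" for i x by (simp add: f_def)
    show "nk b X = 0 \<or> nk b X = 1" for b X unfolding nk_def of_bool_def by presburger
    show "nk b X = nk b X'" if "\<And>i. i \<in> N \<Longrightarrow> h i = b \<Longrightarrow> X i = X' i" for b X X'
    proof -
      have "X i = X' i" if "i \<in> {i \<in> I. h i = b}" for i using that \<open>\<And>i. i \<in> N \<Longrightarrow> h i = b \<Longrightarrow> X i = X' i\<close> N by auto
      then show ?thesis by (simp add: nk_def)
    qed
    show "(\<lambda>_. 0) \<in> Y" by (simp add: Y_def range_mat_vec_zero)
    show "(\<Sum>i\<in>I. f i (X i) * y i) \<le> sqrt 2 * sqrt (G X) + W2 X" if "y \<in> Y" for y X by (rule W[OF that])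
  qed
  have "expectX N Q (\<lambda>X. of_bool (\<exists>y\<in>range (mat_vec d A). (\<Sum>i\<in>I. \<bar>y i\<bar>) \<le> 1 \<and>
       \<kappa> \<le> (\<Sum>i | i \<in> M \<and> w' i < 1 / \<delta> ^ 5. \<bar>y i\<bar>) \<and>
       (\<Sum>b<r. \<bar>\<Sum>i | i \<in> I \<and> h i = b. X i * y i\<bar>) \<le> (log 2 \<delta> - 1) * \<kappa> / 256))
     \<le> expectX N Q (\<lambda>X. of_bool (\<exists>y\<in>Y. g * \<kappa> / 256 \<le> (\<Sum>b<r. expectX N Q (\<lambda>X'. \<Psi> b X' y) - \<Psi> b X y)))"
  proof (intro expect_mono[OF FX])
    fix X
    have "\<exists>y\<in>Y. g * \<kappa> / 256 \<le> (\<Sum>b<r. expectX N Q (\<lambda>X'. \<Psi> b X' y) - \<Psi> b X y)"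
      if "y \<in> range (mat_vec d A)" "(\<Sum>i\<in>I. \<bar>y i\<bar>) \<le> 1" and k: "\<kappa> \<le> (\<Sum>i | i \<in> M \<and> w' i < 1 / \<delta> ^ 5. \<bar>y i\<bar>)"
        and low: "(\<Sum>b<r. \<bar>\<Sum>i | i \<in> I \<and> h i = b. X i * y i\<bar>) \<le> (log 2 \<delta> - 1) * \<kappa> / 256" for y
    proof
      show "y \<in> Y" using that by (auto simp: Y_def)
      have "g / 128 * \<kappa> \<le> g / 128 * (\<Sum>i\<in>S. \<bar>y i\<bar>)" using k g0 by (intro mult_left_mono) (auto simp: S_def \<eta>_def)
      also have "(\<Sum>i\<in>S. \<bar>y i\<bar>) = (\<Sum>b<r. \<Sum>i | i \<in> S \<and> h i = b. \<bar>y i\<bar>)"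
        using SM MI N h by (intro sum_buckets[symmetric] finS) auto
      also have "g / 128 * \<dots> = (\<Sum>b<r. g / 128 * (\<Sum>i | i \<in> S \<and> h i = b. \<bar>y i\<bar>))"
        by (rule sum_distrib_left)
      also have "\<dots> \<le> (\<Sum>b<r. expectX N Q (\<lambda>X. \<Psi> b X y))"
        by (intro sum_mono mean) auto
      finally have "g / 128 * \<kappa> \<le> (\<Sum>b<r. expectX N Q (\<lambda>X. \<Psi> b X y))" .
      moreover have "(\<Sum>b<r. \<Psi> b X y) \<le> (\<Sum>b<r. \<bar>\<Sum>i | i \<in> I \<and> h i = b. X i * y i\<bar>)" by (intro sum_mono \<Psi>le)
      ultimately show "g * \<kappa> / 256 \<le> (\<Sum>b<r. expectX N Q (\<lambda>X'. \<Psi> b X' y) - \<Psi> b X y)"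
        using low unfolding sum_subtractf g_def[symmetric] by linarith
    qed
    then show "of_bool (\<exists>y\<in>range (mat_vec d A). (\<Sum>i\<in>I. \<bar>y i\<bar>) \<le> 1 \<and>
       \<kappa> \<le> (\<Sum>i | i \<in> M \<and> w' i < 1 / \<delta> ^ 5. \<bar>y i\<bar>) \<and>
       (\<Sum>b<r. \<bar>\<Sum>i | i \<in> I \<and> h i = b. X i * y i\<bar>) \<le> (log 2 \<delta> - 1) * \<kappa> / 256)
      \<le> (of_bool (\<exists>y\<in>Y. g * \<kappa> / 256 \<le> (\<Sum>b<r. expectX N Q (\<lambda>X'. \<Psi> b X' y) - \<Psi> b X y)) :: real)"
      by (auto simp: of_bool_def)
  qed
  also note dev
  finally show ?thesis by (simp add: g_def)
qed

section \<open>Rows of small weight\<close>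

lemma expect_sq_le: "fin_prob S p \<Longrightarrow> (expect S p f)\<^sup>2 \<le> expect S p (\<lambda>a. (f a)\<^sup>2)"
proof -
  assume F: "fin_prob S p"
  define m where "m = expect S p f"
  have "0 \<le> expect S p (\<lambda>a. (f a - m)\<^sup>2)" by (intro expect_nonneg[OF F]) auto
  also have "\<dots> = expect S p (\<lambda>a. (f a)\<^sup>2 - 2 * m * f a + m\<^sup>2)" by (simp add: power2_diff algebra_simps)
  also have "\<dots> = expect S p (\<lambda>a. (f a)\<^sup>2) - m\<^sup>2"
    unfolding expect_add expect_diff expect_cmult expect_const[OF F] by (simp add: m_def power2_eq_square)
  finally show ?thesis by (simp add: m_def)
qed

text \<open>Expose the coordinates one at a time, as for McDiarmid's inequality, but let the
  difference bound depend on the value of the coordinate. The exponent then contains second moments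
  of \<open>D\<close>; with suprema instead, it could grow with the number of rows.\<close>

lemma mgf_bounded_difference:
  fixes F :: "('i \<Rightarrow> 'a) \<Rightarrow> real"
  assumes N: "finite N" and S: "fin_prob S p"
    and D: "\<And>i a. i \<in> N \<Longrightarrow> a \<in> S \<Longrightarrow> 0 \<le> D i a \<and> D i a \<le> 1/2"
    and diff: "\<And>i a a' g. i \<in> N \<Longrightarrow> a \<in> S \<Longrightarrow> a' \<in> S \<Longrightarrow> F (g(i := a)) - F (g(i := a')) \<le> D i a + D i a'"
  shows "expect (PiE N (\<lambda>_. S)) (wprod N p) (\<lambda>g. exp (expect (PiE N (\<lambda>_. S)) (wprod N p) F - F g)) \<le> exp (4 * (\<Sum>i\<in>N. expect S p (\<lambda>a. (D i a)\<^sup>2)))"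
  using N D diff
proof (induction N arbitrary: F rule: finite_induct)
  case empty
  then show ?case by (simp add: expect_def wprod_def)
next
  case (insert i N)
  let ?E = "expect (PiE N (\<lambda>_. S)) (wprod N p)"
  note FN = fin_prob_PiE[OF insert(1) S]
  define G where "G = (\<lambda>a. ?E (\<lambda>g. F (g(i := a))))"
  define e where "e = expect S p G"
  define m where "m = expect S p (D i)"
  have IH: "?E (\<lambda>g. exp (G a - F (g(i := a)))) \<le> exp (4 * (\<Sum>j\<in>N. expect S p (\<lambda>a. (D j a)\<^sup>2)))" if a: "a \<in> S" for a
    unfolding G_def
  proof (rule insert.IH)
    show "0 \<le> D j b \<and> D j b \<le> 1/2" if "j \<in> N" "b \<in> S" for j b using insert.prems(1) that by auto
    show "F ((g(j := b))(i := a)) - F ((g(j := b'))(i := a)) \<le> D j b + D j b'" if "j \<in> N" "b \<in> S" "b' \<in> S" for j b b' g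
    proof -
      have "j \<noteq> i" using that insert(2) by auto
      then have eq: "(g(j := c))(i := a) = (g(i := a))(j := c)" for c by (rule fun_upd_twist)
      show ?thesis unfolding eq by (rule insert.prems(2)) (use that in blast)+
    qed
  qed
  have Gd: "G a - G a' \<le> D i a + D i a'" if "a \<in> S" "a' \<in> S" for a a'
  proof -
    have "G a - G a' = ?E (\<lambda>g. F (g(i := a)) - F (g(i := a')))" by (simp add: G_def expect_diff)
    also have "\<dots> \<le> D i a + D i a'" 
    proof (rule expect_le_const[OF FN])
      show "F (g(i := a)) - F (g(i := a')) \<le> D i a + D i a'" for g
        by (rule insert.prems(2)) (use that in blast)+
    qed
    finally show ?thesis .
  qed
  have D': "0 \<le> D i a" "D i a \<le> 1/2" if "a \<in> S" for a using insert.prems(1)[of i a] that by auto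
  have m: "0 \<le> m" "m \<le> 1/2" unfolding m_def by (rule expect_nonneg[OF S D'(1)] expect_le_const[OF S D'(2)], assumption)+
  have u: "\<bar>e - G a\<bar> \<le> D i a + m" if a: "a \<in> S" for a
  proof -
    have "e - G a = expect S p (\<lambda>a'. G a' - G a)" by (simp add: e_def expect_diff expect_const[OF S])
    also have "\<dots> \<le> expect S p (\<lambda>a'. D i a' + D i a)" using Gd a by (intro expect_mono[OF S]) auto
    also have "\<dots> = D i a + m" by (simp add: expect_add expect_const[OF S] m_def)
    finally have 1: "e - G a \<le> D i a + m" .
    have "G a - e = expect S p (\<lambda>a'. G a - G a')" by (simp add: e_def expect_diff expect_const[OF S])
    also have "\<dots> \<le> expect S p (\<lambda>a'. D i a + D i a')" using Gd a by (intro expect_mono[OF S]) auto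
    also have "\<dots> = D i a + m" by (simp add: expect_add expect_const[OF S] m_def)
    finally show ?thesis using 1 by linarith
  qed
  \<comment> \<open>The linear term has mean 0. The square of the mean \<open>m\<close> is at most
    the second moment of \<open>D i\<close>, which turns the factor 2 into 4.\<close>
  have "expect S p (\<lambda>a. exp (e - G a)) \<le> expect S p (\<lambda>a. 1 + (e - G a) + 2 * ((D i a)\<^sup>2 + m\<^sup>2))"
  proof (intro expect_mono[OF S])
    fix a assume a: "a \<in> S"
    have "\<bar>e - G a\<bar> \<le> 1" using u[OF a] m insert.prems(1)[of i a] a by auto
    then have "exp (e - G a) \<le> 1 + (e - G a) + (e - G a)\<^sup>2" by (rule exp_le_quadratic)
    moreover have "(e - G a)\<^sup>2 \<le> (D i a + m)\<^sup>2" using u[OF a] by (metis abs_ge_zero power2_abs power_mono)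
    moreover have "(D i a + m)\<^sup>2 \<le> 2 * ((D i a)\<^sup>2 + m\<^sup>2)"
      using zero_le_power2[of "D i a - m"] by (simp add: power2_sum power2_diff)
    ultimately show "exp (e - G a) \<le> 1 + (e - G a) + 2 * ((D i a)\<^sup>2 + m\<^sup>2)" by linarith
  qed
  also have "\<dots> = 1 + 2 * (expect S p (\<lambda>a. (D i a)\<^sup>2) + m\<^sup>2)"
    unfolding expect_add expect_cmult expect_diff expect_const[OF S] by (simp add: e_def)
  also have "\<dots> \<le> 1 + 4 * expect S p (\<lambda>a. (D i a)\<^sup>2)" using expect_sq_le[OF S, of "D i"] by (simp add: m_def)
  also have "\<dots> \<le> exp (4 * expect S p (\<lambda>a. (D i a)\<^sup>2))" by (rule exp_ge_add_one_self)
  finally have step: "expect S p (\<lambda>a. exp (e - G a)) \<le> exp (4 * expect S p (\<lambda>a. (D i a)\<^sup>2))" .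
  have "expect S p (\<lambda>a. ?E (\<lambda>g. exp (e - F (g(i := a))))) = expect S p (\<lambda>a. exp (e - G a) * ?E (\<lambda>g. exp (G a - F (g(i := a)))))"
    unfolding expect_cmult[symmetric] by (simp add: exp_add[symmetric])
  also have "\<dots> \<le> expect S p (\<lambda>a. exp (e - G a) * exp (4 * (\<Sum>j\<in>N. expect S p (\<lambda>a. (D j a)\<^sup>2))))"
    by (intro expect_mono[OF S] mult_left_mono IH) auto
  also have "\<dots> \<le> exp (4 * expect S p (\<lambda>a. (D i a)\<^sup>2)) * exp (4 * (\<Sum>j\<in>N. expect S p (\<lambda>a. (D j a)\<^sup>2)))"
    unfolding expect_multc by (intro mult_right_mono step) auto
  also have "\<dots> = exp (4 * (\<Sum>j\<in>insert i N. expect S p (\<lambda>a. (D j a)\<^sup>2)))"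
    using insert(1,2) by (simp add: exp_add[symmetric] algebra_simps)
  finally show ?case
    unfolding expect_PiE_insert[OF insert(1,2)] e_def G_def .
qed

section \<open>Bucket and entry of a row as one random coordinate\<close>

abbreviation pairs :: "nat \<Rightarrow> nat \<Rightarrow> (nat \<times> real) set" where
  "pairs r Q \<equiv> {..<r} \<times> dyadic Q"

abbreviation pair_wt :: "nat \<Rightarrow> nat \<Rightarrow> nat \<times> real \<Rightarrow> real" where
  "pair_wt r Q \<equiv> (\<lambda>(b, x). 1 / real r * dyadic_wt Q x)"

abbreviation expectT :: "nat set \<Rightarrow> nat \<Rightarrow> nat \<Rightarrow> ((nat \<Rightarrow> nat \<times> real) \<Rightarrow> real) \<Rightarrow> real" where
  "expectT N r Q \<equiv> expect (PiE N (\<lambda>_. pairs r Q)) (wprod N (pair_wt r Q))"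

lemma fin_prob_buckets: "0 < r \<Longrightarrow> fin_prob {..<r} (\<lambda>_. 1 / real r)"
  by (simp add: fin_prob_def)

lemma fin_prob_pairs: "0 < r \<Longrightarrow> fin_prob (pairs r Q) (pair_wt r Q)"
  by (rule fin_prob_Times[OF fin_prob_buckets fin_prob_dyadic])

lemma expect_pairs: "expect (pairs r Q) (pair_wt r Q) f = (\<Sum>b<r. expect (dyadic Q) (dyadic_wt Q) (\<lambda>x. f (b, x))) / real r"
  unfolding expect_Times by (simp add: expect_def sum_divide_distrib)

lemma expect_pairs_bucket:
  assumes "b < r"
  shows "expect (pairs r Q) (pair_wt r Q) (\<lambda>a. of_bool (fst a = b) * f (snd a)) = expect (dyadic Q) (dyadic_wt Q) f / real r"
proof -
  have "(\<Sum>c<r. expect (dyadic Q) (dyadic_wt Q) (\<lambda>x. of_bool (c = b) * f x)) = (\<Sum>c<r. if c = b then expect (dyadic Q) (dyadic_wt Q) f else 0)"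
    by (intro sum.cong refl) (simp add: expect_def)
  then show ?thesis unfolding expect_pairs using assms by simp
qed

lemma expect_pairs_snd: "0 < r \<Longrightarrow> expect (pairs r Q) (pair_wt r Q) (\<lambda>a. f (snd a)) = expect (dyadic Q) (dyadic_wt Q) f"
  unfolding expect_pairs by simp

text \<open>With the cap \<theta> the values for \<open>x\<close> and \<open>- x\<close> still add
  up to \<open>\<bar>x * c\<bar>\<close>, since a capped value is at least that large. Compared with
  \<open>expect_symmetric_abs\<close> this loses a factor 2.\<close>

lemma expect_symmetric_min:
  assumes \<theta>: "\<And>x. f x \<noteq> 0 \<Longrightarrow> \<bar>x * c\<bar> \<le> \<theta>" and f: "\<And>x. 0 \<le> f x" "\<And>x. f (- x) = f x"
  shows "\<bar>c\<bar> * expect (dyadic Q) (dyadic_wt Q) (\<lambda>x. \<bar>x\<bar> * f x) / 2 \<le> expect (dyadic Q) (dyadic_wt Q) (\<lambda>x. f x * min \<bar>x * c + \<rho>\<bar> \<theta>)"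
proof -
  let ?E = "expect (dyadic Q) (dyadic_wt Q)"
  have "\<bar>c\<bar> * ?E (\<lambda>x. \<bar>x\<bar> * f x) = ?E (\<lambda>x. \<bar>c\<bar> * (\<bar>x\<bar> * f x))" by (simp add: expect_cmult)
  also have "\<dots> \<le> ?E (\<lambda>x. f x * min \<bar>x * c + \<rho>\<bar> \<theta> + f (- x) * min \<bar>- x * c + \<rho>\<bar> \<theta>)"
  proof (intro expect_mono fin_prob_dyadic)
    fix x
    show "\<bar>c\<bar> * (\<bar>x\<bar> * f x) \<le> f x * min \<bar>x * c + \<rho>\<bar> \<theta> + f (- x) * min \<bar>- x * c + \<rho>\<bar> \<theta>"
    proof (cases "f x = 0")
      case False
      have "\<bar>x * c\<bar> \<le> min \<bar>x * c + \<rho>\<bar> \<theta> + min \<bar>- (x * c) + \<rho>\<bar> \<theta>" using \<theta>[OF False] by linarith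
      then have "f x * \<bar>x * c\<bar> \<le> f x * (min \<bar>x * c + \<rho>\<bar> \<theta> + min \<bar>- (x * c) + \<rho>\<bar> \<theta>)" by (intro mult_left_mono f)
      then show ?thesis by (simp add: f(2) abs_mult algebra_simps)
    qed (simp add: f(2))
  qed
  also have "\<dots> = 2 * ?E (\<lambda>x. f x * min \<bar>x * c + \<rho>\<bar> \<theta>)"
    unfolding expect_add by (simp only: expect_dyadic_uminus[where f="\<lambda>x. f x * min \<bar>x * c + \<rho>\<bar> \<theta>"])
  finally show ?thesis by simp
qed

text \<open>The cap limits the influence of a single row to \<theta>, although its entry is
  heavy-tailed. The sum without the cap has no comparable concentration.\<close>

definition bucket_min :: "nat set \<Rightarrow> nat \<Rightarrow> real \<Rightarrow> (nat \<Rightarrow> real) \<Rightarrow> (nat \<Rightarrow> nat \<times> real) \<Rightarrow> real" where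
  "bucket_min I r \<theta> y g = (\<Sum>b<r. min \<bar>\<Sum>i | i \<in> I \<and> fst (g i) = b. snd (g i) * y i\<bar> \<theta>)"

text \<open>Compare both configurations with the one in which row \<open>i\<close> is deleted. Only
  one bucket changes then, by at most the new entry and by at most the cap.\<close>

lemma bucket_min_diff:
  assumes I: "finite I" "i \<in> I" and \<theta>: "0 \<le> \<theta>"
  shows "bucket_min I r \<theta> y (g(i := a)) - bucket_min I r \<theta> y (g(i := a')) \<le> min (\<bar>snd a\<bar> * \<bar>y i\<bar>) \<theta> + min (\<bar>snd a'\<bar> * \<bar>y i\<bar>) \<theta>"
proof -
  define R where "R = (\<lambda>b. \<Sum>j | j \<in> I - {i} \<and> fst (g j) = b. snd (g j) * y j)"
  define V where "V = (\<Sum>b<r. min \<bar>R b\<bar> \<theta>)"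
  have "\<bar>bucket_min I r \<theta> y (g(i := a)) - V\<bar> \<le> min (\<bar>snd a\<bar> * \<bar>y i\<bar>) \<theta>" for a
  proof -
    have s: "(\<Sum>j | j \<in> I \<and> fst ((g(i := a)) j) = b. snd ((g(i := a)) j) * y j) = R b + (if fst a = b then snd a * y i else 0)" for b
    proof (cases "fst a = b")
      case True
      have "{j \<in> I. fst ((g(i := a)) j) = b} = insert i {j \<in> I - {i}. fst (g j) = b}" using True I by auto
      then have "(\<Sum>j | j \<in> I \<and> fst ((g(i := a)) j) = b. snd ((g(i := a)) j) * y j) = snd a * y i + (\<Sum>j\<in>{j \<in> I - {i}. fst (g j) = b}. snd ((g(i := a)) j) * y j)"
        using I by simp
      also have "(\<Sum>j\<in>{j \<in> I - {i}. fst (g j) = b}. snd ((g(i := a)) j) * y j) = R b"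
        unfolding R_def by (intro sum.cong) auto
      finally show ?thesis using True by simp
    next
      case False
      have "{j \<in> I. fst ((g(i := a)) j) = b} = {j \<in> I - {i}. fst (g j) = b}" using False by auto
      then show ?thesis using False unfolding R_def by (auto intro!: sum.cong)
    qed
    have "\<bar>bucket_min I r \<theta> y (g(i := a)) - V\<bar> = \<bar>\<Sum>b<r. min \<bar>R b + (if fst a = b then snd a * y i else 0)\<bar> \<theta> - min \<bar>R b\<bar> \<theta>\<bar>"
      unfolding bucket_min_def s V_def sum_subtractf ..
    also have "\<dots> \<le> (\<Sum>b<r. \<bar>min \<bar>R b + (if fst a = b then snd a * y i else 0)\<bar> \<theta> - min \<bar>R b\<bar> \<theta>\<bar>)" by (rule sum_abs)
    also have "\<dots> \<le> (\<Sum>b<r. if fst a = b then min (\<bar>snd a\<bar> * \<bar>y i\<bar>) \<theta> else 0)"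
    proof (intro sum_mono)
      fix b
      have "\<bar>min \<bar>R b + v\<bar> \<theta> - min \<bar>R b\<bar> \<theta>\<bar> \<le> min \<bar>v\<bar> \<theta>" for v using \<theta> by linarith
      then show "\<bar>min \<bar>R b + (if fst a = b then snd a * y i else 0)\<bar> \<theta> - min \<bar>R b\<bar> \<theta>\<bar> \<le> (if fst a = b then min (\<bar>snd a\<bar> * \<bar>y i\<bar>) \<theta> else 0)"
        by (auto simp: abs_mult[symmetric])
    qed
    also have "\<dots> \<le> min (\<bar>snd a\<bar> * \<bar>y i\<bar>) \<theta>" using \<theta> by simp
    finally show ?thesis .
  qed
  from this[of a] this[of a'] show ?thesis by linarith
qed

text \<open>The isolation argument of \<open>mean_bucket\<close>, now with random buckets: a row
  meets a given bucket with probability \<open>1 / r\<close>, and its scale is measured by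
  \<open>\<bar>x * y i\<bar>\<close> between \<theta>1 and \<theta>. The condition on
  \<open>real r * \<theta>1\<close> makes the expected number of competing rows at most 1/2.\<close>

lemma bucket_min_mean:
  assumes N: "finite N" "I \<subseteq> N" and S: "S \<subseteq> I" and \<theta>: "0 < \<theta>1" "\<theta>1 \<le> \<theta>"
    and y: "\<And>i. i \<in> S \<Longrightarrow> \<theta> / 2 ^ Q \<le> \<bar>y i\<bar> \<and> \<bar>y i\<bar> \<le> \<theta>1"
    and y2: "(\<Sum>i\<in>I. \<bar>y i\<bar>) \<le> 2" and r: "1/8 \<le> real r * \<theta>1" and g0: "0 \<le> log 2 (\<theta> / \<theta>1) - 1"
  shows "(log 2 (\<theta> / \<theta>1) - 1) / 256 * (\<Sum>i\<in>S. \<bar>y i\<bar>) \<le> expectT N r Q (bucket_min I r \<theta> y)"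
proof -
  define G where "G = log 2 (\<theta> / \<theta>1) - 1"
  have r0: "0 < r" using r \<theta> by (cases r) auto
  note FP = fin_prob_pairs[OF r0, of Q]
  note FT = fin_prob_PiE[OF N(1) FP]
  have fI: "finite I" using N finite_subset by blast
  have fS: "finite S" using S fI finite_subset by blast
  let ?EX = "expect (dyadic Q) (dyadic_wt Q)" and ?EP = "expect (pairs r Q) (pair_wt r Q)"
  have one: "G / (256 * real r) * (\<Sum>i\<in>S. \<bar>y i\<bar>) \<le> expectT N r Q (\<lambda>g. min \<bar>\<Sum>i | i \<in> I \<and> fst (g i) = b. snd (g i) * y i\<bar> \<theta>)"
    if b: "b < r" for b
  proof -
    define Z where "Z = (\<lambda>g::nat\<Rightarrow>nat\<times>real. min \<bar>\<Sum>i | i \<in> I \<and> fst (g i) = b. snd (g i) * y i\<bar> \<theta>)"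
    define hit where "hit = (\<lambda>i a. fst a = b \<and> \<theta>1 \<le> \<bar>snd a\<bar> * \<bar>y i\<bar>)"
    define Oth where "Oth = (\<lambda>i g. \<forall>j\<in>S-{i}. \<not> hit j (g j))"
    define f where "f = (\<lambda>i x. of_bool (\<theta>1 / \<bar>y i\<bar> \<le> \<bar>x\<bar> \<and> \<bar>x\<bar> \<le> \<theta> / \<bar>y i\<bar>) :: real)"
    define a where "a = (\<lambda>i c. of_bool (fst c = b) * f i (snd c) :: real)"
    have ypos: "0 < \<bar>y i\<bar>" if "i \<in> S" for i
    proof -
      have "0 < \<theta> / 2 ^ Q" using \<theta> by simp
      then show ?thesis using y[OF that] by linarith
    qed
    have ahit: "hit i c" if "i \<in> S" "a i c \<noteq> 0" for i c
      using that ypos[OF that(1)] by (auto simp: a_def f_def hit_def field_simps split: if_splits)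
    have a1: "0 \<le> a i c" "a i c \<le> 1" for i c by (auto simp: a_def f_def)
    have Z0: "0 \<le> Z g" for g using \<theta> by (simp add: Z_def)
    have pair_wt: "(\<Sum>i\<in>S. of_bool (Oth i g) * (a i (g i) * Z g)) \<le> Z g" for g
    proof (cases "\<exists>i\<in>S. Oth i g \<and> a i (g i) \<noteq> 0")
      case True
      then obtain i where i: "i \<in> S" "Oth i g" "a i (g i) \<noteq> 0" by auto
      have "(\<Sum>j\<in>S. of_bool (Oth j g) * (a j (g j) * Z g)) = (\<Sum>j\<in>S. if j = i then of_bool (Oth j g) * (a j (g j) * Z g) else 0)"
      proof (intro sum.cong refl)
        fix j assume j: "j \<in> S"
        have "a j (g j) = 0" if "j \<noteq> i" using ahit[OF j, of "g j"] i(2) j that by (auto simp: Oth_def)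
        then show "of_bool (Oth j g) * (a j (g j) * Z g) = (if j = i then of_bool (Oth j g) * (a j (g j) * Z g) else 0)" by auto
      qed
      also have "\<dots> = a i (g i) * Z g" using i fS by simp
      also have "\<dots> \<le> 1 * Z g" using a1 Z0 by (intro mult_right_mono) auto
      finally show ?thesis by simp
    next
      case False
      then have "(\<Sum>i\<in>S. of_bool (Oth i g) * (a i (g i) * Z g)) = 0" by (intro sum.neutral) auto
      then show ?thesis using Z0 by simp
    qed
    have low: "\<bar>y i\<bar> * (G / (128 * real r)) * (1/2) \<le> expectT N r Q (\<lambda>g. of_bool (Oth i g) * (a i (g i) * Z g))" if i: "i \<in> S" for i
    proof -
      have iI: "i \<in> I" and iN: "i \<in> N" using i S N by auto
      have upd: "Oth i (g(i := c)) = Oth i g" for g c by (auto simp: Oth_def)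
      have inner: "\<bar>y i\<bar> * (G / (128 * real r)) \<le> ?EP (\<lambda>c. a i c * Z (g(i := c)))" for g
      proof -
        define \<rho> where "\<rho> = (\<Sum>j | j \<in> I - {i} \<and> fst (g j) = b. snd (g j) * y j)"
        have Zu: "a i c * Z (g(i := c)) = of_bool (fst c = b) * (f i (snd c) * min \<bar>snd c * y i + \<rho>\<bar> \<theta>)" for c
        proof (cases "fst c = b")
          case True
          have "{j \<in> I. fst ((g(i := c)) j) = b} = insert i {j \<in> I - {i}. fst (g j) = b}" using True iI by auto
          then have "(\<Sum>j | j \<in> I \<and> fst ((g(i := c)) j) = b. snd ((g(i := c)) j) * y j) = snd c * y i + (\<Sum>j\<in>{j \<in> I - {i}. fst (g j) = b}. snd ((g(i := c)) j) * y j)"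
            using fI by simp
          also have "(\<Sum>j\<in>{j \<in> I - {i}. fst (g j) = b}. snd ((g(i := c)) j) * y j) = \<rho>"
            unfolding \<rho>_def by (intro sum.cong) auto
          finally show ?thesis using True unfolding Z_def a_def by simp
        qed (simp add: a_def)
        have "G / 64 \<le> ?EX (\<lambda>x. \<bar>x\<bar> * f i x)"
        proof -
          have eq: "\<theta> / \<bar>y i\<bar> / (\<theta>1 / \<bar>y i\<bar>) = \<theta> / \<theta>1" using ypos[OF i] by simp
          have "(log 2 (\<theta> / \<bar>y i\<bar> / (\<theta>1 / \<bar>y i\<bar>)) - 1) / 64 \<le> ?EX (\<lambda>x. \<bar>x\<bar> * f i x)"
            unfolding f_def using y[OF i] ypos[OF i] \<theta>
            by (intro dyadic_truncated_abs_lower divide_right_mono) (auto simp: field_simps)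
          then show ?thesis unfolding eq G_def .
        qed
        then have "\<bar>y i\<bar> * (G / 64) / 2 \<le> \<bar>y i\<bar> * ?EX (\<lambda>x. \<bar>x\<bar> * f i x) / 2" by (intro divide_right_mono mult_left_mono) auto
        also have "\<dots> \<le> ?EX (\<lambda>x. f i x * min \<bar>x * y i + \<rho>\<bar> \<theta>)"
          using ypos[OF i] by (intro expect_symmetric_min) (auto simp: f_def abs_mult field_simps split: if_splits)
        finally have "\<bar>y i\<bar> * (G / 64) / 2 / real r \<le> ?EX (\<lambda>x. f i x * min \<bar>x * y i + \<rho>\<bar> \<theta>) / real r"
          by (intro divide_right_mono) auto
        moreover have "?EP (\<lambda>c. of_bool (fst c = b) * (f i (snd c) * min \<bar>snd c * y i + \<rho>\<bar> \<theta>)) = ?EX (\<lambda>x. f i x * min \<bar>x * y i + \<rho>\<bar> \<theta>) / real r"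
          by (rule expect_pairs_bucket[OF b])
        ultimately have "\<bar>y i\<bar> * (G / 64) / 2 / real r \<le> ?EP (\<lambda>c. a i c * Z (g(i := c)))"
          unfolding Zu by (simp only:)
        moreover have "\<bar>y i\<bar> * (G / (128 * real r)) = \<bar>y i\<bar> * (G / 64) / 2 / real r" by simp
        ultimately show ?thesis by (simp only:)
      qed
      have "1 - 1/2 \<le> expectT N r Q (\<lambda>g. of_bool (Oth i g))"
      proof -
        have "expectT N r Q (\<lambda>g. 1 - of_bool (Oth i g)) = expectT N r Q (\<lambda>g. of_bool (\<not> Oth i g))"
          by (intro expect_cong) auto
        also have "\<dots> \<le> (\<Sum>j\<in>S. expectT N r Q (\<lambda>g. of_bool (hit j (g j))))"
          by (intro expect_union_bound[OF FT fS]) (auto simp: Oth_def)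
        also have "\<dots> \<le> (\<Sum>j\<in>S. \<bar>y j\<bar> / (32 * \<theta>1 * real r))"
        proof (intro sum_mono)
          fix j assume j: "j \<in> S"
          have "expectT N r Q (\<lambda>g. of_bool (hit j (g j))) = ?EP (\<lambda>c. of_bool (hit j c))"
            using j S N by (intro expect_coord[where f="\<lambda>c. of_bool (hit j c)"] FP) auto
          also have "\<dots> = ?EP (\<lambda>c. of_bool (fst c = b) * of_bool (\<theta>1 / \<bar>y j\<bar> \<le> \<bar>snd c\<bar>))"
            using ypos[OF j] by (intro expect_cong) (auto simp: hit_def field_simps)
          also have "\<dots> = ?EX (\<lambda>x. of_bool (\<theta>1 / \<bar>y j\<bar> \<le> \<bar>x\<bar>)) / real r" by (rule expect_pairs_bucket[OF b])
          also have "\<dots> \<le> 1 / (32 * (\<theta>1 / \<bar>y j\<bar>)) / real r"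
            using ypos[OF j] \<theta> by (intro divide_right_mono dyadic_tail) auto
          finally show "expectT N r Q (\<lambda>g. of_bool (hit j (g j))) \<le> \<bar>y j\<bar> / (32 * \<theta>1 * real r)" by simp
        qed
        also have "\<dots> = (\<Sum>j\<in>S. \<bar>y j\<bar>) / (32 * \<theta>1 * real r)" by (simp add: sum_divide_distrib)
        also have "\<dots> \<le> 2 / (32 * \<theta>1 * real r)"
          using y2 sum_mono2[OF fI S, of "\<lambda>i. \<bar>y i\<bar>"] \<theta> by (intro divide_right_mono) auto
        also have "\<dots> \<le> 1/2"
        proof -
          have "0 < real r * \<theta>1" using r by linarith
          then show ?thesis using r by (simp add: field_simps)
        qed
        finally have "expectT N r Q (\<lambda>g. 1 - of_bool (Oth i g)) \<le> 1/2" .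
        moreover have "expectT N r Q (\<lambda>g. 1 - of_bool (Oth i g)) = 1 - expectT N r Q (\<lambda>g. of_bool (Oth i g))"
          unfolding expect_diff expect_const[OF FT] ..
        ultimately show ?thesis by linarith
      qed
      then have "\<bar>y i\<bar> * (G / (128 * real r)) * (1/2) \<le> \<bar>y i\<bar> * (G / (128 * real r)) * expectT N r Q (\<lambda>g. of_bool (Oth i g))"
        using g0 by (intro mult_left_mono) (auto simp: G_def)
      also have "\<dots> = expectT N r Q (\<lambda>g. of_bool (Oth i g) * (\<bar>y i\<bar> * (G / (128 * real r))))"
        by (rule trans[OF mult.commute expect_multc[symmetric]])
      also have "\<dots> \<le> expectT N r Q (\<lambda>g. of_bool (Oth i g) * ?EP (\<lambda>c. a i c * Z (g(i := c))))"
        by (intro expect_mono[OF FT] mult_left_mono inner) auto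
      also have "\<dots> = expectT N r Q (\<lambda>g. of_bool (Oth i g) * (a i (g i) * Z g))"
        by (subst expect_resample[OF N(1) iN FP, where F="\<lambda>g. of_bool (Oth i g) * (a i (g i) * Z g)"])
           (simp add: upd expect_cmult)
      finally show ?thesis .
    qed
    have "G / (256 * real r) * (\<Sum>i\<in>S. \<bar>y i\<bar>) = (\<Sum>i\<in>S. \<bar>y i\<bar> * (G / (128 * real r)) * (1/2))"
      unfolding sum_distrib_left by (intro sum.cong refl) simp
    also have "\<dots> \<le> expectT N r Q (\<lambda>g. \<Sum>i\<in>S. of_bool (Oth i g) * (a i (g i) * Z g))"
      unfolding expect_sum by (intro sum_mono low)
    also have "\<dots> \<le> expectT N r Q Z" by (intro expect_mono[OF FT] pair_wt)
    finally show ?thesis unfolding Z_def .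
  qed
  have "G / 256 * (\<Sum>i\<in>S. \<bar>y i\<bar>) = (\<Sum>b<r. G / (256 * real r) * (\<Sum>i\<in>S. \<bar>y i\<bar>))" using r0 by simp
  also have "\<dots> \<le> (\<Sum>b<r. expectT N r Q (\<lambda>g. min \<bar>\<Sum>i | i \<in> I \<and> fst (g i) = b. snd (g i) * y i\<bar> \<theta>))"
    by (intro sum_mono one) auto
  also have "\<dots> = expectT N r Q (bucket_min I r \<theta> y)" unfolding bucket_min_def expect_sum ..
  finally show ?thesis by (simp add: G_def)
qed

text \<open>Chernoff at rate \<open>1 / (2 * \<theta>)\<close>, the scaling that brings the
  differences below 1/2. The variance costs \<open>1 / (8 * \<theta>)\<close> in the exponent, while
  falling from the mean \<open>m\<close> to \<open>m / 2\<close> gains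
  \<open>m / (4 * \<theta>)\<close>; for \<open>m \<ge> 5\<close> the balance is at most
  \<open>- (1 / \<theta>)\<close>.\<close>

lemma bucket_min_tail:
  assumes N: "finite N" "I \<subseteq> N" and S: "S \<subseteq> I" and \<theta>: "0 < \<theta>1" "\<theta>1 \<le> \<theta>"
    and y: "\<And>i. i \<in> S \<Longrightarrow> \<theta> / 2 ^ Q \<le> \<bar>y i\<bar> \<and> \<bar>y i\<bar> \<le> \<theta>1"
    and y2: "(\<Sum>i\<in>I. \<bar>y i\<bar>) \<le> 2" and r: "1/8 \<le> real r * \<theta>1" and g0: "0 \<le> log 2 (\<theta> / \<theta>1) - 1"
    and yS: "c \<le> (\<Sum>i\<in>S. \<bar>y i\<bar>)" and big: "5 \<le> (log 2 (\<theta> / \<theta>1) - 1) / 256 * c"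
  shows "expectT N r Q (\<lambda>g. of_bool (bucket_min I r \<theta> y g \<le> (log 2 (\<theta> / \<theta>1) - 1) / 512 * c)) \<le> exp (- (1 / \<theta>))"
proof -
  have r0: "0 < r" using r \<theta> by (cases r) auto
  note FP = fin_prob_pairs[OF r0, of Q]
  note FT = fin_prob_PiE[OF N(1) FP]
  have fI: "finite I" using N finite_subset by blast
  have \<theta>0: "0 < \<theta>" using \<theta> by linarith
  define m where "m = (log 2 (\<theta> / \<theta>1) - 1) / 256 * c"
  let ?F = "bucket_min I r \<theta> y"
  define EF where "EF = expectT N r Q ?F"
  have mean: "m \<le> EF"
  proof -
    have "m \<le> (log 2 (\<theta> / \<theta>1) - 1) / 256 * (\<Sum>i\<in>S. \<bar>y i\<bar>)"
      unfolding m_def using g0 by (intro mult_left_mono yS) simp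
    also have "\<dots> \<le> EF" unfolding EF_def by (rule bucket_min_mean[OF N S \<theta> _ y2 r g0]) (rule y)
    finally show ?thesis .
  qed
  define D where "D = (\<lambda>(i::nat) (a::nat \<times> real). if i \<in> I then min (\<bar>snd a\<bar> * \<bar>y i\<bar>) \<theta> / (2 * \<theta>) else 0 :: real)"
  have Ei: "expectT N r Q (\<lambda>g. ?F g / (2 * \<theta>)) = EF / (2 * \<theta>)"
    using expect_multc[of _ _ ?F "1 / (2 * \<theta>)"] by (simp add: EF_def)
  have "expectT N r Q (\<lambda>g. exp (EF / (2 * \<theta>) - ?F g / (2 * \<theta>))) \<le> exp (4 * (\<Sum>i\<in>N. expect (pairs r Q) (pair_wt r Q) (\<lambda>a. (D i a)\<^sup>2)))"
    unfolding Ei[symmetric]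
  proof (rule mgf_bounded_difference[OF N(1) FP])
    show "0 \<le> D i a \<and> D i a \<le> 1 / 2" for i a using \<theta>0 by (auto simp: D_def field_simps)
    fix i a a' g
    show "?F (g(i := a)) / (2 * \<theta>) - ?F (g(i := a')) / (2 * \<theta>) \<le> D i a + D i a'"
    proof (cases "i \<in> I")
      case True
      have "(?F (g(i := a)) - ?F (g(i := a'))) / (2 * \<theta>) \<le> (min (\<bar>snd a\<bar> * \<bar>y i\<bar>) \<theta> + min (\<bar>snd a'\<bar> * \<bar>y i\<bar>) \<theta>) / (2 * \<theta>)"
        using \<theta>0 by (intro divide_right_mono bucket_min_diff[OF fI True]) auto
      then show ?thesis using True by (simp add: D_def diff_divide_distrib add_divide_distrib)
    next
      case False
      have "?F (g(i := b)) = ?F g" for b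
        unfolding bucket_min_def using False
        by (intro sum.cong refl arg_cong2[where f=min] arg_cong[where f=abs]) (auto intro!: sum.cong)
      then show ?thesis using False by (simp add: D_def)
    qed
  qed
  also have "(\<Sum>i\<in>N. expect (pairs r Q) (pair_wt r Q) (\<lambda>a. (D i a)\<^sup>2)) \<le> (\<Sum>i\<in>N. if i \<in> I then \<bar>y i\<bar> / (64 * \<theta>) else 0)"
  proof (intro sum_mono)
    fix i
    show "expect (pairs r Q) (pair_wt r Q) (\<lambda>a. (D i a)\<^sup>2) \<le> (if i \<in> I then \<bar>y i\<bar> / (64 * \<theta>) else 0)"
    proof (cases "i \<in> I")
      case True
      have "expect (pairs r Q) (pair_wt r Q) (\<lambda>a. (D i a)\<^sup>2) = expect (pairs r Q) (pair_wt r Q) (\<lambda>a. (min (\<bar>snd a\<bar> * \<bar>y i\<bar>) \<theta>)\<^sup>2) * (1 / (4 * \<theta>\<^sup>2))"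
        unfolding expect_multc[symmetric] using True by (intro expect_cong) (simp add: D_def power_divide power_mult_distrib)
      also have "expect (pairs r Q) (pair_wt r Q) (\<lambda>a. (min (\<bar>snd a\<bar> * \<bar>y i\<bar>) \<theta>)\<^sup>2) = expect (dyadic Q) (dyadic_wt Q) (\<lambda>x. (min (\<bar>x\<bar> * \<bar>y i\<bar>) \<theta>)\<^sup>2)"
        by (rule expect_pairs_snd[OF r0])
      also have "\<dots> * (1 / (4 * \<theta>\<^sup>2)) \<le> (\<bar>y i\<bar> * \<theta> / 16) * (1 / (4 * \<theta>\<^sup>2))"
        by (intro mult_right_mono dyadic_min_square) (use \<theta>0 in auto)
      also have "\<dots> = \<bar>y i\<bar> / (64 * \<theta>)" using \<theta>0 by (simp add: power2_eq_square)
      finally show ?thesis using True by simp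
    qed (simp add: D_def expect_def)
  qed
  also have "\<dots> = (\<Sum>i\<in>I. \<bar>y i\<bar>) / (64 * \<theta>)"
    using N by (simp add: sum.If_cases Int_absorb1 sum_divide_distrib)
  also have "\<dots> \<le> 2 / (64 * \<theta>)" using y2 \<theta>0 by (intro divide_right_mono) auto
  finally have mgf: "expectT N r Q (\<lambda>g. exp (EF / (2 * \<theta>) - ?F g / (2 * \<theta>))) \<le> exp (1 / (8 * \<theta>))" by simp
  have "expectT N r Q (\<lambda>g. of_bool (?F g \<le> m / 2)) \<le> expectT N r Q (\<lambda>g. exp (EF / (2 * \<theta>) - ?F g / (2 * \<theta>))) / exp (m / (4 * \<theta>))"
  proof (rule expect_markov[OF FT])
    fix g assume "?F g \<le> m / 2"
    then have "m / 2 \<le> EF - ?F g" using mean by linarith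
    then have "m / 2 / (2 * \<theta>) \<le> (EF - ?F g) / (2 * \<theta>)" using \<theta>0 by (intro divide_right_mono) auto
    then show "exp (m / (4 * \<theta>)) \<le> exp (EF / (2 * \<theta>) - ?F g / (2 * \<theta>))" by (simp add: diff_divide_distrib)
  qed auto
  also have "\<dots> \<le> exp (1 / (8 * \<theta>)) / exp (m / (4 * \<theta>))" by (intro divide_right_mono mgf) auto
  also have "\<dots> = exp ((1/8 - m / 4) / \<theta>)" by (simp add: exp_diff[symmetric] diff_divide_distrib)
  also have "\<dots> \<le> exp ((- 1) / \<theta>)"
    using big \<theta>0 unfolding exp_le_cancel_iff by (intro divide_right_mono) (auto simp: m_def)
  finally show ?thesis by (simp add: m_def)
qed

section \<open>A net of the column space\<close>

definition net :: "nat \<Rightarrow> (nat \<Rightarrow> int) set" where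
  "net d = PiE {..<d} (\<lambda>_. {- int (2 * d ^ 4) .. int (2 * d ^ 4)})"

definition net_vec :: "nat \<Rightarrow> (nat \<Rightarrow> nat \<Rightarrow> real) \<Rightarrow> (nat \<Rightarrow> int) \<Rightarrow> nat \<Rightarrow> real" where
  "net_vec d e k i = (\<Sum>l<d. (of_int (k l) / real d ^ 4) * e l i)"

lemma finite_net: "finite (net d)"
  by (simp add: net_def finite_PiE)

lemma card_net: "real (card (net d)) = (4 * real d ^ 4 + 1) ^ d"
  by (simp add: net_def card_PiE nat_add_distrib nat_mult_distrib nat_power_eq add.commute)

lemma net_vec_range: "onb I w d A e \<Longrightarrow> net_vec d e k \<in> range (mat_vec d A)"
  unfolding net_vec_def[abs_def] onb_def by (intro range_mat_vec_sum range_mat_vec_scale) auto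

text \<open>Vectors in the l1 ball have coefficients of size at most 2. Rounding each of the
  \<open>d\<close> coefficients costs \<open>1 / d ^ 4\<close>, and the basis vectors have l1 norm
  at most \<open>2 * d\<close>.\<close>

lemma net_approx:
  assumes fin: "finite I" and L: "lewis_upto I d A 2 w e" and d: "1 \<le> d"
    and y: "y \<in> range (mat_vec d A)" and y1: "(\<Sum>i\<in>I. \<bar>y i\<bar>) \<le> 1"
  shows "\<exists>k\<in>net d. (\<Sum>i\<in>I. \<bar>y i - net_vec d e k i\<bar>) \<le> 2 / real d ^ 2"
proof -
  have d0: "0 < real d" using d by simp
  define x where "x = (\<lambda>l. wip I w (e l) y)"
  define k where "k = (\<lambda>l\<in>{..<d}. \<lfloor>x l * real d ^ 4\<rfloor>)"
  have x2: "\<bar>x l\<bar> \<le> 2" if l: "l < d" for l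
  proof -
    have "(x l)\<^sup>2 \<le> (\<Sum>l<d. (x l)\<^sup>2)" using l by (intro member_le_sum) auto
    also have "\<dots> \<le> 2 * (\<Sum>i\<in>I. \<bar>y i\<bar>)\<^sup>2" unfolding x_def by (rule lewis_coeff_sq_le[OF fin L y])
    also have "\<dots> \<le> 2 * 1\<^sup>2" using y1 by (intro mult_left_mono power_mono) (auto intro: sum_nonneg)
    finally have "(x l)\<^sup>2 \<le> 2\<^sup>2" by simp
    then show ?thesis using abs_le_square_iff[of "x l" 2] by simp
  qed
  have kn: "k \<in> net d"
    unfolding net_def
  proof (rule PiE_I)
    fix l assume "l \<in> {..<d}"
    then have l: "l < d" by simp
    have "\<bar>x l * real d ^ 4\<bar> \<le> 2 * real d ^ 4" using x2[OF l] by (simp add: abs_mult mult_right_mono)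
    then have b: "- real (2 * d ^ 4) \<le> x l * real d ^ 4" "x l * real d ^ 4 \<le> real (2 * d ^ 4)" by auto
    have "- int (2 * d ^ 4) \<le> \<lfloor>x l * real d ^ 4\<rfloor>" using b(1) by (simp add: le_floor_iff)
    moreover have "\<lfloor>x l * real d ^ 4\<rfloor> \<le> int (2 * d ^ 4)" using b(2) by (simp add: floor_le_iff)
    ultimately show "k l \<in> {- int (2 * d ^ 4)..int (2 * d ^ 4)}" using l by (simp add: k_def)
  qed (simp add: k_def)
  have close: "\<bar>x l - of_int (k l) / real d ^ 4\<bar> \<le> 1 / real d ^ 4" if l: "l < d" for l
  proof -
    have "\<bar>x l * real d ^ 4 - of_int (k l)\<bar> \<le> 1" using l by (simp add: k_def) linarith
    then have "\<bar>x l * real d ^ 4 - of_int (k l)\<bar> / real d ^ 4 \<le> 1 / real d ^ 4" by (intro divide_right_mono) auto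
    moreover have "x l - of_int (k l) / real d ^ 4 = (x l * real d ^ 4 - of_int (k l)) / real d ^ 4"
      using d0 by (simp add: field_simps)
    ultimately show ?thesis by simp
  qed
  have "(\<Sum>i\<in>I. \<bar>y i - net_vec d e k i\<bar>) \<le> (\<Sum>i\<in>I. \<Sum>l<d. 1 / real d ^ 4 * \<bar>e l i\<bar>)"
  proof (intro sum_mono)
    fix i assume i: "i \<in> I"
    have "y i - net_vec d e k i = (\<Sum>l<d. (x l - of_int (k l) / real d ^ 4) * e l i)"
      using onb_expand[OF fin lewis_pos[OF fin L] lewis_onb[OF fin L] y i]
      by (simp add: net_vec_def x_def left_diff_distrib sum_subtractf)
    then have "\<bar>y i - net_vec d e k i\<bar> \<le> (\<Sum>l<d. \<bar>(x l - of_int (k l) / real d ^ 4) * e l i\<bar>)" by (simp add: sum_abs)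
    also have "\<dots> \<le> (\<Sum>l<d. 1 / real d ^ 4 * \<bar>e l i\<bar>)"
      unfolding abs_mult by (intro sum_mono mult_right_mono close) auto
    finally show "\<bar>y i - net_vec d e k i\<bar> \<le> (\<Sum>l<d. 1 / real d ^ 4 * \<bar>e l i\<bar>)" .
  qed
  also have "\<dots> = (\<Sum>l<d. 1 / real d ^ 4 * (\<Sum>i\<in>I. \<bar>e l i\<bar>))"
    unfolding sum_distrib_left by (rule sum.swap)
  also have "\<dots> \<le> (\<Sum>l<d. 1 / real d ^ 4 * (2 * real d))"
    by (intro sum_mono mult_left_mono lewis_basis_l1_le[OF fin L]) auto
  also have "\<dots> = 2 / real d ^ 2" using d0 by (simp add: power2_eq_square power4_eq_xxxx)
  finally show ?thesis using kn by blast
qed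

text \<open>The bounds 2 and \<open>\<kappa> / 2\<close> leave room for the rounding error relative
  to 1 and \<kappa>. The final \<open>\<kappa> / 4\<close> is the mass that remains after very small
  coordinates are discarded.\<close>

definition net_bad :: "nat set \<Rightarrow> nat set \<Rightarrow> nat \<Rightarrow> (nat \<Rightarrow> nat \<Rightarrow> real) \<Rightarrow> nat \<Rightarrow> real \<Rightarrow> real \<Rightarrow> (nat \<Rightarrow> nat \<times> real) \<Rightarrow> (nat \<Rightarrow> int) \<Rightarrow> bool" where
  "net_bad I J d e r \<delta> \<kappa> g k \<longleftrightarrow> (\<Sum>i\<in>I. \<bar>net_vec d e k i\<bar>) \<le> 2 \<and> \<kappa> / 2 \<le> (\<Sum>i\<in>J. \<bar>net_vec d e k i\<bar>) \<and>
     bucket_min I r (1 / \<delta> ^ 33) (net_vec d e k) g \<le> (log 2 (\<delta> / 4) - 1) / 512 * (\<kappa> / 4)"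

lemma net_event:
  assumes N: "finite N" "I \<subseteq> N" and L: "lewis_upto I d A 2 w e"
    and J: "J \<subseteq> I" "\<And>i. i \<in> J \<Longrightarrow> w i \<le> 1 / \<delta> ^ 34" and \<delta>: "8 \<le> \<delta>" and r: "\<delta> ^ 64 \<le> real r"
    and Q: "real (card I) * (1 / \<delta> ^ 33 / 2 ^ Q) \<le> \<kappa> / 4" and big: "5 \<le> (log 2 (\<delta> / 4) - 1) / 256 * (\<kappa> / 4)"
  shows "expectT N r Q (\<lambda>g. of_bool (\<exists>k\<in>net d. net_bad I J d e r \<delta> \<kappa> g k)) \<le> (4 * real d ^ 4 + 1) ^ d * exp (- (\<delta> ^ 33))"
proof -
  have \<delta>0: "0 < \<delta>" using \<delta> by linarith
  have "0 < \<delta> ^ 64" using \<delta>0 by simp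
  then have r0: "0 < r" using r by (metis of_nat_0_less_iff order_less_le_trans)
  note FT = fin_prob_PiE[OF N(1) fin_prob_pairs[OF r0, of Q]]
  have fI: "finite I" using N finite_subset by blast
  have fJ: "finite J" using J fI finite_subset by blast
  have p34: "\<delta> ^ 34 = \<delta> ^ 33 * \<delta>" by (simp flip: power_Suc2)
  have ratio: "1 / \<delta> ^ 33 / (4 / \<delta> ^ 34) = \<delta> / 4" using \<delta>0 by (simp add: p34)
  have one: "expectT N r Q (\<lambda>g. of_bool (net_bad I J d e r \<delta> \<kappa> g k)) \<le> exp (- (\<delta> ^ 33))" for k
  proof (cases "(\<Sum>i\<in>I. \<bar>net_vec d e k i\<bar>) \<le> 2 \<and> \<kappa> / 2 \<le> (\<Sum>i\<in>J. \<bar>net_vec d e k i\<bar>)")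
    case False
    then have "expectT N r Q (\<lambda>g. of_bool (net_bad I J d e r \<delta> \<kappa> g k)) = expectT N r Q (\<lambda>g. 0)"
      by (intro expect_cong) (auto simp: net_bad_def)
    then show ?thesis unfolding expect_const[OF FT] by simp
  next
    case True
    let ?y = "net_vec d e k"
    \<comment> \<open>For smaller coordinates the scales near the cap would require entries beyond
      \<open>2 ^ Q\<close>. The hypothesis on \<open>Q\<close> bounds their total mass by
      \<open>\<kappa> / 4\<close>.\<close>
    define S where "S = {i \<in> J. 1 / \<delta> ^ 33 / 2 ^ Q \<le> \<bar>?y i\<bar>}"
    have SJ: "S \<subseteq> J" by (auto simp: S_def)
    have yr: "?y \<in> range (mat_vec d A)" by (rule net_vec_range[OF lewis_onb[OF fI L]])
    have "expectT N r Q (\<lambda>g. of_bool (bucket_min I r (1 / \<delta> ^ 33) ?y g \<le> (log 2 (1 / \<delta> ^ 33 / (4 / \<delta> ^ 34)) - 1) / 512 * (\<kappa> / 4))) \<le> exp (- (1 / (1 / \<delta> ^ 33)))"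
    proof (rule bucket_min_tail[OF N])
      show "S \<subseteq> I" using SJ J by auto
      show "0 < 4 / \<delta> ^ 34" using \<delta>0 by simp
      have "4 * \<delta> ^ 33 \<le> \<delta> * \<delta> ^ 33" using \<delta> \<delta>0 by (intro mult_right_mono) auto
      then show "4 / \<delta> ^ 34 \<le> 1 / \<delta> ^ 33" using \<delta>0 by (simp add: p34 field_simps)
      show "1 / \<delta> ^ 33 / 2 ^ Q \<le> \<bar>?y i\<bar> \<and> \<bar>?y i\<bar> \<le> 4 / \<delta> ^ 34" if i: "i \<in> S" for i
      proof
        show "1 / \<delta> ^ 33 / 2 ^ Q \<le> \<bar>?y i\<bar>" using i by (simp add: S_def)
        have iJ: "i \<in> J" "i \<in> I" using i SJ J by auto
        have "\<bar>?y i\<bar> \<le> 2 * w i * (\<Sum>j\<in>I. \<bar>?y j\<bar>)" by (rule lewis_coord_le[OF fI L yr iJ(2)])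
        also have "\<dots> \<le> 2 * (1 / \<delta> ^ 34) * 2"
          using True J(2)[OF iJ(1)] lewis_pos[OF fI L iJ(2)] \<delta>0 by (intro mult_mono) (auto intro: sum_nonneg)
        finally show "\<bar>?y i\<bar> \<le> 4 / \<delta> ^ 34" by simp
      qed
      show "(\<Sum>i\<in>I. \<bar>?y i\<bar>) \<le> 2" using True by simp
      have p64: "\<delta> ^ 64 = \<delta> ^ 30 * \<delta> ^ 34" by (simp flip: power_add)
      have "1/8 \<le> 1 * (4::real)" by simp
      also have "\<dots> \<le> \<delta> ^ 30 * 4" using \<delta> by (intro mult_right_mono one_le_power) auto
      also have "\<dots> = \<delta> ^ 64 * (4 / \<delta> ^ 34)"
      proof -
        have "u * 4 = u * v * (4 / v)" if "0 < v" for u v :: real using that by simp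
        from this[OF zero_less_power[OF \<delta>0]] show ?thesis unfolding p64 .
      qed
      also have "\<dots> \<le> real r * (4 / \<delta> ^ 34)" using r \<delta>0 by (intro mult_right_mono) auto
      finally show "1/8 \<le> real r * (4 / \<delta> ^ 34)" .
      have "1 \<le> log 2 (\<delta> / 4)" using \<delta> by (subst le_log_iff) auto
      then show "0 \<le> log 2 (1 / \<delta> ^ 33 / (4 / \<delta> ^ 34)) - 1" unfolding ratio by simp
      show "5 \<le> (log 2 (1 / \<delta> ^ 33 / (4 / \<delta> ^ 34)) - 1) / 256 * (\<kappa> / 4)" unfolding ratio by (rule big)
      have "(\<Sum>i\<in>J. \<bar>?y i\<bar>) = (\<Sum>i\<in>S. \<bar>?y i\<bar>) + (\<Sum>i\<in>J - S. \<bar>?y i\<bar>)"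
        using sum.subset_diff[OF SJ fJ, of "\<lambda>i. \<bar>?y i\<bar>"] by simp
      also have "(\<Sum>i\<in>J - S. \<bar>?y i\<bar>) \<le> (\<Sum>i\<in>J - S. 1 / \<delta> ^ 33 / 2 ^ Q)"
        by (intro sum_mono) (auto simp: S_def)
      also have "\<dots> \<le> real (card I) * (1 / \<delta> ^ 33 / 2 ^ Q)"
      proof -
        have "card (J - S) \<le> card I" using J fI by (intro card_mono) auto
        then show ?thesis using \<delta>0 by (simp add: divide_right_mono)
      qed
      finally show "\<kappa> / 4 \<le> (\<Sum>i\<in>S. \<bar>?y i\<bar>)" using True Q by linarith
    qed
    moreover have "expectT N r Q (\<lambda>g. of_bool (net_bad I J d e r \<delta> \<kappa> g k)) \<le>
       expectT N r Q (\<lambda>g. of_bool (bucket_min I r (1 / \<delta> ^ 33) ?y g \<le> (log 2 (1 / \<delta> ^ 33 / (4 / \<delta> ^ 34)) - 1) / 512 * (\<kappa> / 4)))"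
      unfolding ratio by (intro expect_mono[OF FT]) (auto simp: net_bad_def)
    ultimately show ?thesis by simp
  qed
  have "expectT N r Q (\<lambda>g. of_bool (\<exists>k\<in>net d. net_bad I J d e r \<delta> \<kappa> g k)) \<le> (\<Sum>k\<in>net d. expectT N r Q (\<lambda>g. of_bool (net_bad I J d e r \<delta> \<kappa> g k)))"
    by (intro expect_union_bound[OF FT finite_net]) auto
  also have "\<dots> \<le> (\<Sum>k\<in>net d. exp (- (\<delta> ^ 33)))" by (intro sum_mono one)
  also have "\<dots> = (4 * real d ^ 4 + 1) ^ d * exp (- (\<delta> ^ 33))" by (simp add: card_net)
  finally show ?thesis .
qed

text \<open>The rounding error again lies in the column space, so the uniform upper bound applies to
  it: passing from the net to \<open>y\<close> costs only \<open>U * (2 / d ^ 2)\<close>.\<close>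

lemma light_lower:
  assumes fin: "finite I" and L: "lewis_upto I d A 2 w e" and d: "1 \<le> d" and J: "J \<subseteq> I"
    and ok: "\<And>k. k \<in> net d \<Longrightarrow> \<not> net_bad I J d e r \<delta> \<kappa> (\<lambda>i\<in>N. (h i, X i)) k" and IN: "I \<subseteq> N"
    and up: "\<And>y. y \<in> range (mat_vec d A) \<Longrightarrow> (\<Sum>b<r. \<bar>\<Sum>i | i \<in> I \<and> h i = b. X i * y i\<bar>) \<le> U * (\<Sum>i\<in>I. \<bar>y i\<bar>)"
    and U: "0 \<le> U"
    and y: "y \<in> range (mat_vec d A)" and y1: "(\<Sum>i\<in>I. \<bar>y i\<bar>) \<le> 1" and yJ: "\<kappa> \<le> (\<Sum>i\<in>J. \<bar>y i\<bar>)"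
    and dk: "2 / real d ^ 2 \<le> \<kappa> / 2" "2 / real d ^ 2 \<le> 1"
  shows "(log 2 (\<delta> / 4) - 1) / 512 * (\<kappa> / 4) - 2 * U / real d ^ 2 \<le> (\<Sum>b<r. \<bar>\<Sum>i | i \<in> I \<and> h i = b. X i * y i\<bar>)"
proof -
  obtain k where k: "k \<in> net d" "(\<Sum>i\<in>I. \<bar>y i - net_vec d e k i\<bar>) \<le> 2 / real d ^ 2"
    using net_approx[OF fin L d y y1] by blast
  let ?z = "net_vec d e k"
  have zr: "?z \<in> range (mat_vec d A)" by (rule net_vec_range[OF lewis_onb[OF fin L]])
  define u where "u = (\<lambda>i. ?z i - y i)"
  have ur: "u \<in> range (mat_vec d A)"
    using range_mat_vec_add[OF zr range_mat_vec_scale[OF y, of "-1"]] by (simp add: u_def)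
  have us: "(\<Sum>i\<in>I. \<bar>u i\<bar>) \<le> 2 / real d ^ 2" using k(2) by (simp add: u_def abs_minus_commute)
  have "(\<Sum>i\<in>I. \<bar>?z i\<bar>) \<le> (\<Sum>i\<in>I. \<bar>y i\<bar> + \<bar>u i\<bar>)" by (intro sum_mono) (simp add: u_def)
  then have z2: "(\<Sum>i\<in>I. \<bar>?z i\<bar>) \<le> 2" using y1 us dk(2) by (simp add: sum.distrib)
  have "(\<Sum>i\<in>J. \<bar>y i\<bar>) \<le> (\<Sum>i\<in>J. \<bar>?z i\<bar> + \<bar>u i\<bar>)" by (intro sum_mono) (simp add: u_def)
  also have "\<dots> \<le> (\<Sum>i\<in>J. \<bar>?z i\<bar>) + (\<Sum>i\<in>I. \<bar>u i\<bar>)"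
    unfolding sum.distrib using J fin by (intro add_left_mono sum_mono2) auto
  finally have zJ: "\<kappa> / 2 \<le> (\<Sum>i\<in>J. \<bar>?z i\<bar>)" using yJ us dk(1) by linarith
  have "(log 2 (\<delta> / 4) - 1) / 512 * (\<kappa> / 4) < bucket_min I r (1 / \<delta> ^ 33) ?z (\<lambda>i\<in>N. (h i, X i))"
    using ok[OF k(1)] z2 zJ by (auto simp: net_bad_def not_le)
  also have "\<dots> \<le> (\<Sum>b<r. \<bar>\<Sum>i | i \<in> I \<and> h i = b. X i * ?z i\<bar>)"
    unfolding bucket_min_def
  proof (intro sum_mono)
    fix b
    have "(\<Sum>i | i \<in> I \<and> fst ((\<lambda>i\<in>N. (h i, X i)) i) = b. snd ((\<lambda>i\<in>N. (h i, X i)) i) * ?z i) = (\<Sum>i | i \<in> I \<and> h i = b. X i * ?z i)"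
      using IN by (intro sum.cong) auto
    then show "min \<bar>\<Sum>i | i \<in> I \<and> fst ((\<lambda>i\<in>N. (h i, X i)) i) = b. snd ((\<lambda>i\<in>N. (h i, X i)) i) * ?z i\<bar> (1 / \<delta> ^ 33) \<le> \<bar>\<Sum>i | i \<in> I \<and> h i = b. X i * ?z i\<bar>"
      by simp
  qed
  also have "\<dots> \<le> (\<Sum>b<r. \<bar>\<Sum>i | i \<in> I \<and> h i = b. X i * y i\<bar> + \<bar>\<Sum>i | i \<in> I \<and> h i = b. X i * u i\<bar>)"
  proof (intro sum_mono)
    fix b
    have "(\<Sum>i | i \<in> I \<and> h i = b. X i * ?z i) = (\<Sum>i | i \<in> I \<and> h i = b. X i * y i) + (\<Sum>i | i \<in> I \<and> h i = b. X i * u i)"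
      unfolding sum.distrib[symmetric] by (intro sum.cong) (auto simp: u_def algebra_simps)
    then show "\<bar>\<Sum>i | i \<in> I \<and> h i = b. X i * ?z i\<bar> \<le> \<bar>\<Sum>i | i \<in> I \<and> h i = b. X i * y i\<bar> + \<bar>\<Sum>i | i \<in> I \<and> h i = b. X i * u i\<bar>" by linarith
  qed
  also have "\<dots> \<le> (\<Sum>b<r. \<bar>\<Sum>i | i \<in> I \<and> h i = b. X i * y i\<bar>) + U * (2 / real d ^ 2)"
    unfolding sum.distrib using up[OF ur] mult_left_mono[OF us U] by linarith
  finally show ?thesis by (simp add: mult.commute)
qed

section \<open>Collisions and loads of random bucket functions\<close>

abbreviation expectH :: "nat set \<Rightarrow> nat \<Rightarrow> ((nat \<Rightarrow> nat) \<Rightarrow> real) \<Rightarrow> real" where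
  "expectH N r \<equiv> expect (PiE N (\<lambda>_. {..<r})) (wprod N (\<lambda>_. 1 / real r))"

lemma fin_prob_H: "finite N \<Longrightarrow> 0 < r \<Longrightarrow> fin_prob (PiE N (\<lambda>_. {..<r})) (wprod N (\<lambda>_. 1 / real r))"
  by (intro fin_prob_PiE fin_prob_buckets)

lemma expect_hash_eq:
  assumes "b < r"
  shows "expect {..<r} (\<lambda>_. 1 / real r) (\<lambda>a. of_bool (a = b)) = 1 / real r"
proof -
  have "expect {..<r} (\<lambda>_. 1 / real r) (\<lambda>a. of_bool (a = b)) = (\<Sum>a<r. if a = b then 1 / real r else 0)"
    unfolding expect_def by (intro sum.cong) auto
  then show ?thesis using assms by simp
qed

lemma hash_resample_eq:
  assumes N: "finite N" and r: "0 < r" and i: "i \<in> N" and j: "j \<in> N" "i \<noteq> j" and G: "\<And>g a. G (g(i := a)) = G g"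
  shows "expectH N r (\<lambda>h. of_bool (h i = h j \<and> G h)) = expectH N r (\<lambda>h. of_bool (G h)) / real r"
proof -
  have "expectH N r (\<lambda>h. of_bool (h i = h j \<and> G h)) = expectH N r (\<lambda>h. of_bool (G h) * (1 / real r))"
  proof (subst expect_resample[OF N i fin_prob_buckets[OF r]], rule expect_cong)
    fix h assume "h \<in> PiE N (\<lambda>_. {..<r})"
    then have hj: "h j < r" using j by (auto simp: PiE_iff)
    have "expect {..<r} (\<lambda>_. 1 / real r) (\<lambda>a. of_bool ((h(i := a)) i = (h(i := a)) j \<and> G (h(i := a))))
        = expect {..<r} (\<lambda>_. 1 / real r) (\<lambda>a. of_bool (G h) * of_bool (a = h j))"
      using j by (intro expect_cong) (auto simp: G)
    then show "expect {..<r} (\<lambda>_. 1 / real r) (\<lambda>a. of_bool ((h(i := a)) i = (h(i := a)) j \<and> G (h(i := a)))) = of_bool (G h) * (1 / real r)"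
      by (simp only: expect_cmult expect_hash_eq[OF hj])
  qed
  then show ?thesis by (simp only: expect_multc) simp
qed

lemma hash_collision:
  assumes N: "finite N" and r: "0 < r" and ij: "i \<in> N" "j \<in> N" "i \<noteq> j"
  shows "expectH N r (\<lambda>h. of_bool (h i = h j)) = 1 / real r"
  using hash_resample_eq[OF N r ij, of "\<lambda>_. True"] expect_const[OF fin_prob_H[OF N r], of 1] by simp

text \<open>Two different pairs, even if they share a row, leave one row that belongs to only one of
  them. Resampling its bucket gives a factor \<open>1 / r\<close> whatever the other rows
  do.\<close>

lemma hash_two_collisions:
  assumes N: "finite N" and r: "0 < r" and ij: "i \<in> N" "j \<in> N" "i \<noteq> j" and kl: "k \<in> N" "l \<in> N" "k \<noteq> l" and ne: "{i, j} \<noteq> {k, l}"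
  shows "expectH N r (\<lambda>h. of_bool (h i = h j \<and> h k = h l)) = 1 / (real r)\<^sup>2"
proof -
  have *: "expectH N r (\<lambda>h. of_bool (h i = h j \<and> h k = h l)) = 1 / (real r)\<^sup>2" if "i \<in> N" "j \<in> N" "i \<noteq> j" "i \<notin> {k, l}" for i j
    using hash_resample_eq[OF N r that(1,2,3), of "\<lambda>h. h k = h l"] hash_collision[OF N r kl] that(4)
    by (simp add: power2_eq_square)
  consider "i \<notin> {k, l}" | "j \<notin> {k, l}" using ij kl ne by auto
  then show ?thesis
  proof cases
    case 1 then show ?thesis using * ij by blast
  next
    case 2
    then have "expectH N r (\<lambda>h. of_bool (h j = h i \<and> h k = h l)) = 1 / (real r)\<^sup>2" using * ij by blast
    then show ?thesis by (simp add: eq_commute[of "_ j" "_ i"])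
  qed
qed

lemma exp_le_chord:
  assumes "0 \<le> a" "a \<le> 1"
  shows "exp (q * a) \<le> 1 + a * (exp q - 1 :: real)"
  using convex_onD[OF exp_convex assms, of 0 q] by (simp add: mult.commute algebra_simps)

text \<open>A Chernoff bound for weighted balls. Convexity replaces \<open>exp (q * v i / V)\<close>
  by its chord, so the total weight \<open>s\<close> is the only information about the weights that
  enters. The rate \<open>q\<close> stays free because the two applications have very different
  average loads.\<close>

lemma hash_load:
  assumes N: "finite N" "J \<subseteq> N" and r: "0 < r" and v: "\<And>i. i \<in> J \<Longrightarrow> 0 \<le> v i \<and> v i \<le> V" and V: "0 < V" and q: "0 \<le> q"
    and s: "(\<Sum>i\<in>J. v i) \<le> s"
  shows "expectH N r (\<lambda>h. of_bool (\<exists>b<r. k * V \<le> (\<Sum>i | i \<in> J \<and> h i = b. v i))) \<le> real r * exp (s / V * (exp q - 1) / real r - q * k)"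
proof -
  note FH = fin_prob_H[OF N(1) r]
  have fJ: "finite J" using N finite_subset by blast
  have one: "expectH N r (\<lambda>h. of_bool (k * V \<le> (\<Sum>i | i \<in> J \<and> h i = b. v i))) \<le> exp (s / V * (exp q - 1) / real r - q * k)" if b: "b < r" for b
  proof -
    define f where "f = (\<lambda>i a. exp (q * (v i / V) * of_bool (a = b)))" for a :: nat
    have "expectH N r (\<lambda>h. of_bool (k * V \<le> (\<Sum>i | i \<in> J \<and> h i = b. v i))) \<le> expectH N r (\<lambda>h. \<Prod>i\<in>J. f i (h i)) / exp (q * k)"
    proof (rule expect_markov[OF FH])
      fix h assume "k * V \<le> (\<Sum>i | i \<in> J \<and> h i = b. v i)"
      then have "k \<le> (\<Sum>i | i \<in> J \<and> h i = b. v i) / V" using V by (simp add: field_simps)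
      then have "q * k \<le> q * ((\<Sum>i | i \<in> J \<and> h i = b. v i) / V)" using q by (intro mult_left_mono)
      also have "\<dots> = (\<Sum>i\<in>J. q * (v i / V) * of_bool (h i = b))"
        unfolding sum_divide_distrib sum_distrib_left using fJ
        by (subst sum.inter_filter[OF fJ]) (auto intro!: sum.cong)
      finally have "exp (q * k) \<le> exp (\<Sum>i\<in>J. q * (v i / V) * of_bool (h i = b))" by simp
      also have "\<dots> = (\<Prod>i\<in>J. f i (h i))" unfolding f_def by (rule exp_sum[OF fJ])
      finally show "exp (q * k) \<le> (\<Prod>i\<in>J. f i (h i))" .
    qed (auto simp: f_def intro!: prod_nonneg)
    also have "expectH N r (\<lambda>h. \<Prod>i\<in>J. f i (h i)) = (\<Prod>i\<in>J. expect {..<r} (\<lambda>_. 1 / real r) (f i))"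
      by (rule expect_prod[OF N fin_prob_buckets[OF r]])
    also have "\<dots> \<le> (\<Prod>i\<in>J. exp (v i / V * (exp q - 1) / real r))"
    proof (intro prod_mono conjI)
      fix i assume i: "i \<in> J"
      show "0 \<le> expect {..<r} (\<lambda>_. 1 / real r) (f i)" by (intro expect_nonneg[OF fin_prob_buckets[OF r]]) (simp add: f_def)
      have c: "0 \<le> v i / V" "v i / V \<le> 1" using v[OF i] V by auto
      have "expect {..<r} (\<lambda>_. 1 / real r) (f i) = expect {..<r} (\<lambda>_. 1 / real r) (\<lambda>a. 1 + (exp (q * (v i / V)) - 1) * of_bool (a = b))"
        by (intro expect_cong) (auto simp: f_def)
      also have "\<dots> = 1 + (exp (q * (v i / V)) - 1) / real r"
        unfolding expect_add expect_cmult expect_hash_eq[OF b] expect_const[OF fin_prob_buckets[OF r]] by simp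
      also have "\<dots> \<le> 1 + (v i / V * (exp q - 1)) / real r"
        using exp_le_chord[OF c, of q] by (intro add_left_mono divide_right_mono) auto
      also have "\<dots> \<le> exp (v i / V * (exp q - 1) / real r)" by (rule exp_ge_add_one_self)
      finally show "expect {..<r} (\<lambda>_. 1 / real r) (f i) \<le> exp (v i / V * (exp q - 1) / real r)" .
    qed
    also have "\<dots> = exp ((\<Sum>i\<in>J. v i) / V * (exp q - 1) / real r)"
      unfolding sum_divide_distrib sum_distrib_right by (rule exp_sum[OF fJ, symmetric])
    also have "\<dots> \<le> exp (s / V * (exp q - 1) / real r)"
      using s V q by (intro iffD2[OF exp_le_cancel_iff] divide_right_mono mult_right_mono) auto
    finally show ?thesis by (simp add: exp_diff divide_right_mono)
  qed
  have "expectH N r (\<lambda>h. of_bool (\<exists>b<r. k * V \<le> (\<Sum>i | i \<in> J \<and> h i = b. v i))) \<le> (\<Sum>b<r. expectH N r (\<lambda>h. of_bool (k * V \<le> (\<Sum>i | i \<in> J \<and> h i = b. v i))))"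
    by (intro expect_union_bound[OF FH]) auto
  also have "\<dots> \<le> (\<Sum>b<r. exp (s / V * (exp q - 1) / real r - q * k))" by (intro sum_mono one) auto
  finally show ?thesis by simp
qed

section \<open>Rows of large weight\<close>

text \<open>A total order, so that exactly the heaviest row of \<open>H\<close> in a bucket escapes
  \<open>collided\<close>. A collision is charged to the lighter row: row \<open>i\<close> then has
  at most \<open>2 * d / w i\<close> possible partners, which offsets its kernel entry of size
  \<open>2 * (w i)\<^sup>2\<close>.\<close>

definition prec :: "(nat \<Rightarrow> real) \<Rightarrow> nat \<Rightarrow> nat \<Rightarrow> bool" where
  "prec w i j \<longleftrightarrow> w i < w j \<or> (w i = w j \<and> i < j)"

definition collided :: "nat set \<Rightarrow> (nat \<Rightarrow> real) \<Rightarrow> (nat \<Rightarrow> nat) \<Rightarrow> nat set" where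
  "collided H w h = {i \<in> H. \<exists>j\<in>H. prec w i j \<and> h i = h j}"

lemma prec_asym: "prec w i j \<Longrightarrow> \<not> prec w j i" and prec_neq: "prec w i j \<Longrightarrow> i \<noteq> j"
  and prec_total: "i \<noteq> j \<Longrightarrow> prec w i j \<or> prec w j i" and prec_le: "prec w i j \<Longrightarrow> w i \<le> w j"
  by (auto simp: prec_def)

text \<open>On the diagonal the number of partners times the kernel entry is of order
  \<open>d * w i\<close>, which sums to \<open>d ^ 2\<close> and is paid for by \<open>r\<close>.
  Off the diagonal two different collisions are needed, with probability at most
  \<open>(card H / r)\<^sup>2\<close>; this beats the total kernel mass because \<open>H\<close> has
  at most \<open>2 * \<delta> ^ 37\<close> rows.\<close>

lemma heavy_event:
  fixes C0 \<delta> \<nu> :: real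
  assumes N: "finite N" "M \<subseteq> N" and L: "lewis_upto M d A 2 w e" and H: "H = {i \<in> M. 1 / \<delta> ^ 5 \<le> w i}"
    and d: "real d = \<delta> ^ 32" and \<delta>: "1 \<le> \<delta>" and C0: "1 \<le> C0" and r: "C0 * \<delta> ^ 64 \<le> real r" and \<nu>: "0 < \<nu>"
  shows "expectH N r (\<lambda>h. of_bool (\<nu> \<le> (\<Sum>i\<in>collided H w h. \<Sum>j\<in>collided H w h. \<bar>ker d e i j\<bar>))) \<le> 24 / (C0 * \<nu>)"
proof -
  have \<delta>0: "0 < \<delta>" using \<delta> by linarith
  have Cd: "0 < C0 * \<delta> ^ 64" using C0 \<delta>0 by simp
  then have r0: "0 < real r" using r by linarith
  then have r0': "0 < r" by simp
  have fM: "finite M" using N finite_subset by blast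
  have HM: "H \<subseteq> M" by (auto simp: H)
  have fH: "finite H" using HM fM finite_subset by blast
  have HN: "H \<subseteq> N" using HM N by blast
  note FH = fin_prob_H[OF N(1) r0']
  note w = lewis_pos[OF fM L]
  let ?B = "collided H w"
  define p where "p = (\<lambda>i j. expectH N r (\<lambda>h. of_bool (i \<in> ?B h \<and> j \<in> ?B h)))"
  have p0: "0 \<le> p i j" for i j unfolding p_def by (intro expect_nonneg[OF FH]) auto
  define K where "K = (\<lambda>i j. \<bar>ker d e i j\<bar>)"
  have cH: "real (card H) \<le> 2 * \<delta> ^ 37"
  proof -
    have "real (card H) \<le> 2 * real d / (1 / \<delta> ^ 5)"
      using \<delta>0 HM by (intro lewis_card_ge[OF fM L]) (auto simp: H)
    also have "\<dots> = 2 * \<delta> ^ 37" unfolding d by (simp flip: power_add)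
    finally show ?thesis .
  qed
  have diag: "p i i \<le> 2 * real d / w i / real r" if i: "i \<in> H" for i
  proof -
    let ?S = "{j \<in> H. prec w i j}"
    have "p i i \<le> (\<Sum>j\<in>?S. expectH N r (\<lambda>h. of_bool (h i = h j)))"
      unfolding p_def using fH by (intro expect_union_bound[OF FH]) (auto simp: collided_def)
    also have "\<dots> = (\<Sum>j\<in>?S. 1 / real r)"
      using i HN prec_neq by (intro sum.cong refl hash_collision[OF N(1) r0']) auto
    also have "\<dots> = real (card ?S) / real r" by simp
    also have "\<dots> \<le> 2 * real d / w i / real r"
      using w i HM prec_le by (intro divide_right_mono lewis_card_ge[OF fM L]) auto
    finally show ?thesis .
  qed
  have off: "p i j \<le> (real (card H))\<^sup>2 / (real r)\<^sup>2" if i: "i \<in> H" and j: "j \<in> H" and ij: "i \<noteq> j" for i j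
  proof -
    let ?S = "{k \<in> H. prec w i k} \<times> {l \<in> H. prec w j l}"
    have "p i j \<le> (\<Sum>kl\<in>?S. expectH N r (\<lambda>h. of_bool (h i = h (fst kl) \<and> h j = h (snd kl))))"
      unfolding p_def using fH by (intro expect_union_bound[OF FH]) (auto simp: collided_def)
    also have "\<dots> = (\<Sum>kl\<in>?S. 1 / (real r)\<^sup>2)"
    proof (intro sum.cong refl)
      fix kl assume "kl \<in> ?S"
      then obtain k l where kl: "kl = (k, l)" "k \<in> H" "l \<in> H" "prec w i k" "prec w j l" by auto
      \<comment> \<open>Equality would force \<open>k = j\<close> and \<open>l = i\<close>, hence
        both \<open>prec w i j\<close> and \<open>prec w j i\<close>.\<close>
      have "{i, k} \<noteq> {j, l}" using kl ij prec_asym by (auto simp: doubleton_eq_iff)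
      then show "expectH N r (\<lambda>h. of_bool (h i = h (fst kl) \<and> h j = h (snd kl))) = 1 / (real r)\<^sup>2"
        using kl i j HN prec_neq by (auto intro!: hash_two_collisions[OF N(1) r0'])
    qed
    also have "\<dots> = real (card {k \<in> H. prec w i k}) * real (card {l \<in> H. prec w j l}) / (real r)\<^sup>2"
      by (simp add: card_cartesian_product)
    also have "\<dots> \<le> real (card H) * real (card H) / (real r)\<^sup>2"
      using fH by (intro divide_right_mono mult_mono of_nat_mono card_mono) auto
    finally show ?thesis by (simp add: power2_eq_square)
  qed
  have E: "expectH N r (\<lambda>h. \<Sum>i\<in>?B h. \<Sum>j\<in>?B h. K i j) \<le> 24 / C0"
  proof -
    have eq: "(\<Sum>i\<in>?B h. \<Sum>j\<in>?B h. K i j) = (\<Sum>i\<in>H. \<Sum>j\<in>H. of_bool (i \<in> ?B h \<and> j \<in> ?B h) * K i j)" for h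
    proof -
      have B: "?B h = {i \<in> H. i \<in> ?B h}" by (auto simp: collided_def)
      have s: "(\<Sum>i\<in>?B h. f i) = (\<Sum>i\<in>H. of_bool (i \<in> ?B h) * f i)" for f :: "nat \<Rightarrow> real"
        by (subst B, subst sum.inter_filter[OF fH]) (auto intro!: sum.cong)
      show ?thesis unfolding s by (simp add: sum_distrib_left mult.assoc of_bool_conj)
    qed
    have "expectH N r (\<lambda>h. \<Sum>i\<in>?B h. \<Sum>j\<in>?B h. K i j) = (\<Sum>i\<in>H. \<Sum>j\<in>H. p i j * K i j)"
      unfolding eq expect_sum expect_multc p_def ..
    also have "\<dots> \<le> (\<Sum>i\<in>H. \<Sum>j\<in>H. (if j = i then 4 * real d * w i / real r else 0) + (real (card H))\<^sup>2 / (real r)\<^sup>2 * K i j)"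
    proof (intro sum_mono)
      fix i j assume i: "i \<in> H" and j: "j \<in> H"
      have nn: "0 \<le> (real (card H))\<^sup>2 / (real r)\<^sup>2 * K i j" by (simp add: K_def)
      show "p i j * K i j \<le> (if j = i then 4 * real d * w i / real r else 0) + (real (card H))\<^sup>2 / (real r)\<^sup>2 * K i j"
      proof (cases "j = i")
        case True
        have wi: "0 < w i" using w i HM by auto
        have "p i i * K i i \<le> (2 * real d / w i / real r) * (2 * (w i)\<^sup>2)"
          using diag[OF i] lewis_ker_le[OF fM L, of i] i HM p0 wi
          by (intro mult_mono) (auto simp: K_def ker_self_nonneg)
        also have "\<dots> = 4 * real d * w i / real r" using wi by (simp add: power2_eq_square)
        finally show ?thesis using True nn by simp
      next
        case False
        have "p i j * K i j \<le> (real (card H))\<^sup>2 / (real r)\<^sup>2 * K i j"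
          using off[OF i j] False by (intro mult_right_mono) (auto simp: K_def)
        then show ?thesis using False by simp
      qed
    qed
    also have "\<dots> = 4 * real d / real r * (\<Sum>i\<in>H. w i) + (real (card H))\<^sup>2 / (real r)\<^sup>2 * (\<Sum>i\<in>H. \<Sum>j\<in>H. K i j)"
    proof -
      have "(\<Sum>i\<in>H. \<Sum>j\<in>H. (if j = i then 4 * real d * w i / real r else 0)) = 4 * real d / real r * (\<Sum>i\<in>H. w i)"
        using fH by (simp add: sum_distrib_left)
      then show ?thesis by (simp add: sum.distrib sum_distrib_left)
    qed
    also have "\<dots> \<le> 8 / C0 + 16 / C0"
    proof (rule add_mono)
      have dd: "real d * real d = \<delta> ^ 64" unfolding d by (simp flip: power_add)
      have "(\<Sum>i\<in>H. w i) \<le> (\<Sum>i\<in>M. w i)" using HM fM w by (intro sum_mono2) (auto simp: less_imp_le)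
      also have "\<dots> \<le> 2 * real d" by (rule lewis_sum[OF fM L])
      finally have "4 * real d / real r * (\<Sum>i\<in>H. w i) \<le> 4 * real d / real r * (2 * real d)" by (intro mult_left_mono) auto
      also have "\<dots> = 8 * (real d * real d) / real r" by simp
      also have "\<dots> = 8 * \<delta> ^ 64 / real r" unfolding dd ..
      also have "\<dots> \<le> 8 * \<delta> ^ 64 / (C0 * \<delta> ^ 64)" using r Cd \<delta>0 by (intro divide_left_mono) auto
      also have "\<dots> = 8 / C0" using \<delta>0 by simp
      finally show "4 * real d / real r * (\<Sum>i\<in>H. w i) \<le> 8 / C0" .
      have p74: "(\<delta> ^ 37)\<^sup>2 = \<delta> ^ 74" by (simp flip: power_mult)
      \<comment> \<open>Arithmetic-geometric mean inequality. The factor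
        \<open>\<delta> ^ 21\<close> balances the square of \<open>card H\<close>, at most
        \<open>4 * \<delta> ^ 74\<close>, against the Hilbert-Schmidt bound
        \<open>4 * \<delta> ^ 32\<close>.\<close>
      have K1: "K i j \<le> (1 / \<delta> ^ 21 + (ker d e i j)\<^sup>2 * \<delta> ^ 21) / 2" for i j
      proof -
        have "0 \<le> (K i j * \<delta> ^ 21 - 1)\<^sup>2" by simp
        then have "2 * (K i j * \<delta> ^ 21) \<le> (K i j)\<^sup>2 * (\<delta> ^ 21)\<^sup>2 + 1" by (simp add: power2_diff power_mult_distrib)
        then have "2 * (K i j * \<delta> ^ 21) / \<delta> ^ 21 \<le> ((K i j)\<^sup>2 * (\<delta> ^ 21)\<^sup>2 + 1) / \<delta> ^ 21" using \<delta>0 by (intro divide_right_mono) auto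
        also have "((K i j)\<^sup>2 * (\<delta> ^ 21)\<^sup>2 + 1) / \<delta> ^ 21 = 1 / \<delta> ^ 21 + (ker d e i j)\<^sup>2 * \<delta> ^ 21"
        proof -
          have "(k * t\<^sup>2 + 1) / t = 1 / t + k * t" if "0 < t" for k t :: real
            using that by (simp add: field_simps power2_eq_square)
          from this[OF zero_less_power[OF \<delta>0]] show ?thesis by (simp only: K_def power2_abs)
        qed
        finally show ?thesis using \<delta>0 by simp
      qed
      have "(\<Sum>i\<in>H. \<Sum>j\<in>H. K i j) \<le> (\<Sum>i\<in>H. \<Sum>j\<in>H. (1 / \<delta> ^ 21 + (ker d e i j)\<^sup>2 * \<delta> ^ 21) / 2)"
        by (intro sum_mono K1)
      also have "\<dots> = ((real (card H))\<^sup>2 / \<delta> ^ 21 + (\<Sum>i\<in>H. \<Sum>j\<in>H. (ker d e i j)\<^sup>2) * \<delta> ^ 21) / 2"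
        by (simp add: sum.distrib add_divide_distrib sum_divide_distrib[symmetric] sum_distrib_right[symmetric] power2_eq_square)
      also have "\<dots> \<le> ((2 * \<delta> ^ 37)\<^sup>2 / \<delta> ^ 21 + (4 * real d) * \<delta> ^ 21) / 2"
        using cH \<delta>0 lewis_ker_sq_sum_le[OF fM L HM]
        by (intro divide_right_mono add_mono mult_right_mono power_mono) auto
      also have "\<dots> = 4 * \<delta> ^ 53"
      proof -
        have 1: "(2 * \<delta> ^ 37)\<^sup>2 = 4 * (\<delta> ^ 53 * \<delta> ^ 21)"
          by (simp add: power_mult_distrib flip: power_mult power_add)
        have 2: "\<delta> ^ 53 = \<delta> ^ 32 * \<delta> ^ 21" by (simp flip: power_add)
        have "(4 * (u * v) / v + 4 * a * v) / 2 = 4 * u" if "0 < v" "u = a * v" for u v a :: real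
          using that by simp
        from this[OF zero_less_power[OF \<delta>0] 2] show ?thesis unfolding 1 d .
      qed
      finally have K2: "(\<Sum>i\<in>H. \<Sum>j\<in>H. K i j) \<le> 4 * \<delta> ^ 53" .
      have "(real (card H))\<^sup>2 / (real r)\<^sup>2 * (\<Sum>i\<in>H. \<Sum>j\<in>H. K i j) \<le> (2 * \<delta> ^ 37)\<^sup>2 / (C0 * \<delta> ^ 64)\<^sup>2 * (4 * \<delta> ^ 53)"
        using cH r r0 Cd K2 \<delta>0 by (intro mult_mono frac_le power_mono) (auto simp: K_def intro!: sum_nonneg)
      also have "\<dots> = 16 / (C0\<^sup>2 * \<delta>)"
      proof -
        have "(\<delta> ^ 64)\<^sup>2 = \<delta> ^ 74 * \<delta> ^ 53 * \<delta>" by (simp flip: power_add power_mult power_Suc2)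
        then show ?thesis using \<delta>0 C0 by (simp add: power_mult_distrib p74)
      qed
      also have "\<dots> \<le> 16 / C0"
      proof (intro divide_left_mono)
        have "C0 * 1 \<le> C0 * (C0 * \<delta>)" using C0 \<delta> mult_mono[OF C0 \<delta>] by (intro mult_left_mono) auto
        then show "C0 \<le> C0\<^sup>2 * \<delta>" by (simp add: power2_eq_square mult.assoc)
      qed (use C0 \<delta>0 in auto)
      finally show "(real (card H))\<^sup>2 / (real r)\<^sup>2 * (\<Sum>i\<in>H. \<Sum>j\<in>H. K i j) \<le> 16 / C0" .
    qed
    also have "\<dots> = 24 / C0" by simp
    finally show ?thesis .
  qed
  have "expectH N r (\<lambda>h. of_bool (\<nu> \<le> (\<Sum>i\<in>?B h. \<Sum>j\<in>?B h. K i j))) \<le> expectH N r (\<lambda>h. \<Sum>i\<in>?B h. \<Sum>j\<in>?B h. K i j) / \<nu>"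
    by (intro expect_markov[OF FH \<nu>]) (auto simp: K_def intro!: sum_nonneg)
  also have "\<dots> \<le> 24 / C0 / \<nu>" using E \<nu> by (intro divide_right_mono) auto
  finally show ?thesis by (simp add: K_def)
qed

text \<open>A bucket contains at most one row of \<open>H\<close> that is not collided, so the mass
  of such rows survives up to disturbance by the others. Collided mass is subtracted twice: once as
  missing, once as disturbing.\<close>

lemma heavy_lower:
  assumes fI: "finite I" and MI: "M \<subseteq> I" and L: "lewis_upto M d A 2 w e" and HM: "H \<subseteq> M"
    and h: "\<And>i. i \<in> I \<Longrightarrow> h i < r" and y: "y \<in> range (mat_vec d A)"
    and B: "(\<Sum>i\<in>collided H w h. \<Sum>j\<in>collided H w h. \<bar>ker d e i j\<bar>) \<le> \<nu>"
  shows "(\<Sum>i\<in>H. \<bar>y i\<bar>) - 2 * (sqrt 2 * (\<Sum>i\<in>M. \<bar>y i\<bar>) * sqrt \<nu>) - (\<Sum>i\<in>I - H. \<bar>y i\<bar>)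
     \<le> (\<Sum>b<r. \<bar>\<Sum>i | i \<in> I \<and> h i = b. y i\<bar>)"
proof -
  have fM: "finite M" using MI fI finite_subset by blast
  have fH: "finite H" using HM fM finite_subset by blast
  let ?B = "collided H w h"
  have BH: "?B \<subseteq> H" by (auto simp: collided_def)
  have fB: "finite ?B" using BH fH finite_subset by blast
  have sB: "(\<Sum>i\<in>?B. \<bar>y i\<bar>) \<le> sqrt 2 * (\<Sum>i\<in>M. \<bar>y i\<bar>) * sqrt \<nu>"
  proof -
    \<comment> \<open>With the signs of \<open>y\<close> as coefficients the mass on the collided
      set becomes a linear functional. Its norm is a quadratic form in the kernel, at most the
      kernel mass whatever the signs are.\<close>
    have "(\<Sum>i\<in>?B. \<bar>y i\<bar>) = (\<Sum>i\<in>?B. sgn (y i) * y i)" by (intro sum.cong refl) (simp add: abs_sgn mult.commute)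
    also have "\<dots> \<le> sqrt 2 * (\<Sum>i\<in>M. \<bar>y i\<bar>) * sqrt (\<Sum>l<d. (\<Sum>i\<in>?B. sgn (y i) * e l i)\<^sup>2)"
      by (rule order_trans[OF abs_ge_self lewis_linear_le[OF fM L y]]) (use BH HM in blast)
    also have "\<dots> \<le> sqrt 2 * (\<Sum>i\<in>M. \<bar>y i\<bar>) * sqrt \<nu>"
    proof (intro mult_left_mono real_sqrt_le_mono)
      have "(\<Sum>l<d. (\<Sum>i\<in>?B. sgn (y i) * e l i)\<^sup>2) = (\<Sum>i\<in>?B. \<Sum>j\<in>?B. sgn (y i) * sgn (y j) * ker d e i j)"
        by (rule ker_quadratic)
      also have "\<dots> \<le> (\<Sum>i\<in>?B. \<Sum>j\<in>?B. \<bar>ker d e i j\<bar>)"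
        by (intro sum_mono) (auto simp: sgn_if)
      finally show "(\<Sum>l<d. (\<Sum>i\<in>?B. sgn (y i) * e l i)\<^sup>2) \<le> \<nu>" using B by linarith
    qed (auto intro!: mult_nonneg_nonneg sum_nonneg)
    finally show ?thesis .
  qed
  have bucket: "(\<Sum>i | i \<in> H - ?B \<and> h i = b. \<bar>y i\<bar>) - (\<Sum>i | i \<in> ?B \<and> h i = b. \<bar>y i\<bar>) - (\<Sum>i | i \<in> I - H \<and> h i = b. \<bar>y i\<bar>)
     \<le> \<bar>\<Sum>i | i \<in> I \<and> h i = b. y i\<bar>" for b
  proof -
    let ?U = "{i \<in> H - ?B. h i = b}" and ?V = "{i \<in> ?B. h i = b}" and ?W = "{i \<in> I - H. h i = b}"
    have fin: "finite ?U" "finite ?V" "finite ?W" using fI fH fB by auto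
    have U1: "\<exists>i. ?U \<subseteq> {i}"
    proof (cases "?U = {}")
      case False
      then obtain i where i: "i \<in> ?U" by auto
      have "j = i" if j: "j \<in> ?U" for j
      proof (rule ccontr)
        assume "j \<noteq> i"
        then have "prec w i j \<or> prec w j i" using prec_total by auto
        then show False using i j by (auto simp: collided_def)
      qed
      then show ?thesis by auto
    qed auto
    then obtain i where "?U \<subseteq> {i}" by blast
    then have "?U = {} \<or> ?U = {i}" by (rule subset_singletonD)
    then have Us: "(\<Sum>i\<in>?U. \<bar>y i\<bar>) = \<bar>\<Sum>i\<in>?U. y i\<bar>"
      by (elim disjE) (simp_all only: sum.empty abs_zero sum.insert finite.emptyI finite.insertI empty_iff add_0_right not_False_eq_True if_False simp_thms)
    have "{i \<in> I. h i = b} = ?U \<union> (?V \<union> ?W)" using BH HM MI by auto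
    then have "(\<Sum>i | i \<in> I \<and> h i = b. y i) = (\<Sum>i\<in>?U. y i) + ((\<Sum>i\<in>?V. y i) + (\<Sum>i\<in>?W. y i))"
      using fin BH by (subst sum.union_disjoint[symmetric], simp, simp, blast, subst sum.union_disjoint[symmetric]) auto
    moreover have "\<bar>\<Sum>i\<in>?V. y i\<bar> \<le> (\<Sum>i\<in>?V. \<bar>y i\<bar>)" "\<bar>\<Sum>i\<in>?W. y i\<bar> \<le> (\<Sum>i\<in>?W. \<bar>y i\<bar>)" by (rule sum_abs)+
    ultimately show ?thesis unfolding Us by linarith
  qed
  have "(\<Sum>i\<in>H - ?B. \<bar>y i\<bar>) - (\<Sum>i\<in>?B. \<bar>y i\<bar>) - (\<Sum>i\<in>I - H. \<bar>y i\<bar>)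
     = (\<Sum>b<r. (\<Sum>i | i \<in> H - ?B \<and> h i = b. \<bar>y i\<bar>) - (\<Sum>i | i \<in> ?B \<and> h i = b. \<bar>y i\<bar>) - (\<Sum>i | i \<in> I - H \<and> h i = b. \<bar>y i\<bar>))"
  proof -
    have 1: "(\<Sum>b<r. \<Sum>i | i \<in> H - ?B \<and> h i = b. \<bar>y i\<bar>) = (\<Sum>i\<in>H - ?B. \<bar>y i\<bar>)"
      using fH h HM MI by (intro sum_buckets) auto
    have 2: "(\<Sum>b<r. \<Sum>i | i \<in> ?B \<and> h i = b. \<bar>y i\<bar>) = (\<Sum>i\<in>?B. \<bar>y i\<bar>)"
      using fB h BH HM MI by (intro sum_buckets) auto
    have 3: "(\<Sum>b<r. \<Sum>i | i \<in> I - H \<and> h i = b. \<bar>y i\<bar>) = (\<Sum>i\<in>I - H. \<bar>y i\<bar>)"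
      using fI h by (intro sum_buckets) auto
    show ?thesis unfolding sum_subtractf 1 2 3 ..
  qed
  also have "\<dots> \<le> (\<Sum>b<r. \<bar>\<Sum>i | i \<in> I \<and> h i = b. y i\<bar>)" by (intro sum_mono bucket)
  finally show ?thesis
    using sB sum.subset_diff[OF BH fH, of "\<lambda>i. \<bar>y i\<bar>"] by linarith
qed

section \<open>The random matrix\<close>

lemma log2_bounds:
  assumes "1 \<le> (x::real)"
  shows "ln x \<le> log 2 x" "log 2 x \<le> 2 * ln x"
proof -
  have l: "0 \<le> ln x" using assms by simp
  have two: "1 / 2 \<le> ln (2::real)" "ln (2::real) \<le> 1" using ln2_ge_two_thirds ln_le_minus_one[of "2::real"] by auto
  have "ln x * ln 2 \<le> ln x * 1" "ln x * 1 \<le> ln x * (2 * ln 2)" using l two by (intro mult_left_mono; simp)+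
  then show "ln x \<le> log 2 x" "log 2 x \<le> 2 * ln x" by (simp_all add: log_def field_simps)
qed

text \<open>Numerical demands on \<delta>, with 1/100 as the mass threshold and
  \<open>10 ^ 8 * \<delta> ^ 64\<close> as the number of buckets. After
  \<open>8 \<le> \<delta>\<close> they concern, in order: the soft maximum of the medium rows, the
  two bucket loads, the failure probability for medium rows, the union bound over the net, the upper
  constant, the mean needed for light rows, and the lower bounds for light and for medium
  rows.\<close>

definition large :: "real \<Rightarrow> bool" where
  "large \<delta> \<longleftrightarrow> 8 \<le> \<delta> \<and> ln (4 * \<delta> ^ 66 + 1) + 3 \<le> \<delta> \<and>
     10 ^ 8 * \<delta> ^ 64 * exp (- (\<delta>\<^sup>2 / 16)) \<le> 1 / 1000 \<and>
     10 ^ 8 * \<delta> ^ 64 * exp (1 - 112 * ln \<delta>) \<le> 1 / 1000 \<and>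
     1024 / ((log 2 \<delta> - 1) * (1/100)) \<le> 1 / 1000 \<and>
     exp (\<delta> ^ 32 * ln (4 * \<delta> ^ 128 + 1) - \<delta> ^ 33) \<le> 1 / 1000 \<and>
     63 * (log 2 (1000 * \<delta> ^ 64) + 1) + 1500 * 10 ^ 8 \<le> 10 ^ 12 * (32 * ln \<delta>) \<and>
     5 \<le> (log 2 (\<delta> / 4) - 1) / 256 * (1 / 100 / 4) \<and>
     1 / 10 ^ 7 * (32 * ln \<delta>) \<le> (log 2 (\<delta> / 4) - 1) / 512 * (1 / 100 / 4) - 2 * (10 ^ 12 * (32 * ln \<delta>) * \<delta> ^ 32) / \<delta> ^ 64 \<and>
     1 / 10 ^ 7 * (32 * ln \<delta>) \<le> (log 2 \<delta> - 1) * (1 / 100) / 256"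

lemma eventually_large: "eventually large at_top"
  unfolding large_def
proof (intro eventually_conj)
  show "eventually (\<lambda>\<delta>::real. 8 \<le> \<delta>) at_top" by (rule eventually_ge_at_top)
  show "eventually (\<lambda>\<delta>::real. ln (4 * \<delta> ^ 66 + 1) + 3 \<le> \<delta>) at_top" by real_asymp
  show "eventually (\<lambda>\<delta>::real. 10 ^ 8 * \<delta> ^ 64 * exp (- (\<delta>\<^sup>2 / 16)) \<le> 1 / 1000) at_top" by real_asymp
  show "eventually (\<lambda>\<delta>::real. 10 ^ 8 * \<delta> ^ 64 * exp (1 - 112 * ln \<delta>) \<le> 1 / 1000) at_top" by real_asymp
  show "eventually (\<lambda>\<delta>::real. 1024 / ((log 2 \<delta> - 1) * (1/100)) \<le> 1 / 1000) at_top" by real_asymp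
  show "eventually (\<lambda>\<delta>::real. exp (\<delta> ^ 32 * ln (4 * \<delta> ^ 128 + 1) - \<delta> ^ 33) \<le> 1 / 1000) at_top" by real_asymp
  show "eventually (\<lambda>\<delta>::real. 5 \<le> (log 2 (\<delta> / 4) - 1) / 256 * (1 / 100 / 4)) at_top" by real_asymp
  have "eventually (\<lambda>\<delta>::real. 63 * (2 * ln (1000 * \<delta> ^ 64) + 1) + 1500 * 10 ^ 8 \<le> 10 ^ 12 * (32 * ln \<delta>)) at_top" by real_asymp
  moreover have "eventually (\<lambda>\<delta>::real. 1 \<le> 1000 * \<delta> ^ 64) at_top" by real_asymp
  ultimately show "eventually (\<lambda>\<delta>::real. 63 * (log 2 (1000 * \<delta> ^ 64) + 1) + 1500 * 10 ^ 8 \<le> 10 ^ 12 * (32 * ln \<delta>)) at_top"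
  proof eventually_elim
    case (elim \<delta>)
    show ?case
      by (rule order_trans[OF add_right_mono[OF mult_left_mono[OF add_right_mono[OF log2_bounds(2)[OF elim(2)]]]] elim(1)]) simp
  qed
  have "eventually (\<lambda>\<delta>::real. 1 / 10 ^ 7 * (32 * ln \<delta>) \<le> (ln (\<delta> / 4) - 1) / 512 * (1 / 100 / 4) - 2 * (10 ^ 12 * (32 * ln \<delta>) * \<delta> ^ 32) / \<delta> ^ 64) at_top" by real_asymp
  moreover have "eventually (\<lambda>\<delta>::real. 1 \<le> \<delta> / 4) at_top" by real_asymp
  ultimately show "eventually (\<lambda>\<delta>::real. 1 / 10 ^ 7 * (32 * ln \<delta>) \<le> (log 2 (\<delta> / 4) - 1) / 512 * (1 / 100 / 4) - 2 * (10 ^ 12 * (32 * ln \<delta>) * \<delta> ^ 32) / \<delta> ^ 64) at_top"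
  proof eventually_elim
    case (elim \<delta>)
    show ?case
      by (rule order_trans[OF elim(1)]) (intro diff_right_mono mult_right_mono divide_right_mono log2_bounds(1)[OF elim(2)]; simp)
  qed
  have "eventually (\<lambda>\<delta>::real. 1 / 10 ^ 7 * (32 * ln \<delta>) \<le> (ln \<delta> - 1) * (1 / 100) / 256) at_top" by real_asymp
  moreover have "eventually (\<lambda>\<delta>::real. 1 \<le> \<delta>) at_top" by real_asymp
  ultimately show "eventually (\<lambda>\<delta>::real. 1 / 10 ^ 7 * (32 * ln \<delta>) \<le> (log 2 \<delta> - 1) * (1 / 100) / 256) at_top"
  proof eventually_elim
    case (elim \<delta>)
    show ?case
      by (rule order_trans[OF elim(1)]) (intro diff_right_mono mult_right_mono divide_right_mono log2_bounds(1)[OF elim(2)]; simp)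
  qed
qed

section \<open>The sketching matrix and its probability space\<close>

definition sketch :: "nat \<Rightarrow> nat \<Rightarrow> real \<Rightarrow> (nat \<Rightarrow> nat) \<Rightarrow> (nat \<Rightarrow> nat) \<Rightarrow> (nat \<Rightarrow> real) \<Rightarrow> nat \<Rightarrow> nat \<Rightarrow> real" where
  "sketch n r c h1 h2 X = (\<lambda>i j. if j < n then
     if i < r then if h1 j = i then c else 0
     else if i < 2 * r \<and> h2 j = i - r then X j else 0 else 0)"

lemma sketch_sparse: "sparse_rn_matrix (2 * r) n (sketch n r c h1 h2 X)"
  unfolding sparse_rn_matrix_def
proof (intro conjI allI impI)
  fix j
  have "{i. i < 2 * r \<and> sketch n r c h1 h2 X i j \<noteq> 0} \<subseteq> {h1 j, r + h2 j}"
    by (auto simp: sketch_def split: if_splits)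
  then have "card {i. i < 2 * r \<and> sketch n r c h1 h2 X i j \<noteq> 0} \<le> card {h1 j, r + h2 j}"
    by (intro card_mono) auto
  also have "\<dots> \<le> 2" by (auto simp: card_insert_if)
  finally show "card {i. i < 2 * r \<and> sketch n r c h1 h2 X i j \<noteq> 0} \<le> 2" .
qed (auto simp: sketch_def)

lemma sum_lessThan_add: "(\<Sum>i<a + b. f i) = (\<Sum>i<a. f i) + (\<Sum>i<b. f (a + i :: nat) :: real)"
  by (induction b) (auto simp: add.assoc)

lemma sketch_l1:
  assumes I: "I \<subseteq> {..<n}" and y: "\<And>i. i < n \<Longrightarrow> i \<notin> I \<Longrightarrow> y i = 0" and c: "0 \<le> c"
  shows "l1norm (2 * r) (mat_vec n (sketch n r c h1 h2 X) y) =
     c * (\<Sum>b<r. \<bar>\<Sum>i | i \<in> I \<and> h1 i = b. y i\<bar>) + (\<Sum>b<r. \<bar>\<Sum>i | i \<in> I \<and> h2 i = b. X i * y i\<bar>)"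
proof -
  have s: "(\<Sum>j<n. (if h j = b then f j else 0) * y j) = (\<Sum>i | i \<in> I \<and> h i = b. f i * y i)" for h :: "nat \<Rightarrow> nat" and b f
  proof -
    have "(\<Sum>i | i \<in> I \<and> h i = b. f i * y i) = (\<Sum>j\<in>{i \<in> I. h i = b}. (if h j = b then f j else 0) * y j)"
      by (intro sum.cong) auto
    also have "\<dots> = (\<Sum>j<n. (if h j = b then f j else 0) * y j)"
      using I y by (intro sum.mono_neutral_left) auto
    finally show ?thesis by simp
  qed
  have a: "mat_vec n (sketch n r c h1 h2 X) y b = c * (\<Sum>i | i \<in> I \<and> h1 i = b. y i)" if "b < r" for b
  proof -
    have "mat_vec n (sketch n r c h1 h2 X) y b = (\<Sum>j<n. (if h1 j = b then c else 0) * y j)"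
      unfolding mat_vec_def using that by (intro sum.cong) (auto simp: sketch_def)
    then show ?thesis unfolding s by (simp add: sum_distrib_left)
  qed
  have b: "mat_vec n (sketch n r c h1 h2 X) y (r + b) = (\<Sum>i | i \<in> I \<and> h2 i = b. X i * y i)" if "b < r" for b
  proof -
    have "mat_vec n (sketch n r c h1 h2 X) y (r + b) = (\<Sum>j<n. (if h2 j = b then X j else 0) * y j)"
      unfolding mat_vec_def using that by (intro sum.cong) (auto simp: sketch_def)
    then show ?thesis unfolding s .
  qed
  have "(\<Sum>b<r. \<bar>mat_vec n (sketch n r c h1 h2 X) y b\<bar>) = c * (\<Sum>b<r. \<bar>\<Sum>i | i \<in> I \<and> h1 i = b. y i\<bar>)"
    unfolding sum_distrib_left[of c "\<lambda>b. \<bar>\<Sum>i | i \<in> I \<and> h1 i = b. y i\<bar>"]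
    by (intro sum.cong refl) (simp only: a lessThan_iff abs_mult abs_of_nonneg[OF c])
  moreover have "(\<Sum>b<r. \<bar>mat_vec n (sketch n r c h1 h2 X) y (r + b)\<bar>) = (\<Sum>b<r. \<bar>\<Sum>i | i \<in> I \<and> h2 i = b. X i * y i\<bar>)"
    by (intro sum.cong refl) (simp only: b lessThan_iff)
  ultimately show ?thesis unfolding l1norm_def mult_2 sum_lessThan_add by (simp only:)
qed

text \<open>With the power set as sigma-algebra on the finite image every event is measurable, and
  its probability is a finite expectation.\<close>

lemma finite_prob_image:
  assumes F: "fin_prob S p"
  shows "\<exists>M. prob_space M \<and> space M = f ` S \<and> sets M = Pow (f ` S) \<and>
    (\<forall>P. measure M {m \<in> f ` S. P m} = expect S p (\<lambda>a. of_bool (P (f a))))"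
proof -
  define N where "N = point_measure S (\<lambda>a. ennreal (p a))"
  define M where "M = distr N (count_space (f ` S)) f"
  have fin: "finite S" and p0: "\<And>a. a \<in> S \<Longrightarrow> 0 \<le> p a" and p1: "sum p S = 1" using F by (auto simp: fin_prob_def)
  have emN: "emeasure N T = ennreal (\<Sum>a\<in>T. p a)" if "T \<subseteq> S" for T
  proof -
    have "emeasure N T = (\<Sum>a\<in>T. ennreal (p a))" unfolding N_def by (rule emeasure_point_measure_finite[OF fin that])
    also have "\<dots> = ennreal (\<Sum>a\<in>T. p a)" using that p0 by (intro sum_ennreal) auto
    finally show ?thesis .
  qed
  have sN: "space N = S" "sets N = Pow S" by (simp_all add: N_def space_point_measure sets_point_measure)
  have "prob_space N" by (rule prob_spaceI) (simp add: sN emN p1)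
  moreover have meas: "f \<in> measurable N (count_space (f ` S))" by (auto simp: measurable_def sN)
  ultimately have "prob_space M" unfolding M_def by (rule prob_space.prob_space_distr)
  moreover have "measure M {m \<in> f ` S. P m} = expect S p (\<lambda>a. of_bool (P (f a)))" for P
  proof -
    have "measure M {m \<in> f ` S. P m} = measure N (f -` {m \<in> f ` S. P m} \<inter> space N)"
      unfolding M_def using meas by (intro measure_distr) auto
    also have "f -` {m \<in> f ` S. P m} \<inter> space N = {a \<in> S. P (f a)}" by (auto simp: sN)
    also have "measure N {a \<in> S. P (f a)} = (\<Sum>a | a \<in> S \<and> P (f a). p a)"
      by (subst measure_def, subst emN) (auto intro!: enn2real_ennreal sum_nonneg p0)
    also have "\<dots> = expect S p (\<lambda>a. of_bool (P (f a)))"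
      unfolding expect_def by (subst sum.inter_filter[OF fin]) (auto intro!: sum.cong)
    finally show ?thesis .
  qed
  ultimately show ?thesis by (intro exI[of _ M]) (auto simp: M_def)
qed

section \<open>Assembling the embedding\<close>

definition embeds :: "nat \<Rightarrow> nat \<Rightarrow> nat \<Rightarrow> real \<Rightarrow> real \<Rightarrow> bool" where
  "embeds d n r lo hi \<longleftrightarrow> (\<exists>M. prob_space M \<and> (\<forall>P\<in>space M. sparse_rn_matrix r n P) \<and>
     (\<forall>A. \<exists>E\<in>sets M. measure M E \<ge> 0.99 \<and> (\<forall>P\<in>E. \<forall>x.
        lo * l1norm n (mat_vec d A x) \<le> l1norm r (mat_vec n P (mat_vec d A x)) \<and>
        l1norm r (mat_vec n P (mat_vec d A x)) \<le> hi * l1norm n (mat_vec d A x))))"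

lemma l1norm_nonneg: "0 \<le> l1norm n y"
  by (simp add: l1norm_def sum_nonneg)

lemma embeds_mono: "embeds d n r lo hi \<Longrightarrow> lo' \<le> lo \<Longrightarrow> hi \<le> hi' \<Longrightarrow> embeds d n r lo' hi'"
  unfolding embeds_def by (meson l1norm_nonneg mult_right_mono order_trans)

lemma embeds_fewer_columns:
  assumes "embeds D n r lo hi" "d \<le> D"
  shows "embeds d n r lo hi"
proof -
  have pad: "mat_vec d A x = mat_vec D (\<lambda>i j. if j < d then A i j else 0) x" for A x
  proof
    fix i
    have "(\<Sum>j<D. (if j < d then A i j else 0) * x j) = (\<Sum>j<d. (if j < d then A i j else 0) * x j)"
      using assms(2) by (intro sum.mono_neutral_right) auto
    then show "mat_vec d A x i = mat_vec D (\<lambda>i j. if j < d then A i j else 0) x i" by (simp add: mat_vec_def)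
  qed
  obtain M where M: "prob_space M" "\<forall>P\<in>space M. sparse_rn_matrix r n P"
    "\<And>A. \<exists>E\<in>sets M. measure M E \<ge> 0.99 \<and> (\<forall>P\<in>E. \<forall>x.
        lo * l1norm n (mat_vec D A x) \<le> l1norm r (mat_vec n P (mat_vec D A x)) \<and>
        l1norm r (mat_vec n P (mat_vec D A x)) \<le> hi * l1norm n (mat_vec D A x))"
    using assms(1) unfolding embeds_def by blast
  show ?thesis unfolding embeds_def pad using M by blast
qed

text \<open>Six events are excluded: the upper bound fails with probability at most 3/1000 and each
  of the other five with probability at most 1/1000, within the budget of 1/100.\<close>

lemma embeds_large:
  fixes \<delta> :: real
  assumes "large \<delta>" and d: "real d = \<delta> ^ 32"
  shows "embeds d n (2 * (10 ^ 8 * d ^ 2)) (1 / 10 ^ 7 * ln (real d)) (2 * 10 ^ 12 * real d * ln (real d))"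
proof -
  have \<delta>: "8 \<le> \<delta>" and b2: "ln (4 * \<delta> ^ 66 + 1) + 3 \<le> \<delta>"
    and b3: "10 ^ 8 * \<delta> ^ 64 * exp (- (\<delta>\<^sup>2 / 16)) \<le> 1 / 1000"
    and b4: "10 ^ 8 * \<delta> ^ 64 * exp (1 - 112 * ln \<delta>) \<le> 1 / 1000"
    and b5: "1024 / ((log 2 \<delta> - 1) * (1/100)) \<le> 1 / 1000"
    and b6: "exp (\<delta> ^ 32 * ln (4 * \<delta> ^ 128 + 1) - \<delta> ^ 33) \<le> 1 / 1000"
    and b7: "63 * (log 2 (1000 * \<delta> ^ 64) + 1) + 1500 * 10 ^ 8 \<le> 10 ^ 12 * (32 * ln \<delta>)"
    and b8: "5 \<le> (log 2 (\<delta> / 4) - 1) / 256 * (1 / 100 / 4)"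
    and b9: "1 / 10 ^ 7 * (32 * ln \<delta>) \<le> (log 2 (\<delta> / 4) - 1) / 512 * (1 / 100 / 4) - 2 * (10 ^ 12 * (32 * ln \<delta>) * \<delta> ^ 32) / \<delta> ^ 64"
    and b10: "1 / 10 ^ 7 * (32 * ln \<delta>) \<le> (log 2 \<delta> - 1) * (1 / 100) / 256"
    using assms(1) unfolding large_def by blast+
  have \<delta>0: "0 < \<delta>" and \<delta>1: "1 \<le> \<delta>" using \<delta> by linarith+
  have lnd: "ln (real d) = 32 * ln \<delta>" using \<delta>0 by (simp add: d ln_realpow)
  have ln\<delta>: "0 \<le> ln \<delta>" using \<delta>1 by simp
  have p64: "\<delta> ^ 64 = (\<delta> ^ 32)\<^sup>2" by (simp flip: power_mult)
  have d2: "(real d)\<^sup>2 = \<delta> ^ 64" unfolding d p64 ..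
  have d1: "1 \<le> real d" unfolding d using \<delta>1 by (rule one_le_power)
  then have d1': "1 \<le> d" by simp
  define r where "r = 10 ^ 8 * d ^ 2"
  have r: "real r = 10 ^ 8 * \<delta> ^ 64" by (simp add: r_def d2)
  have r0: "0 < r" using d1' by (simp add: r_def)
  define N where "N = {..<n}"
  have N: "finite N" by (simp add: N_def)
  \<comment> \<open>The term \<open>\<delta> ^ 3\<close> provides all scales used for medium rows.
    The term \<open>400 * n\<close> makes the discarded small coordinates of light rows sum to at
    most 1/400.\<close>
  obtain Q where Q: "\<delta> ^ 3 + 400 * real n < 2 ^ Q" using real_arch_pow[of 2 "\<delta> ^ 3 + 400 * real n"] by auto
  let ?H = "PiE N (\<lambda>_. {..<r})" and ?X = "rowspace N Q"
  note FH = fin_prob_H[OF N r0] and FX = fin_prob_X[OF N, of Q]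
  define \<Omega> where "\<Omega> = ?H \<times> (?H \<times> ?X)"
  define \<mu> where "\<mu> = (\<lambda>(a :: nat \<Rightarrow> nat, b). wprod N (\<lambda>_. 1 / real r) a * (\<lambda>(b :: nat \<Rightarrow> nat, c). wprod N (\<lambda>_. 1 / real r) b * wprod N (dyadic_wt Q) c) b)"
  have F\<Omega>: "fin_prob \<Omega> \<mu>" unfolding \<Omega>_def \<mu>_def by (intro fin_prob_Times FH FX)
  have expect\<Omega>: "expect \<Omega> \<mu> f = expectH N r (\<lambda>h1. expectH N r (\<lambda>h2. expectX N Q (\<lambda>X. f (h1, h2, X))))" for f
    unfolding \<Omega>_def \<mu>_def expect_Times ..
  define sk where "sk = (\<lambda>(h1, h2, X). sketch n r (ln (real d)) h1 h2 X)"
  obtain Ms where Ms: "prob_space Ms" "space Ms = sk ` \<Omega>" "sets Ms = Pow (sk ` \<Omega>)"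
    "\<And>P. measure Ms {m \<in> sk ` \<Omega>. P m} = expect \<Omega> \<mu> (\<lambda>a. of_bool (P (sk a)))"
    using finite_prob_image[OF F\<Omega>, of sk] by auto
  have event: "\<exists>E\<in>sets Ms. measure Ms E \<ge> 0.99 \<and> (\<forall>P\<in>E. \<forall>x.
        1 / 10 ^ 7 * ln (real d) * l1norm n (mat_vec d A x) \<le> l1norm (2 * r) (mat_vec n P (mat_vec d A x)) \<and>
        l1norm (2 * r) (mat_vec n P (mat_vec d A x)) \<le> 2 * 10 ^ 12 * real d * ln (real d) * l1norm n (mat_vec d A x))" for A
  proof -
    define Y where "Y = range (mat_vec d A)"
    \<comment> \<open>Rows on which the whole column space vanishes carry no mass and have no
      positive Lewis weight.\<close>
    define I where "I = {i \<in> N. \<exists>y\<in>Y. y i \<noteq> 0}"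
    have IN: "I \<subseteq> N" by (auto simp: I_def)
    have fI: "finite I" using IN N finite_subset by blast
    have nzI: "\<exists>y\<in>range (mat_vec d A). y i \<noteq> 0" if "i \<in> I" for i using that by (auto simp: I_def Y_def)
    obtain w e where L: "lewis_upto I d A 2 w e"
      by (rule approx_lewis_weights[OF fI, of d A]) (use nzI in blast)+
    define M where "M = {i \<in> I. 1 / \<delta> ^ 34 \<le> w i}"
    have MI: "M \<subseteq> I" by (auto simp: M_def)
    have fM: "finite M" using MI fI finite_subset by blast
    have MN: "M \<subseteq> N" using MI IN by blast
    obtain w' e' where L': "lewis_upto M d A 2 w' e'"
      by (rule approx_lewis_weights[OF fM, of d A]) (use MI nzI in blast)+
    define H where "H = {i \<in> M. 1 / \<delta> ^ 5 \<le> w' i}"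
    define J where "J = I - M"
    have HM: "H \<subseteq> M" and JI: "J \<subseteq> I" by (auto simp: H_def J_def)
    define P1 where "P1 = (\<lambda>h. 1/1000 \<le> (\<Sum>i\<in>collided H w' h. \<Sum>j\<in>collided H w' h. \<bar>ker d e' i j\<bar>))"
    define P2 where "P2 = (\<lambda>h::nat\<Rightarrow>nat. \<exists>b<r. \<delta>\<^sup>2 / 8 * (1 / \<delta> ^ 34) \<le> (\<Sum>i | i \<in> I \<and> h i = b. min (w i) (1 / \<delta> ^ 34)))"
    define P2' where "P2' = (\<lambda>h::nat\<Rightarrow>nat. \<exists>b<r. 7 * (1 / \<delta> ^ 5) \<le> (\<Sum>i | i \<in> M \<and> h i = b. min (w' i) (1 / \<delta> ^ 5)))"
    define P3 where "P3 = (\<lambda>h X. \<exists>y\<in>Y. (\<Sum>i\<in>I. \<bar>y i\<bar>) \<le> 1 \<and>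
       1/100 \<le> (\<Sum>i | i \<in> M \<and> w' i < 1 / \<delta> ^ 5. \<bar>y i\<bar>) \<and>
       (\<Sum>b<r. \<bar>\<Sum>i | i \<in> I \<and> h i = b. X i * y i\<bar>) \<le> (log 2 \<delta> - 1) * (1/100) / 256)"
    define U0 where "U0 = 63 * (log 2 (1000 * real d ^ 2) + 1) + 1500 * 10 ^ 8"
    define P4 where "P4 = (\<lambda>h X. \<exists>y\<in>Y. U0 * real d * (\<Sum>i\<in>I. \<bar>y i\<bar>) < (\<Sum>b<r. \<bar>\<Sum>i | i \<in> I \<and> h i = b. X i * y i\<bar>))"
    define P5 where "P5 = (\<lambda>h X. \<exists>k\<in>net d. net_bad I J d e r \<delta> (1/100) (\<lambda>i\<in>N. (h i, X i)) k)"
    have e1: "expectH N r (\<lambda>h. of_bool (P1 h)) \<le> 1/1000"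
    proof -
      have "expectH N r (\<lambda>h. of_bool (P1 h)) \<le> 24 / (10 ^ 8 * (1/1000))"
        unfolding P1_def by (rule heavy_event[OF N MN L' H_def d \<delta>1]) (auto simp: r)
      then show ?thesis by simp
    qed
    have e2: "expectH N r (\<lambda>h. of_bool (P2 h)) \<le> 1/1000"
    proof -
\<comment> \<open>In units of \<open>1 / \<delta> ^ 34\<close> the average load is a small multiple
  of \<open>\<delta> ^ 2\<close>, so rate 1 suffices to exclude
  \<open>\<delta> ^ 2 / 8\<close>.\<close>
have le: "2 * real d / (1 / \<delta> ^ 34) * (exp 1 - 1) / real r \<le> \<delta>\<^sup>2 / 16"
      proof -
        have p: "\<delta> ^ 32 * \<delta> ^ 34 = \<delta>\<^sup>2 * \<delta> ^ 64" by (simp flip: power_add)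
        have "2 * real d / (1 / \<delta> ^ 34) * (exp 1 - 1) / real r = 2 * (\<delta> ^ 32 * \<delta> ^ 34) * (exp 1 - 1) / (10 ^ 8 * \<delta> ^ 64)"
          by (simp add: d r)
        also have "\<dots> = \<delta>\<^sup>2 * (2 * (exp 1 - 1) / 10 ^ 8)"
        proof -
          have "2 * (u * v) * a / (10 ^ 8 * v) = u * (2 * a / 10 ^ 8)" if "0 < v" for u v a :: real using that by simp
          from this[OF zero_less_power[OF \<delta>0]] show ?thesis unfolding p .
        qed
        also have "\<dots> \<le> \<delta>\<^sup>2 * (1/16)" using exp_le by (intro mult_left_mono) auto
        finally show ?thesis by simp
      qed
      have "expectH N r (\<lambda>h. of_bool (P2 h)) \<le> real r * exp (2 * real d / (1 / \<delta> ^ 34) * (exp 1 - 1) / real r - 1 * (\<delta>\<^sup>2 / 8))"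
        unfolding P2_def
      proof (rule hash_load[OF N IN r0])
        show "0 \<le> min (w i) (1 / \<delta> ^ 34) \<and> min (w i) (1 / \<delta> ^ 34) \<le> 1 / \<delta> ^ 34" if "i \<in> I" for i
          using lewis_pos[OF fI L that] \<delta>0 by (simp add: less_imp_le)
        have "(\<Sum>i\<in>I. min (w i) (1 / \<delta> ^ 34)) \<le> (\<Sum>i\<in>I. w i)" by (intro sum_mono) auto
        then show "(\<Sum>i\<in>I. min (w i) (1 / \<delta> ^ 34)) \<le> 2 * real d" using lewis_sum[OF fI L] by linarith
      qed (use \<delta>0 in auto)
      also have "\<dots> \<le> real r * exp (\<delta>\<^sup>2 / 16 - 1 * (\<delta>\<^sup>2 / 8))" using le by (intro mult_left_mono) auto
      also have "\<dots> \<le> 1/1000" using b3 by (simp add: r)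
      finally show ?thesis .
    qed
    have e2': "expectH N r (\<lambda>h. of_bool (P2' h)) \<le> 1/1000"
    proof -
      \<comment> \<open>The rate \<open>16 * ln \<delta>\<close> has
        \<open>exp (16 * ln \<delta>) = \<delta> ^ 16\<close>, and
        \<open>\<delta> ^ (32 + 5 + 16)\<close> stays below \<open>r\<close>. Seven units then give
        the factor \<open>\<delta> ^ (- 112)\<close>, which beats the
        \<open>10 ^ 8 * \<delta> ^ 64\<close> buckets.\<close>
      have le: "2 * real d / (1 / \<delta> ^ 5) * (exp (16 * ln \<delta>) - 1) / real r \<le> 1"
      proof -
        have q: "exp (16 * ln \<delta>) = \<delta> ^ 16"
        proof -
          have "16 * ln \<delta> = ln (\<delta> ^ 16)" using \<delta>0 by (simp add: ln_realpow)
          then show ?thesis using \<delta>0 by simp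
        qed
        have "2 * real d / (1 / \<delta> ^ 5) * (exp (16 * ln \<delta>) - 1) / real r \<le> 2 * (\<delta> ^ 32 * \<delta> ^ 5) * \<delta> ^ 16 / (10 ^ 8 * \<delta> ^ 64)"
          unfolding q d r using \<delta>0 one_le_power[OF \<delta>1, of 16] by (intro divide_right_mono mult_mono) auto
        also have "\<dots> \<le> 2 * \<delta> ^ 64 / (10 ^ 8 * \<delta> ^ 64)"
        proof -
          have "\<delta> ^ 32 * \<delta> ^ 5 * \<delta> ^ 16 \<le> \<delta> ^ 64" using \<delta>1 by (simp add: power_increasing flip: power_add)
          then show ?thesis using \<delta>0 by (intro divide_right_mono) auto
        qed
        also have "\<dots> \<le> 1" using \<delta>0 by simp
        finally show ?thesis .
      qed
      have "expectH N r (\<lambda>h. of_bool (P2' h)) \<le> real r * exp (2 * real d / (1 / \<delta> ^ 5) * (exp (16 * ln \<delta>) - 1) / real r - 16 * ln \<delta> * 7)"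
        unfolding P2'_def
      proof (rule hash_load[OF N MN r0])
        show "0 \<le> min (w' i) (1 / \<delta> ^ 5) \<and> min (w' i) (1 / \<delta> ^ 5) \<le> 1 / \<delta> ^ 5" if "i \<in> M" for i
          using lewis_pos[OF fM L' that] \<delta>0 by (simp add: less_imp_le)
        have "(\<Sum>i\<in>M. min (w' i) (1 / \<delta> ^ 5)) \<le> (\<Sum>i\<in>M. w' i)" by (intro sum_mono) auto
        then show "(\<Sum>i\<in>M. min (w' i) (1 / \<delta> ^ 5)) \<le> 2 * real d" using lewis_sum[OF fM L'] by linarith
      qed (use \<delta>0 ln\<delta> in auto)
      also have "\<dots> \<le> real r * exp (1 - 16 * ln \<delta> * 7)" using le by (intro mult_left_mono) auto
      also have "\<dots> \<le> 1/1000" using b4 by (simp add: r mult.commute)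
      finally show ?thesis .
    qed
    \<comment> \<open>The load conditions are part of the event, so that its bound holds for every
      bucket function and can be averaged over all of them.\<close>
    have e3: "expectX N Q (\<lambda>X. of_bool (\<not> P2 h \<and> \<not> P2' h \<and> P3 h X)) \<le> 1/1000" if h: "h \<in> ?H" for h
    proof (cases "\<not> P2 h \<and> \<not> P2' h")
      case True
      have hr: "h i < r" if "i \<in> N" for i using h that by (auto simp: PiE_iff)
      have e32: "\<delta>\<^sup>2 / 8 * (1 / \<delta> ^ 34) = 1 / (8 * real d)"
      proof -
        have p: "\<delta> ^ 34 = \<delta>\<^sup>2 * \<delta> ^ 32" by (simp flip: power_add)
        have "u / 8 * (1 / (u * v)) = 1 / (8 * v)" if "0 < u" for u v :: real using that by simp
        from this[OF zero_less_power[OF \<delta>0]] show ?thesis unfolding p d .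
      qed
      have "expectX N Q (\<lambda>X. of_bool (P3 h X)) \<le> 1024 / ((log 2 \<delta> - 1) * (1/100))"
        unfolding P3_def Y_def
      proof (rule medium_event[OF N IN L M_def L' d _ b2])
        show "(\<Sum>i | i \<in> I \<and> h i = b. min (w i) (1 / \<delta> ^ 34)) \<le> 1 / (8 * real d)" if "b < r" for b
          using True that e32 by (auto simp: P2_def not_le less_imp_le)
        show "(\<Sum>i | i \<in> M \<and> h i = b. min (w' i) (1 / \<delta> ^ 5)) \<le> 7 * (1 / \<delta> ^ 5)" if "b < r" for b
          using True that by (auto simp: P2'_def not_le less_imp_le)
        show "\<delta> ^ 3 \<le> 2 ^ Q" using Q by linarith
      qed (use \<delta> hr in auto)
      then show ?thesis using True b5 by simp
    next
      case False
      then have "expectX N Q (\<lambda>X. of_bool (\<not> P2 h \<and> \<not> P2' h \<and> P3 h X)) = expectX N Q (\<lambda>X. 0)" by (intro expect_cong) auto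
      then show ?thesis unfolding expect_const[OF FX] by simp
    qed
    have e4: "expectX N Q (\<lambda>X. of_bool (P4 h X)) \<le> 3/1000" if h: "h \<in> ?H" for h
      unfolding P4_def U0_def Y_def
    proof (rule upper_event[OF N IN L d1'])
      show "real r \<le> 10 ^ 8 * real d ^ 2" by (simp add: r d2)
      show "h i < r" if "i \<in> I" for i using h that IN by (auto simp: PiE_iff)
    qed simp
    have e5: "expectH N r (\<lambda>h. expectX N Q (\<lambda>X. of_bool (P5 h X))) \<le> 1/1000"
    proof -
      have "expectH N r (\<lambda>h. expectX N Q (\<lambda>X. of_bool (P5 h X))) = expectT N r Q (\<lambda>g. of_bool (P5 (\<lambda>i\<in>N. fst (g i)) (\<lambda>i\<in>N. snd (g i))))"
        by (rule expect_PiE_pair[OF N, symmetric])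
      also have "\<dots> = expectT N r Q (\<lambda>g. of_bool (\<exists>k\<in>net d. net_bad I J d e r \<delta> (1/100) g k))"
      proof (rule expect_cong)
        fix g assume g: "g \<in> PiE N (\<lambda>_. pairs r Q)"
        have "(\<lambda>i\<in>N. ((\<lambda>i\<in>N. fst (g i)) i, (\<lambda>i\<in>N. snd (g i)) i)) = g"
          using g by (auto simp: fun_eq_iff restrict_def PiE_iff extensional_def)
        then show "of_bool (P5 (\<lambda>i\<in>N. fst (g i)) (\<lambda>i\<in>N. snd (g i))) = of_bool (\<exists>k\<in>net d. net_bad I J d e r \<delta> (1/100) g k)"
          unfolding P5_def by (simp only:)
      qed
      also have "\<dots> \<le> (4 * real d ^ 4 + 1) ^ d * exp (- (\<delta> ^ 33))"
      proof (rule net_event[OF N IN L JI _ \<delta> _ _ b8])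
        show "w i \<le> 1 / \<delta> ^ 34" if "i \<in> J" for i using that by (auto simp: J_def M_def)
        show "\<delta> ^ 64 \<le> real r" using \<delta>0 by (simp add: r)
        have "card I \<le> card N" using IN N by (intro card_mono)
        then have cI: "real (card I) \<le> real n" by (simp add: N_def)
        have "real (card I) * (1 / \<delta> ^ 33 / 2 ^ Q) \<le> real n * (1 / 1 / 2 ^ Q)"
          using cI \<delta>1 by (intro mult_mono divide_right_mono divide_left_mono) auto
        also have "\<dots> \<le> 1 / 100 / 4"
        proof -
          have "0 \<le> \<delta> ^ 3" using \<delta>0 by simp
          then have "400 * real n \<le> 2 ^ Q" using Q by linarith
          then show ?thesis by (simp add: field_simps)
        qed
        finally show "real (card I) * (1 / \<delta> ^ 33 / 2 ^ Q) \<le> 1 / 100 / 4" .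
      qed
      also have "\<dots> = exp (\<delta> ^ 32 * ln (4 * \<delta> ^ 128 + 1) - \<delta> ^ 33)"
      proof -
        have x: "4 * real d ^ 4 + 1 = 4 * \<delta> ^ 128 + 1" by (simp add: d flip: power_mult)
        have "0 < 4 * \<delta> ^ 128 + 1" using \<delta>0 by (intro add_pos_pos) auto
        then have "(4 * \<delta> ^ 128 + 1) ^ d = exp (real d * ln (4 * \<delta> ^ 128 + 1))" by (simp add: exp_of_nat_mult)
        then show ?thesis unfolding x by (simp add: d exp_diff exp_minus field_simps)
      qed
      also have "\<dots> \<le> 1/1000" by (rule b6)
      finally show ?thesis .
    qed
    have U0: "U0 \<le> 10 ^ 12 * ln (real d)" using b7 unfolding U0_def d2 lnd .
    define T where "T = (\<lambda>h1 h2 X y. ln (real d) * (\<Sum>b<r. \<bar>\<Sum>i | i \<in> I \<and> h1 i = b. y i\<bar>) + (\<Sum>b<r. \<bar>\<Sum>i | i \<in> I \<and> h2 i = b. X i * y i\<bar>))" for h1 h2 :: "nat \<Rightarrow> nat" and X y :: "nat \<Rightarrow> real"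
    have yI: "y i = 0" if "y \<in> Y" "i < n" "i \<notin> I" for y i using that by (auto simp: I_def N_def)
    have l1T: "l1norm (2 * r) (mat_vec n (sketch n r (ln (real d)) h1 h2 X) y) = T h1 h2 X y" if "y \<in> Y" for h1 h2 X y
      unfolding T_def using IN yI[OF that] d1 by (intro sketch_l1) (auto simp: N_def)
    have l1n: "l1norm n y = (\<Sum>i\<in>I. \<bar>y i\<bar>)" if "y \<in> Y" for y
      unfolding l1norm_def using IN yI[OF that] by (intro sum.mono_neutral_right) (auto simp: N_def)
    have up: "(\<Sum>b<r. \<bar>\<Sum>i | i \<in> I \<and> h i = b. X i * y i\<bar>) \<le> 10 ^ 12 * ln (real d) * real d * (\<Sum>i\<in>I. \<bar>y i\<bar>)"
      if "\<not> P4 h X" "y \<in> Y" for h X y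
    proof -
      have "(\<Sum>b<r. \<bar>\<Sum>i | i \<in> I \<and> h i = b. X i * y i\<bar>) \<le> U0 * real d * (\<Sum>i\<in>I. \<bar>y i\<bar>)"
        using that by (auto simp: P4_def not_less)
      also have "\<dots> \<le> 10 ^ 12 * ln (real d) * real d * (\<Sum>i\<in>I. \<bar>y i\<bar>)"
        using U0 by (intro mult_right_mono) (auto intro: sum_nonneg)
      finally show ?thesis .
    qed
    have upper: "T h1 h2 X y \<le> 2 * 10 ^ 12 * real d * ln (real d) * (\<Sum>i\<in>I. \<bar>y i\<bar>)"
      if h1: "h1 \<in> ?H" and X: "\<not> P4 h2 X" and y: "y \<in> Y" for h1 h2 X y
    proof -
      define s where "s = (\<Sum>i\<in>I. \<bar>y i\<bar>)"
      have s0: "0 \<le> s" by (simp add: s_def sum_nonneg)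
      have ld: "0 \<le> ln (real d)" using d1 by simp
      have "(\<Sum>b<r. \<bar>\<Sum>i | i \<in> I \<and> h1 i = b. y i\<bar>) \<le> (\<Sum>b<r. \<Sum>i | i \<in> I \<and> h1 i = b. \<bar>y i\<bar>)"
        by (intro sum_mono sum_abs)
      also have "\<dots> = s" unfolding s_def using h1 IN by (intro sum_buckets[OF fI]) (auto simp: PiE_iff)
      finally have "ln (real d) * (\<Sum>b<r. \<bar>\<Sum>i | i \<in> I \<and> h1 i = b. y i\<bar>) \<le> ln (real d) * s" using ld by (intro mult_left_mono)
      also have "\<dots> \<le> 10 ^ 12 * ln (real d) * real d * s"
      proof -
        have "1 * (ln (real d) * s) \<le> (10 ^ 12 * real d) * (ln (real d) * s)"
          using d1 ld s0 by (intro mult_right_mono mult_nonneg_nonneg) auto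
        then show ?thesis by (simp add: mult_ac)
      qed
      finally show ?thesis using up[OF X y] unfolding T_def s_def[symmetric] by (simp add: algebra_simps)
    qed
    have lower1: "1 / 10 ^ 7 * ln (real d) \<le> T h1 h2 X z"
      if h1: "h1 \<in> ?H" and ok: "\<not> P1 h1" "\<not> P3 h2 X" "\<not> P4 h2 X" "\<not> P5 h2 X" and z: "z \<in> Y" and z1: "(\<Sum>i\<in>I. \<bar>z i\<bar>) = 1" for h1 h2 X z
    proof -
      have ld: "0 \<le> ln (real d)" using d1 by simp
      define t1 t2 where "t1 = (\<Sum>b<r. \<bar>\<Sum>i | i \<in> I \<and> h1 i = b. z i\<bar>)" and "t2 = (\<Sum>b<r. \<bar>\<Sum>i | i \<in> I \<and> h2 i = b. X i * z i\<bar>)"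
      have T: "T h1 h2 X z = ln (real d) * t1 + t2" by (simp add: T_def t1_def t2_def)
      have t0: "0 \<le> t1" "0 \<le> t2" by (auto simp: t1_def t2_def intro: sum_nonneg)
      have lt1: "0 \<le> ln (real d) * t1" using ld t0 by simp
      consider (a) "1/100 \<le> (\<Sum>i\<in>J. \<bar>z i\<bar>)" | (c) "1/100 \<le> (\<Sum>i | i \<in> M \<and> w' i < 1 / \<delta> ^ 5. \<bar>z i\<bar>)"
        | (b) "(\<Sum>i\<in>J. \<bar>z i\<bar>) < 1/100" "(\<Sum>i | i \<in> M \<and> w' i < 1 / \<delta> ^ 5. \<bar>z i\<bar>) < 1/100" by linarith
      then show ?thesis
      proof cases
        case a
        have k: "2 / real d ^ 2 \<le> 1 / 100 / 2"
        proof -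
          have "8 ^ 64 \<le> \<delta> ^ 64" using \<delta> by (intro power_mono) auto
          then have "400 \<le> \<delta> ^ 64" by simp
          then show ?thesis unfolding d2 using \<delta>0 by (simp add: field_simps)
        qed
        have "(log 2 (\<delta> / 4) - 1) / 512 * (1 / 100 / 4) - 2 * (10 ^ 12 * ln (real d) * real d) / real d ^ 2 \<le> t2"
          unfolding t2_def
        proof (rule light_lower[OF fI L d1' JI _ IN])
          show "\<not> net_bad I J d e r \<delta> (1/100) (\<lambda>i\<in>N. (h2 i, X i)) k" if "k \<in> net d" for k using ok(4) that by (auto simp: P5_def)
          show "(\<Sum>b<r. \<bar>\<Sum>i | i \<in> I \<and> h2 i = b. X i * y i\<bar>) \<le> 10 ^ 12 * ln (real d) * real d * (\<Sum>i\<in>I. \<bar>y i\<bar>)"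
            if "y \<in> range (mat_vec d A)" for y using up[OF ok(3)] that by (simp add: Y_def)
          show "0 \<le> 10 ^ 12 * ln (real d) * real d" using ld by simp
          show "z \<in> range (mat_vec d A)" using z by (simp add: Y_def)
          show "2 / real d ^ 2 \<le> 1" using k by simp
        qed (use a z1 k in auto)
        moreover have "1 / 10 ^ 7 * ln (real d) \<le> (log 2 (\<delta> / 4) - 1) / 512 * (1 / 100 / 4) - 2 * (10 ^ 12 * ln (real d) * real d) / real d ^ 2"
          unfolding lnd d2 unfolding d by (rule b9)
        ultimately show ?thesis using lt1 unfolding T by linarith
      next
        case c
        then have "(log 2 \<delta> - 1) * (1/100) / 256 < t2" using ok(2) z z1 by (auto simp: P3_def t2_def not_le)
        then show ?thesis using lt1 b10 unfolding T lnd by linarith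
      next
        case b
        have hr: "h1 i < r" if "i \<in> I" for i using h1 that IN by (auto simp: PiE_iff)
        have "(\<Sum>i\<in>H. \<bar>z i\<bar>) - 2 * (sqrt 2 * (\<Sum>i\<in>M. \<bar>z i\<bar>) * sqrt (1/1000)) - (\<Sum>i\<in>I - H. \<bar>z i\<bar>) \<le> t1"
          unfolding t1_def
          by (rule heavy_lower[OF fI MI L' HM hr]) (use z ok(1) in \<open>auto simp: Y_def P1_def not_le less_imp_le\<close>)
        moreover have "(\<Sum>i\<in>I - H. \<bar>z i\<bar>) \<le> 2/100"
        proof -
          have "I - H = J \<union> {i \<in> M. w' i < 1 / \<delta> ^ 5}" using HM MI by (auto simp: J_def H_def not_le)
          then have "(\<Sum>i\<in>I - H. \<bar>z i\<bar>) = (\<Sum>i\<in>J. \<bar>z i\<bar>) + (\<Sum>i | i \<in> M \<and> w' i < 1 / \<delta> ^ 5. \<bar>z i\<bar>)"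
            using fI fM JI by (subst sum.union_disjoint[symmetric]) (auto simp: J_def)
          then show ?thesis using b by linarith
        qed
        moreover have "(\<Sum>i\<in>H. \<bar>z i\<bar>) + (\<Sum>i\<in>I - H. \<bar>z i\<bar>) = 1"
          using sum.subset_diff[OF order_trans[OF HM MI] fI, of "\<lambda>i. \<bar>z i\<bar>"] z1 by simp
        moreover have "2 * (sqrt 2 * (\<Sum>i\<in>M. \<bar>z i\<bar>) * sqrt (1/1000)) \<le> 1/10"
        proof -
          have "(\<Sum>i\<in>M. \<bar>z i\<bar>) \<le> 1" using sum_mono2[OF fI MI, of "\<lambda>i. \<bar>z i\<bar>"] z1 by simp
          then have "sqrt 2 * (\<Sum>i\<in>M. \<bar>z i\<bar>) * sqrt (1/1000) \<le> sqrt 2 * 1 * sqrt (1/1000)"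
            by (intro mult_right_mono mult_left_mono) auto
          also have "\<dots> = sqrt (2 * (1/1000))" by (simp only: real_sqrt_mult mult_1_right)
          also have "\<dots> \<le> 1/20" by (intro real_le_lsqrt) (auto simp: power2_eq_square)
          finally show ?thesis by simp
        qed
        \<comment> \<open>Heavy rows carry at least 98/100 of the mass; at most 1/10 is lost to
          collisions and 2/100 to the other rows.\<close>
        ultimately have "1/2 \<le> t1" by linarith
        then have "ln (real d) * (1/2) \<le> ln (real d) * t1" using ld by (intro mult_left_mono)
        then show ?thesis using t0 ld unfolding T by simp
      qed
    qed
    have lower: "1 / 10 ^ 7 * ln (real d) * (\<Sum>i\<in>I. \<bar>y i\<bar>) \<le> T h1 h2 X y"
      if h1: "h1 \<in> ?H" and ok: "\<not> P1 h1" "\<not> P3 h2 X" "\<not> P4 h2 X" "\<not> P5 h2 X" and y: "y \<in> Y" for h1 h2 X y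
    proof -
      define s where "s = (\<Sum>i\<in>I. \<bar>y i\<bar>)"
      have s0: "0 \<le> s" by (simp add: s_def sum_nonneg)
      show ?thesis
      proof (cases "s = 0")
        case True
        have "0 \<le> T h1 h2 X y" unfolding T_def using d1 by (intro add_nonneg_nonneg mult_nonneg_nonneg sum_nonneg) auto
        then show ?thesis using True by (simp add: s_def)
      next
        case False
        then have sp: "0 < s" using s0 by simp
        define z where "z = (\<lambda>i. 1 / s * y i)"
        have zY: "z \<in> Y" unfolding z_def Y_def using y by (intro range_mat_vec_scale) (simp add: Y_def)
        have "(\<Sum>i\<in>I. \<bar>z i\<bar>) = 1 / s * s" unfolding z_def s_def abs_mult sum_distrib_left using sp by (simp add: s_def)
        then have z1: "(\<Sum>i\<in>I. \<bar>z i\<bar>) = 1" using sp by simp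
        have Tz: "T h1 h2 X z = 1 / s * T h1 h2 X y"
        proof -
          have 1: "(\<Sum>i\<in>B. z i) = 1 / s * (\<Sum>i\<in>B. y i)" for B by (simp add: z_def sum_divide_distrib)
          have 2: "(\<Sum>i\<in>B. X i * z i) = 1 / s * (\<Sum>i\<in>B. X i * y i)" for B by (simp add: z_def sum_divide_distrib)
          have 3: "\<bar>1 / s * u\<bar> = 1 / s * \<bar>u\<bar>" for u using sp by (simp add: abs_mult)
          show ?thesis unfolding T_def 1 2 3 sum_distrib_left[symmetric] by (simp only: distrib_left mult.left_commute)
        qed
        have "s * (1 / 10 ^ 7 * ln (real d)) \<le> s * T h1 h2 X z" using lower1[OF h1 ok zY z1] s0 by (intro mult_left_mono)
        also have "\<dots> = T h1 h2 X y" unfolding Tz using sp by simp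
        finally show ?thesis by (simp add: s_def mult_ac)
      qed
    qed
    define good where "good = (\<lambda>P. \<forall>x. 1 / 10 ^ 7 * ln (real d) * l1norm n (mat_vec d A x) \<le> l1norm (2 * r) (mat_vec n P (mat_vec d A x)) \<and>
        l1norm (2 * r) (mat_vec n P (mat_vec d A x)) \<le> 2 * 10 ^ 12 * real d * ln (real d) * l1norm n (mat_vec d A x))"
    have goodI: "good (sk (h1, h2, X))" if "h1 \<in> ?H" "\<not> P1 h1" "\<not> P3 h2 X" "\<not> P4 h2 X" "\<not> P5 h2 X" for h1 h2 X
      unfolding good_def sk_def prod.case
    proof
      fix x
      have y: "mat_vec d A x \<in> Y" by (simp add: Y_def)
      show "1 / 10 ^ 7 * ln (real d) * l1norm n (mat_vec d A x) \<le> l1norm (2 * r) (mat_vec n (sketch n r (ln (real d)) h1 h2 X) (mat_vec d A x)) \<and>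
        l1norm (2 * r) (mat_vec n (sketch n r (ln (real d)) h1 h2 X) (mat_vec d A x)) \<le> 2 * 10 ^ 12 * real d * ln (real d) * l1norm n (mat_vec d A x)"
        unfolding l1T[OF y] l1n[OF y] using lower[OF that y] upper[OF that(1,4) y] by blast
    qed
    have "expect \<Omega> \<mu> (\<lambda>a. of_bool (\<not> good (sk a))) \<le>
       expectH N r (\<lambda>h1. expectH N r (\<lambda>h2. expectX N Q (\<lambda>X. of_bool (P1 h1) + (of_bool (P2 h2) + (of_bool (P2' h2) +
         (of_bool (\<not> P2 h2 \<and> \<not> P2' h2 \<and> P3 h2 X) + (of_bool (P4 h2 X) + of_bool (P5 h2 X))))))))"
      unfolding expect\<Omega>
    proof (intro expect_mono[OF FH] expect_mono[OF FX])
      fix h1 h2 X assume "h1 \<in> ?H"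
      then have "\<not> good (sk (h1, h2, X)) \<Longrightarrow> P1 h1 \<or> P2 h2 \<or> P2' h2 \<or> (\<not> P2 h2 \<and> \<not> P2' h2 \<and> P3 h2 X) \<or> P4 h2 X \<or> P5 h2 X"
        using goodI by blast
      then show "of_bool (\<not> good (sk (h1, h2, X))) \<le> of_bool (P1 h1) + (of_bool (P2 h2) + (of_bool (P2' h2) +
         (of_bool (\<not> P2 h2 \<and> \<not> P2' h2 \<and> P3 h2 X) + (of_bool (P4 h2 X) + (of_bool (P5 h2 X) :: real)))))"
        by (auto simp: of_bool_def)
    qed
    also have "\<dots> = expectH N r (\<lambda>h1. of_bool (P1 h1)) + (expectH N r (\<lambda>h2. of_bool (P2 h2)) + (expectH N r (\<lambda>h2. of_bool (P2' h2)) +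
         (expectH N r (\<lambda>h2. expectX N Q (\<lambda>X. of_bool (\<not> P2 h2 \<and> \<not> P2' h2 \<and> P3 h2 X))) +
         (expectH N r (\<lambda>h2. expectX N Q (\<lambda>X. of_bool (P4 h2 X))) + expectH N r (\<lambda>h2. expectX N Q (\<lambda>X. of_bool (P5 h2 X)))))))"
      unfolding expect_add expect_const[OF FX] expect_const[OF FH] ..
    also have "\<dots> \<le> 1/1000 + (1/1000 + (1/1000 + (1/1000 + (3/1000 + 1/1000))))"
    proof -
      have "expectH N r (\<lambda>h2. expectX N Q (\<lambda>X. of_bool (\<not> P2 h2 \<and> \<not> P2' h2 \<and> P3 h2 X))) \<le> 1/1000"
        by (intro expect_le_const[OF FH] e3)
      moreover have "expectH N r (\<lambda>h2. expectX N Q (\<lambda>X. of_bool (P4 h2 X))) \<le> 3/1000"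
        by (intro expect_le_const[OF FH] e4)
      ultimately show ?thesis by (intro add_mono e1 e2 e2' e5)
    qed
    finally have bad: "expect \<Omega> \<mu> (\<lambda>a. of_bool (\<not> good (sk a))) \<le> 8/1000" by simp
    have "expect \<Omega> \<mu> (\<lambda>a. of_bool (good (sk a))) = expect \<Omega> \<mu> (\<lambda>a. 1 - of_bool (\<not> good (sk a)))"
      by (intro expect_cong) auto
    also have "\<dots> = 1 - expect \<Omega> \<mu> (\<lambda>a. of_bool (\<not> good (sk a)))" unfolding expect_diff expect_const[OF F\<Omega>] ..
    finally have "0.99 \<le> measure Ms {m \<in> sk ` \<Omega>. good m}" using bad unfolding Ms(4) by simp
    moreover have "{m \<in> sk ` \<Omega>. good m} \<in> sets Ms" unfolding Ms(3) by auto
    ultimately show ?thesis unfolding good_def by blast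
  qed
  have "\<forall>P\<in>space Ms. sparse_rn_matrix (2 * r) n P"
    unfolding Ms(2) sk_def by (auto intro: sketch_sparse)
  then show ?thesis unfolding embeds_def r_def[symmetric] using Ms(1) event by blast
qed

theorem theorem3:
  shows "\<exists>c C :: real. c > 0 \<and> C > 0 \<and>
    (\<forall>d n :: nat. d \<ge> 2 \<longrightarrow> n \<ge> 1 \<longrightarrow>
      (\<exists>(r :: nat) (M :: (nat \<Rightarrow> nat \<Rightarrow> real) measure).
         real r \<le> C * real d ^ 2 \<and>
         prob_space M \<and>
         (\<forall>P \<in> space M. sparse_rn_matrix r n P) \<and>
         (\<forall>A :: nat \<Rightarrow> nat \<Rightarrow> real.
            \<exists>E \<in> sets M. measure M E \<ge> 0.99 \<and>
              (\<forall>P \<in> E. \<forall>x :: nat \<Rightarrow> real.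
                 c * ln (real d) * l1norm n (mat_vec d A x)
                   \<le> l1norm r (mat_vec n P (mat_vec d A x)) \<and>
                 l1norm r (mat_vec n P (mat_vec d A x))
                   \<le> C * real d * ln (real d) * l1norm n (mat_vec d A x)))))"
proof -
  obtain \<delta>0 where \<delta>0: "\<And>\<delta>. \<delta>0 \<le> \<delta> \<Longrightarrow> large \<delta>" using eventually_large unfolding eventually_at_top_linorder by blast
  define D where "D = max 2 (nat \<lceil>(max 1 \<delta>0) ^ 32\<rceil>)"
  have D2: "2 \<le> D" by (simp add: D_def)
  have big: "embeds d n (2 * (10 ^ 8 * d ^ 2)) (1 / 10 ^ 7 * ln (real d)) (2 * 10 ^ 12 * real d * ln (real d))" if d: "D \<le> d" for d n
  proof -
    define \<delta> where "\<delta> = real d powr (1/32)"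
    have d0: "0 < real d" using d D2 by simp
    have "\<delta> ^ 32 = \<delta> powr real 32" unfolding \<delta>_def using d0 by (subst powr_realpow) auto
    also have "\<dots> = real d" unfolding \<delta>_def powr_powr using d0 by simp
    finally have \<delta>d: "real d = \<delta> ^ 32" by simp
    have "(max 1 \<delta>0) ^ 32 \<le> real D" unfolding D_def by linarith
    also have "\<dots> \<le> \<delta> ^ 32" using d \<delta>d by simp
    finally have "(max 1 \<delta>0) ^ 32 \<le> \<delta> ^ 32" .
    then have "max 1 \<delta>0 \<le> \<delta>" by (rule power_le_imp_le_base[of _ 31, simplified]) (simp add: \<delta>_def)
    then have "large \<delta>" using \<delta>0 by simp
    then show ?thesis using \<delta>d by (rule embeds_large)
  qed
  \<comment> \<open>For \<open>d\<close> below \<open>D\<close> the embedding for \<open>D\<close>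
    columns is reused, and \<open>C\<close> has to absorb its \<open>D ^ 2\<close> rows and its
    distortion of order \<open>D * ln D\<close>.\<close>
  define C where "C = 2 * 10 ^ 12 * (real D)\<^sup>2 * (1 + ln (real D))"
  have lD: "0 \<le> ln (real D)" using D2 by simp
  have sq: "1 \<le> (real D)\<^sup>2" using D2 by (simp add: one_le_power)
  have C1: "2 * 10 ^ 12 * (real D)\<^sup>2 \<le> C"
  proof -
    have "2 * 10 ^ 12 * (real D)\<^sup>2 * 1 \<le> 2 * 10 ^ 12 * (real D)\<^sup>2 * (1 + ln (real D))" using lD by (intro mult_left_mono) auto
    then show ?thesis by (simp add: C_def)
  qed
  have C2: "2 * 10 ^ 12 \<le> C"
  proof -
    have "2 * 10 ^ 12 * 1 \<le> 2 * 10 ^ 12 * (real D)\<^sup>2" using sq by (intro mult_left_mono) auto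
    also note C1
    finally show ?thesis by simp
  qed
  have main: "\<exists>r. real r \<le> C * real d ^ 2 \<and> embeds d n r (1 / 10 ^ 7 * ln (real d)) (C * real d * ln (real d))" if d: "2 \<le> d" for d n
  proof (cases "D \<le> d")
    case True
    have "2 * 10 ^ 8 * real d ^ 2 \<le> C * real d ^ 2" using C2 by (intro mult_right_mono) auto
    then have "real (2 * (10 ^ 8 * d ^ 2)) \<le> C * real d ^ 2" by simp
    moreover have "2 * 10 ^ 12 * real d * ln (real d) \<le> C * real d * ln (real d)" using C2 d by (intro mult_right_mono) auto
    ultimately show ?thesis using embeds_mono[OF big[OF True, of n] order_refl] by blast
  next
    case False
    then have dD: "d \<le> D" by simp
    have "1 \<le> (real d)\<^sup>2" using d by (simp add: one_le_power)
    then have "C * 1 \<le> C * (real d)\<^sup>2" using C2 by (intro mult_left_mono) auto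
    moreover have "2 * 10 ^ 8 * (real D)\<^sup>2 \<le> 2 * 10 ^ 12 * (real D)\<^sup>2" by (intro mult_right_mono) auto
    ultimately have "2 * 10 ^ 8 * (real D)\<^sup>2 \<le> C * (real d)\<^sup>2" using C1 by (metis mult.right_neutral order_trans)
    then have r: "real (2 * (10 ^ 8 * D ^ 2)) \<le> C * real d ^ 2" by simp
    have lo: "1 / 10 ^ 7 * ln (real d) \<le> 1 / 10 ^ 7 * ln (real D)" using dD d by simp
    \<comment> \<open>For small \<open>d\<close> the required upper bound must still be at least
      \<open>C\<close>; this is where \<open>2 \<le> d\<close> enters.\<close>
    have "1 \<le> real d * ln (real d)"
    proof -
      have "ln 2 \<le> ln (real d)" using d by simp
      then have "1/2 \<le> ln (real d)" using ln2_ge_two_thirds by linarith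
      then have "2 * (1/2) \<le> real d * ln (real d)" using d by (intro mult_mono) auto
      then show ?thesis by simp
    qed
    then have "C * 1 \<le> C * (real d * ln (real d))" using C2 by (intro mult_left_mono) auto
    moreover have "2 * 10 ^ 12 * real D * ln (real D) \<le> C"
    proof -
      have "real D * ln (real D) \<le> (real D)\<^sup>2 * (1 + ln (real D))"
        using lD D2 by (intro mult_mono) (auto simp: power2_eq_square)
      then show ?thesis by (simp add: C_def)
    qed
    ultimately have hi: "2 * 10 ^ 12 * real D * ln (real D) \<le> C * real d * ln (real d)" by (simp add: mult_ac)
    show ?thesis using r embeds_mono[OF embeds_fewer_columns[OF big[OF order_refl, of n] dD] lo hi] by blast
  qed
  show ?thesis
  proof (rule exI[of _ "1 / 10 ^ 7"], rule exI[of _ C], intro conjI allI impI)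
    show "0 < C" using C2 by simp
    fix d n :: nat assume "2 \<le> d"
    from main[OF this, of n] show "\<exists>r M. real r \<le> C * real d ^ 2 \<and> prob_space M \<and>
         (\<forall>P \<in> space M. sparse_rn_matrix r n P) \<and>
         (\<forall>A :: nat \<Rightarrow> nat \<Rightarrow> real.
            \<exists>E \<in> sets M. measure M E \<ge> 0.99 \<and>
              (\<forall>P \<in> E. \<forall>x :: nat \<Rightarrow> real.
                 1 / 10 ^ 7 * ln (real d) * l1norm n (mat_vec d A x)
                   \<le> l1norm r (mat_vec n P (mat_vec d A x)) \<and>
                 l1norm r (mat_vec n P (mat_vec d A x))
                   \<le> C * real d * ln (real d) * l1norm n (mat_vec d A x)))"
      unfolding embeds_def by blast
  qed simp
qed

end
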